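(* Let $0\le\delta<\rho\le1$ and $m>0$. Let $P\in\mathrm{Op}_{\hbar\mathbb{Z}^n}S^{2m}_{\rho,\delta}(\hbar\mathbb{Z}^n\times\mathbb{T}^n)$ be an elliptic semi-classical pseudo-differential operator (of order $2m$) such that $\sigma_{\hbar,P}(k,\theta)\ge0$ for all $\theta\in\mathbb{T}^n$ and for co-finitely many $k\in\hbar\mathbb{Z}^n$. Then there exist $C_0,C_1>0$ such that for all $g\in\ell^2_m(\hbar\mathbb{Z}^n)$ we have $$\mathrm{Re}\,(Pg,g)_{\ell^2(\hbar\mathbb{Z}^n)}\ge C_0\|g\|^2_{\ell^2_m(\hbar\mathbb{Z}^n)}-C_1\|g\|^2_{\ell^2(\hbar\mathbb{Z}^n)}.$$
   Context: Fix $n\ge1$ and $\hbar\in(0,1]$. $\hbar\mathbb{Z}^n=\{\hbar\bar k:\bar k\in\mathbb{Z}^n\}\subset\mathbb{R}^n$, $|k|$ is the Euclidean norm, $\mathbb{T}^n=\mathbb{R}^n/\mathbb{Z}^n$ with normalized Haar measure, $k\cdot\theta=\sum_jk_j\theta_j$. Semi-classical Fourier transform: $\widehat f(\theta)=\sum_{k\in\hbar\mathbb{Z}^n}e^{-2\pi\frac{i}{\hbar}k\cdot\theta}f(k)$. Quantization: $\mathrm{Op}_{\hbar\mathbb{Z}^n}(\sigma_\hbar)f(k)=\int_{\mathbb{T}^n}e^{2\pi\frac{i}{\hbar}k\cdot\theta}\sigma_\hbar(k,\theta)\widehat f(\theta)\,d\theta=\sum_{l\in\hbar\mathbb{Z}^n}K(k,l)f(l)$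 with $K(k,l)=\int_{\mathbb{T}^n}e^{2\pi\frac{i}{\hbar}(k-l)\cdot\theta}\sigma_\hbar(k,\theta)\,d\theta$; $\sigma_{\hbar,P}$ denotes the symbol of $P$. Difference operators: with $v_j$ the $j$-th standard unit vector, $\Delta_{\hbar,j}g(k)=\frac{g(k+\hbar v_j)-g(k)}{\hbar}$, $\Delta_\hbar^\alpha=\Delta_{\hbar,1}^{\alpha_1}\cdots\Delta_{\hbar,n}^{\alpha_n}$. Toroidal operators: $D_{\hbar,\theta}^{(\beta)}=\hbar^{|\beta|}\prod_{j=1}^n\prod_{\ell=0}^{\beta_j-1}\big(\frac{1}{2\pi i}\frac{\partial}{\partial\theta_j}-\ell\big)$. $S^\mu_{\rho,\delta}(\hbar\mathbb{Z}^n\times\mathbb{T}^n)$ is the set of $\sigma_\hbar:\hbar\mathbb{Z}^n\times\mathbb{T}^n\to\mathbb{C}$, smooth in $\theta$, such that for all $\alpha,\beta\in\mathbb{N}_0^n$ there is $C_{\alpha,\beta}$ with $|D^{(\beta)}_{\hbar,\theta}\Delta^\alpha_{\hbar,k}\sigma_\hbar(k,\theta)|\le C_{\alpha,\beta}(1+|k|)^{\mu-\rho|\alpha|+\delta|\beta|}$ for all $(k,\theta)$. A symbol $\sigma_\hbar\in S^\mu_{\rho,\delta}$ (and its operator) is elliptic of order $\mu$ if there are $C,M>0$ with $|\sigma_\hbar(k,\theta)|\ge C(1+|k|)^\mu$ for all $\theta$ and all $|k|\ge M$. Weighted space: $\ell^2_s(\hbar\mathbb{Z}^n)$ is the space of $f:\hbar\mathbb{Z}^n\to\mathbb{C}$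 with $\|f\|_{\ell^2_s}=\big(\sum_k(1+|k|)^{2s}|f(k)|^2\big)^{1/2}<\infty$. $(f,g)_{\ell^2}=\sum_kf(k)\overline{g(k)}$; for $g\in\ell^2_m$ the pairing $(Pg,g)$ is the one between $\ell^2_{-m}$ and $\ell^2_m$. *)

theory Defs
  imports "HOL-Analysis.Analysis"
begin

text \<open>The dimension is \<^term>\<open>CARD('n)\<close>. Functions on the lattice are total functions on
  \<^typ>\<open>real ^ 'n\<close> whose values off the lattice are never used; functions on the torus are
  \<open>\<int>\<^sup>n\<close>-periodic functions on \<^typ>\<open>real ^ 'n\<close>, and the Haar integral is the integral over
  the unit cube.\<close>

definition hlattice :: "real \<Rightarrow> (real ^ 'n::finite) set" where
  "hlattice h = {h *\<^sub>R k | k. \<forall>j. k $ j \<in> \<int>}"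

definition torus_periodic :: "(real ^ 'n::finite \<Rightarrow> 'a) \<Rightarrow> bool" where
  "torus_periodic f \<longleftrightarrow> (\<forall>j \<theta>. f (\<theta> + axis j 1) = f \<theta>)"

definition partial_deriv :: "'n::finite \<Rightarrow> (real ^ 'n \<Rightarrow> complex) \<Rightarrow> real ^ 'n \<Rightarrow> complex" where
  "partial_deriv j f \<theta> = vector_derivative (\<lambda>t. f (\<theta> + t *\<^sub>R axis j 1)) (at 0)"

primrec C_k :: "nat \<Rightarrow> (real ^ 'n::finite \<Rightarrow> complex) \<Rightarrow> bool" where
  "C_k 0 f \<longleftrightarrow> continuous_on UNIV f"
| "C_k (Suc N) f \<longleftrightarrow> (\<forall>\<theta>. f differentiable (at \<theta>)) \<and> (\<forall>j. C_k N (partial_deriv j f))"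

definition smooth_fun :: "(real ^ 'n::finite \<Rightarrow> complex) \<Rightarrow> bool" where
  "smooth_fun f \<longleftrightarrow> (\<forall>N. C_k N f)"

text \<open>Multi-indices are functions \<open>'n \<Rightarrow> nat\<close>. A product over all coordinates of operators is
  a composition along an arbitrary enumeration of the coordinates. The choice does not matter:
  difference operators commute, and so do partial derivatives of smooth functions.\<close>

definition coords :: "'n::finite list" where
  "coords = (SOME js. distinct js \<and> set js = UNIV)"

lemma coords: "distinct (coords :: 'n::finite list)" "set (coords :: 'n::finite list) = UNIV"
proof -
  have "\<exists>js :: 'n list. distinct js \<and> set js = UNIV"
    using finite_distinct_list[of "UNIV :: 'n set"] by auto
  from someI_ex[OF this] show "distinct (coords :: 'n list)" "set (coords :: 'n list) = UNIV"
    by (auto simp: coords_def)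
qed

definition mi_size :: "('n::finite \<Rightarrow> nat) \<Rightarrow> nat" where
  "mi_size \<alpha> = (\<Sum>j\<in>UNIV. \<alpha> j)"

definition diff_op :: "real \<Rightarrow> 'n::finite \<Rightarrow> (real ^ 'n \<Rightarrow> complex) \<Rightarrow> real ^ 'n \<Rightarrow> complex" where
  "diff_op h j g k = (g (k + h *\<^sub>R axis j 1) - g k) / of_real h"

definition Diff_op ::
  "real \<Rightarrow> ('n::finite \<Rightarrow> nat) \<Rightarrow> (real ^ 'n \<Rightarrow> complex) \<Rightarrow> real ^ 'n \<Rightarrow> complex" where
  "Diff_op h \<alpha> g = foldr (\<lambda>j. diff_op h j ^^ \<alpha> j) coords g"

text \<open>The factor \<open>h\<^sup>|\<^sup>\<beta>\<^sup>|\<close> of the toroidal operator is distributed over its \<open>|\<beta>|\<close> first-order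
  factors.\<close>

primrec tor_op ::
  "real \<Rightarrow> 'n::finite \<Rightarrow> nat \<Rightarrow> (real ^ 'n \<Rightarrow> complex) \<Rightarrow> real ^ 'n \<Rightarrow> complex" where
  "tor_op h j 0 f = f"
| "tor_op h j (Suc l) f = (\<lambda>\<theta>. of_real h *
     (1 / (2 * of_real pi * \<i>) * partial_deriv j (tor_op h j l f) \<theta> - of_nat l * tor_op h j l f \<theta>))"

definition Tor_op ::
  "real \<Rightarrow> ('n::finite \<Rightarrow> nat) \<Rightarrow> (real ^ 'n \<Rightarrow> complex) \<Rightarrow> real ^ 'n \<Rightarrow> complex" where
  "Tor_op h \<beta> f = foldr (\<lambda>j. tor_op h j (\<beta> j)) coords f"

definition symbol_class ::
  "real \<Rightarrow> real \<Rightarrow> real \<Rightarrow> real \<Rightarrow> (real ^ 'n::finite \<Rightarrow> real ^ 'n \<Rightarrow> complex) set" where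
  "symbol_class h \<mu> \<rho> \<delta> = {\<sigma>.
     (\<forall>k\<in>hlattice h. torus_periodic (\<sigma> k) \<and> smooth_fun (\<sigma> k)) \<and>
     (\<forall>\<alpha> \<beta>. \<exists>C. \<forall>k\<in>hlattice h. \<forall>\<theta>.
        cmod (Tor_op h \<beta> (\<lambda>\<theta>'. Diff_op h \<alpha> (\<lambda>k'. \<sigma> k' \<theta>') k) \<theta>)
          \<le> C * (1 + norm k) powr (\<mu> - \<rho> * real (mi_size \<alpha>) + \<delta> * real (mi_size \<beta>)))}"

definition elliptic_symbol ::
  "real \<Rightarrow> real \<Rightarrow> (real ^ 'n::finite \<Rightarrow> real ^ 'n \<Rightarrow> complex) \<Rightarrow> bool" where
  "elliptic_symbol h \<mu> \<sigma> \<longleftrightarrow> (\<exists>C>0. \<exists>M>0. \<forall>k\<in>hlattice h. \<forall>\<theta>.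
     norm k \<ge> M \<longrightarrow> cmod (\<sigma> k \<theta>) \<ge> C * (1 + norm k) powr \<mu>)"

definition op_kernel ::
  "real \<Rightarrow> (real ^ 'n::finite \<Rightarrow> real ^ 'n \<Rightarrow> complex) \<Rightarrow> real ^ 'n \<Rightarrow> real ^ 'n \<Rightarrow> complex" where
  "op_kernel h \<sigma> k l =
     (LINT \<theta>:cbox 0 1|lborel. exp (2 * of_real pi * (\<i> / of_real h) * of_real ((k - l) \<bullet> \<theta>)) * \<sigma> k \<theta>)"

text \<open>The kernel form of the quantization is taken as the definition because it makes sense on
  every weighted space: for smooth symbols each row of the kernel decays rapidly, so the
  series converges absolutely there, whereas the Fourier series of such an \<open>f\<close> need
  not converge pointwise. \<open>Op_eq_fourier\<close> below is the agreement with the Fourier form.\<close>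

definition Op ::
  "real \<Rightarrow> (real ^ 'n::finite \<Rightarrow> real ^ 'n \<Rightarrow> complex) \<Rightarrow>
     (real ^ 'n \<Rightarrow> complex) \<Rightarrow> real ^ 'n \<Rightarrow> complex" where
  "Op h \<sigma> f k = (\<Sum>\<^sub>\<infinity>l\<in>hlattice h. op_kernel h \<sigma> k l * f l)"

definition sc_fourier :: "real \<Rightarrow> (real ^ 'n::finite \<Rightarrow> complex) \<Rightarrow> real ^ 'n \<Rightarrow> complex" where
  "sc_fourier h f \<theta> =
     (\<Sum>\<^sub>\<infinity>k\<in>hlattice h. exp (- 2 * of_real pi * (\<i> / of_real h) * of_real (k \<bullet> \<theta>)) * f k)"

lemma Op_eq_fourier:
  fixes \<sigma> :: "real ^ 'n::finite \<Rightarrow> real ^ 'n \<Rightarrow> complex"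
  assumes cont: "continuous_on UNIV (\<sigma> k)"
    and summ: "(\<lambda>l. cmod (f l)) summable_on hlattice h"
  shows "Op h \<sigma> f k = (LINT \<theta>:cbox 0 1|lborel.
     exp (2 * of_real pi * (\<i> / of_real h) * of_real (k \<bullet> \<theta>)) * \<sigma> k \<theta> * sc_fourier h f \<theta>)"
proof -
  define Q where "Q = cbox (0 :: real ^ 'n) 1"
  define L where "L = (hlattice h :: (real ^ 'n) set)"
  define E where "E c \<theta> = exp (2 * of_real pi * (\<i> / of_real h) * of_real (c \<bullet> \<theta>))"
    for c \<theta> :: "real ^ 'n"
  have normE: "norm (E c \<theta>) = 1" for c \<theta>
    unfolding E_def norm_exp_eq_Re by (simp add: complex_eq_iff Re_divide)
  have contE: "continuous_on S (E c)" for S c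
    unfolding E_def by (intro continuous_intros)
  define F where "F X \<theta> = (\<Sum>l\<in>X. E k \<theta> * \<sigma> k \<theta> * (E (-l) \<theta> * f l))" for X \<theta>
  have contQ: "continuous_on Q (\<sigma> k)"
    using cont continuous_on_subset by blast
  have uni0: "uniform_limit Q (\<lambda>X \<theta>. \<Sum>l\<in>X. E (-l) \<theta> * f l)
        (\<lambda>\<theta>. \<Sum>\<^sub>\<infinity>l\<in>L. E (-l) \<theta> * f l) (finite_subsets_at_top L)"
    by (rule Weierstrass_m_test_general[where M = "\<lambda>l. norm (f l)"])
       (use summ in \<open>auto simp: norm_mult normE L_def\<close>)
  have sc: "sc_fourier h f \<theta> = (\<Sum>\<^sub>\<infinity>l\<in>L. E (-l) \<theta> * f l)" for \<theta>
    unfolding sc_fourier_def E_def L_def by simp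
  have "bounded ((\<lambda>\<theta>. E k \<theta> * \<sigma> k \<theta>) ` Q)"
    unfolding Q_def
    by (intro compact_imp_bounded compact_continuous_image continuous_intros contE
        contQ[unfolded Q_def] compact_cbox)
  then obtain B where B: "\<And>\<theta>. \<theta> \<in> Q \<Longrightarrow> norm (E k \<theta> * \<sigma> k \<theta>) \<le> B"
    unfolding bounded_iff by blast
  have uni: "uniform_limit Q F (\<lambda>\<theta>. E k \<theta> * \<sigma> k \<theta> * sc_fourier h f \<theta>) (finite_subsets_at_top L)"
  proof -
    have "uniform_limit Q (\<lambda>X \<theta>. E k \<theta> * \<sigma> k \<theta> * (\<Sum>l\<in>X. E (-l) \<theta> * f l))
       (\<lambda>\<theta>. E k \<theta> * \<sigma> k \<theta> * sc_fourier h f \<theta>) (finite_subsets_at_top L)"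
    proof (rule uniform_limitI)
      fix e :: real assume e: "e > 0"
      define B' where "B' = max B 1"
      have B': "B' > 0" "B \<le> B'" by (auto simp: B'_def)
      have "\<forall>\<^sub>F X in finite_subsets_at_top L. \<forall>\<theta>\<in>Q.
          dist (\<Sum>l\<in>X. E (-l) \<theta> * f l) (\<Sum>\<^sub>\<infinity>l\<in>L. E (-l) \<theta> * f l) < e / B'"
        by (rule uniform_limitD[OF uni0]) (rule divide_pos_pos[OF e B'(1)])
      then show "\<forall>\<^sub>F X in finite_subsets_at_top L. \<forall>\<theta>\<in>Q.
          dist (E k \<theta> * \<sigma> k \<theta> * (\<Sum>l\<in>X. E (-l) \<theta> * f l)) (E k \<theta> * \<sigma> k \<theta> * sc_fourier h f \<theta>) < e"
      proof (rule eventually_mono, intro ballI)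
        fix X \<theta>
        assume *: "\<forall>\<theta>\<in>Q. dist (\<Sum>l\<in>X. E (-l) \<theta> * f l) (\<Sum>\<^sub>\<infinity>l\<in>L. E (-l) \<theta> * f l) < e / B'"
          and \<theta>: "\<theta> \<in> Q"
        let ?d = "dist (\<Sum>l\<in>X. E (-l) \<theta> * f l) (\<Sum>\<^sub>\<infinity>l\<in>L. E (-l) \<theta> * f l)"
        have "dist (E k \<theta> * \<sigma> k \<theta> * (\<Sum>l\<in>X. E (-l) \<theta> * f l)) (E k \<theta> * \<sigma> k \<theta> * sc_fourier h f \<theta>)
            = norm (E k \<theta> * \<sigma> k \<theta>) * ?d"
          unfolding sc dist_norm right_diff_distrib[symmetric] by (rule norm_mult)
        also have "\<dots> \<le> B' * ?d"
          by (rule mult_right_mono[OF order_trans[OF B[OF \<theta>] B'(2)] zero_le_dist])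
        also have "\<dots> < e"
          using bspec[OF * \<theta>] B'(1) by (simp add: pos_less_divide_eq mult.commute)
        finally show "dist (E k \<theta> * \<sigma> k \<theta> * (\<Sum>l\<in>X. E (-l) \<theta> * f l))
            (E k \<theta> * \<sigma> k \<theta> * sc_fourier h f \<theta>) < e" .
      qed
    qed
    then show ?thesis unfolding F_def sum_distrib_left .
  qed
  have contF: "continuous_on Q (F X)" for X
    unfolding F_def by (intro continuous_intros contE contQ)
  have LI: "(LINT \<theta>:Q|lborel. u \<theta>) = integral Q u" if "continuous_on Q u"
    for u :: "real ^ 'n \<Rightarrow> complex"
    by (rule set_borel_integral_eq_integral(2))
       (use that in \<open>simp add: set_integrable_def borel_integrable_compact Q_def\<close>)
  have "((\<lambda>X. integral Q (F X)) \<longlongrightarrow>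
      integral Q (\<lambda>\<theta>. E k \<theta> * \<sigma> k \<theta> * sc_fourier h f \<theta>)) (finite_subsets_at_top L)"
  proof -
    obtain I J where I: "\<And>X. (F X has_integral I X) Q"
      and J: "((\<lambda>\<theta>. E k \<theta> * \<sigma> k \<theta> * sc_fourier h f \<theta>) has_integral J) Q"
      and IJ: "(I \<longlongrightarrow> J) (finite_subsets_at_top L)"
      using uniform_limit_integral_cbox[OF uni[unfolded Q_def] contF[unfolded Q_def]
        finite_subsets_at_top_neq_bot] unfolding Q_def by metis
    show ?thesis
      using IJ by (simp only: integral_unique[OF I] integral_unique[OF J])
  qed
  moreover have "integral Q (F X) = (\<Sum>l\<in>X. op_kernel h \<sigma> k l * f l)" if "finite X" for X
  proof -
    have EE: "E k \<theta> * \<sigma> k \<theta> * (E (-l) \<theta> * f l) = E (k - l) \<theta> * \<sigma> k \<theta> * f l" for l \<theta>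
    proof -
      have "E (k - l) \<theta> = E k \<theta> * E (-l) \<theta>"
        unfolding E_def exp_add[symmetric] by (simp add: inner_diff_left algebra_simps diff_divide_distrib)
      then show ?thesis by simp
    qed
    have ker: "op_kernel h \<sigma> k l = integral Q (\<lambda>\<theta>. E (k - l) \<theta> * \<sigma> k \<theta>)" for l
      unfolding op_kernel_def Q_def[symmetric] E_def[symmetric]
      by (rule LI) (intro continuous_intros contE contQ)
    have int: "(\<lambda>\<theta>. E (k - l) \<theta> * \<sigma> k \<theta> * f l) integrable_on Q" for l
      unfolding Q_def
      by (intro integrable_continuous continuous_intros contE contQ[unfolded Q_def])
    show ?thesis
      unfolding F_def EE ker using that int by (simp add: integral_sum)
  qed
  then have "\<forall>\<^sub>F X in finite_subsets_at_top L. integral Q (F X) = (\<Sum>l\<in>X. op_kernel h \<sigma> k l * f l)"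
    by (intro eventually_finite_subsets_at_top_weakI) auto
  ultimately have "((\<lambda>l. op_kernel h \<sigma> k l * f l) has_sum
      integral Q (\<lambda>\<theta>. E k \<theta> * \<sigma> k \<theta> * sc_fourier h f \<theta>)) L"
    unfolding has_sum_def using Lim_transform_eventually by fast
  then have "Op h \<sigma> f k = integral Q (\<lambda>\<theta>. E k \<theta> * \<sigma> k \<theta> * sc_fourier h f \<theta>)"
    unfolding Op_def L_def[symmetric] by (rule infsumI)
  also have "\<dots> = (LINT \<theta>:Q|lborel. E k \<theta> * \<sigma> k \<theta> * sc_fourier h f \<theta>)"
  proof (rule LI[symmetric])
    show "continuous_on Q (\<lambda>\<theta>. E k \<theta> * \<sigma> k \<theta> * sc_fourier h f \<theta>)"
      by (rule uniform_limit_theorem[OF _ uni]) (auto simp: contF)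
  qed
  finally show ?thesis unfolding Q_def E_def .
qed

definition l2s :: "real \<Rightarrow> real \<Rightarrow> (real ^ 'n::finite \<Rightarrow> complex) set" where
  "l2s h s = {f. (\<lambda>k. (1 + norm k) powr (2 * s) * (cmod (f k))\<^sup>2) summable_on hlattice h}"

definition l2s_norm :: "real \<Rightarrow> real \<Rightarrow> (real ^ 'n::finite \<Rightarrow> complex) \<Rightarrow> real" where
  "l2s_norm h s f = sqrt (\<Sum>\<^sub>\<infinity>k\<in>hlattice h. (1 + norm k) powr (2 * s) * (cmod (f k))\<^sup>2)"

definition l2_pairing ::
  "real \<Rightarrow> (real ^ 'n::finite \<Rightarrow> complex) \<Rightarrow> (real ^ 'n \<Rightarrow> complex) \<Rightarrow> complex" where
  "l2_pairing h f g = (\<Sum>\<^sub>\<infinity>k\<in>hlattice h. f k * cnj (g k))"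

end

theory Submission imports Defs begin

text \<open>
  A frozen symbol \<open>\<sigma>(p, \<theta>)\<close> quantizes to a convolution, i.e. to multiplication by \<open>\<sigma>(p, \<cdot>)\<close> on
  the torus. Its operator norm is at most the supremum norm, and its form is bounded below by the
  infimum, without any loss of derivatives. The kernel of the operator is concentrated on
  \<open>|k - l| \<lesssim> |k|\<^sup>\<delta>\<close>, whereas \<open>\<sigma>\<close> is nearly constant in \<open>k\<close> on sets of diameter
  \<open>|k|\<^sup>\<tau>\<close> if \<open>\<tau> < \<rho>\<close>. With \<open>\<delta> < \<tau> < \<rho>\<close> one cuts the lattice into cells of diameter
  \<open>|k|\<^sup>\<tau>\<close>: these are the preimages of unit cubes under \<open>k \<mapsto> (1 + |k|)\<^sup>-\<^sup>\<tau> k\<close>. Freezing \<open>\<sigma>\<close> in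
  a cell causes a relative error of size \<open>|k|\<close> to the power \<open>\<tau> - \<rho>\<close>, by summation of mixed differences over a
  box. Interactions between different cells are either far from the diagonal, hence bounded on
  \<open>\<ell>\<^sup>2\<close> by Schur's test, or take place near the cell boundaries, and a translate of the cell
  partition can be chosen such that the boundary region carries a small fraction of the norm.
\<close>

subsection \<open>Fourier coefficients of smooth periodic functions\<close>

text \<open>A block coupling neighbouring cells is only bounded at the full order 2m. It is not of
  lower order, so it must be made small by the choice of the partition and not by decay. This
  succeeds because the bound on such blocks is uniform in the shift: the number of shifts is fixed
  from that bound and the ellipticity constant, and only the far part, whose constant depends on
  this number, is charged to the subtracted \<ell>^2 norm. Two facts make freezing cheap. The symbol
  depends on the row index only, so discrete summation over a box puts indicator functions on the
  row function, which cannot increase its norm, and one difference per coordinate suffices. The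
  weight (1 + |k|)^(2m) is constant up to a factor on a cell, so unweighted bounds there become
  weighted ones. Since \<tau> < 1, the map defining the cells distorts distances near k by the
  factor (1 + |k|)^(-\<tau>), up to constants, in both directions. All estimates are for finite
  sums; the pairing is an iterated sum, reached by letting the columns exhaust the lattice before
  the rows.\<close>

lemma set_lebesgue_integral_cbox_eq_integral:
  fixes u :: "'a::euclidean_space \<Rightarrow> 'b::euclidean_space"
  assumes "continuous_on (cbox a b) u"
  shows "(LINT \<theta>:cbox a b|lborel. u \<theta>) = integral (cbox a b) u"
  by (rule set_borel_integral_eq_integral(2))
     (use assms in \<open>simp add: set_integrable_def borel_integrable_compact\<close>)

text \<open>The translated cube is cut where the j-th coordinate is 1. The piece that sticks out is
  the translate by a unit vector of the slab of width \<open>t\<close> that was left uncovered, and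
  periodicity moves it back.\<close>

lemma integral_periodic_shift:
  fixes F :: "real ^ 'n::finite \<Rightarrow> 'b::banach"
  assumes cont: "continuous_on UNIV F"
    and per: "\<And>\<theta>. F (\<theta> + axis j 1) = F \<theta>"
    and t: "0 \<le> t" "t \<le> 1"
  shows "integral (cbox 0 1) (\<lambda>\<theta>. F (\<theta> + t *\<^sub>R axis j 1)) = integral (cbox 0 1) F"
proof -
  let ?e = "axis j 1 :: real ^ 'n"
  have e: "?e \<in> Basis" by (simp add: axis_in_Basis_iff)
  have int: "F integrable_on cbox u v" for u v
    by (rule integrable_continuous) (use cont continuous_on_subset in blast)
  have split: "integral (cbox u v) F =
      integral (cbox u v \<inter> {x. x \<bullet> ?e \<le> c}) F + integral (cbox u v \<inter> {x. x \<bullet> ?e \<ge> c}) F"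
    for u v c
    by (rule integral_unique, rule has_integral_split[OF _ _ e, where c = c])
       (simp_all add: interval_split[OF e] int integrable_integral)
  have shift: "integral (cbox u v) (\<lambda>\<theta>. F (\<theta> + w)) = integral (cbox (u + w) (v + w)) F" for u v w
    using integral_shift_cbox_plus[of u v F w] by (simp add: o_def add.commute)
  have ax: "axis j 1 $ i = (if i = j then 1 else 0 :: real)" for i
    by (simp add: axis_def)
  have box: "x \<in> cbox u v \<longleftrightarrow>
      (u $ j \<le> x $ j \<and> x $ j \<le> v $ j) \<and> (\<forall>i. i \<noteq> j \<longrightarrow> u $ i \<le> x $ i \<and> x $ i \<le> v $ i)"
    for x u v :: "real ^ 'n"
    unfolding mem_box_cart by metis
  have 1: "cbox (t *\<^sub>R ?e) (1 + t *\<^sub>R ?e) \<inter> {x. x \<bullet> ?e \<le> 1} = cbox 0 1 \<inter> {x. x \<bullet> ?e \<ge> t}"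
    using t by (auto simp: box inner_axis ax)
  have "cbox (t *\<^sub>R ?e) (1 + t *\<^sub>R ?e) \<inter> {x. x \<bullet> ?e \<ge> 1}
      = cbox ?e (\<chi> i. if i = j then 1 + t else 1)"
    using t by (auto simp: box inner_axis ax)
  also have "\<dots> = cbox (0 + ?e) ((\<chi> i. if i = j then t else 1) + ?e)"
    by (rule arg_cong2[of _ _ _ _ cbox]) (auto simp: vec_eq_iff axis_def)
  finally have 2: "cbox (t *\<^sub>R ?e) (1 + t *\<^sub>R ?e) \<inter> {x. x \<bullet> ?e \<ge> 1}
      = cbox (0 + ?e) ((\<chi> i. if i = j then t else 1) + ?e)" .
  have 3: "cbox 0 1 \<inter> {x. x \<bullet> ?e \<le> t} = cbox 0 (\<chi> i. if i = j then t else 1)"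
    using t by (auto simp: box inner_axis ax)
  have "integral (cbox 0 1) (\<lambda>\<theta>. F (\<theta> + t *\<^sub>R ?e))
      = integral (cbox (t *\<^sub>R ?e) (1 + t *\<^sub>R ?e)) F"
    by (subst shift) simp
  also have "\<dots> = integral (cbox 0 1 \<inter> {x. x \<bullet> ?e \<ge> t}) F
      + integral (cbox 0 (\<chi> i. if i = j then t else 1)) (\<lambda>\<theta>. F (\<theta> + ?e))"
    by (subst split[of _ _ 1]) (simp only: 1 2 shift)
  also have "\<dots> = integral (cbox 0 1) F"
    by (subst split[of 0 1 t]) (simp only: per 3 add.commute)
  finally show ?thesis .
qed

lemma has_vector_derivative_partial_deriv:
  assumes "f differentiable (at (\<theta> + x *\<^sub>R axis j 1))"
  shows "((\<lambda>t. f (\<theta> + t *\<^sub>R axis j 1)) has_vector_derivative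
            partial_deriv j f (\<theta> + x *\<^sub>R axis j 1)) (at x within S)"
proof -
  define \<xi> where "\<xi> = \<theta> + x *\<^sub>R axis j 1"
  obtain f' where f': "(f has_derivative f') (at \<xi>)"
    using assms unfolding \<xi>_def differentiable_def by blast
  have *: "((\<lambda>t. f (u + t *\<^sub>R axis j 1)) has_vector_derivative f' (axis j 1)) (at s)"
    if "u + s *\<^sub>R axis j 1 = \<xi>" for u s
  proof -
    have "((\<lambda>t. f (u + t *\<^sub>R axis j 1)) has_derivative (\<lambda>t. f' (t *\<^sub>R axis j 1))) (at s)"
      by (rule has_derivative_compose[of "\<lambda>t. u + t *\<^sub>R axis j 1", OF _ f'[folded that]])
         (auto intro!: derivative_eq_intros)
    then show ?thesis
      unfolding has_vector_derivative_def
      using has_derivative_linear[OF f'] by (simp add: linear_cmul)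
  qed
  have "partial_deriv j f \<xi> = f' (axis j 1)"
    unfolding partial_deriv_def by (rule vector_derivative_at) (rule *, simp)
  then show ?thesis
    using *[of \<theta> x] by (auto simp: \<xi>_def intro: has_vector_derivative_at_within)
qed

text \<open>The integral of the translate of \<open>F\<close> along the j-th axis does not depend on
  the translation, so differentiating under the integral sign at 0 gives the claim without Fubini.
  The derivative is one-sided because \<open>integral_periodic_shift\<close> covers \<open>t\<close>
  in \<open>{0..1}\<close>.\<close>

lemma integral_partial_deriv_periodic:
  fixes F :: "real ^ 'n::finite \<Rightarrow> complex"
  assumes per: "torus_periodic F"
    and diff: "\<And>\<theta>. F differentiable (at \<theta>)"
    and cont: "continuous_on UNIV (partial_deriv j F)"
  shows "integral (cbox 0 1) (partial_deriv j F) = 0"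
proof -
  have contF: "continuous_on UNIV F"
    using diff by (simp add: continuous_at_imp_continuous_on differentiable_imp_continuous_within)
  let ?I = "\<lambda>t. integral (cbox 0 1) (\<lambda>\<theta>. F (\<theta> + t *\<^sub>R axis j 1))"
  have d: "(?I has_vector_derivative
      integral (cbox 0 1) (\<lambda>\<theta>. partial_deriv j F (\<theta> + 0 *\<^sub>R axis j 1))) (at 0 within {0..1})"
  proof (rule leibniz_rule_vector_derivative)
    show "(\<lambda>\<theta>. F (\<theta> + x *\<^sub>R axis j 1)) integrable_on cbox 0 1" for x
      by (intro integrable_continuous continuous_on_compose2[OF contF] continuous_intros) auto
    show "continuous_on ({0..1} \<times> cbox 0 1)
        (\<lambda>(x, \<theta>). partial_deriv j F (\<theta> + x *\<^sub>R axis j 1))"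
      unfolding case_prod_beta
      by (intro continuous_on_compose2[OF cont] continuous_intros) auto
  qed (auto intro!: has_vector_derivative_partial_deriv diff)
  have "?I t = integral (cbox 0 1) F" if "t \<in> {0..1}" for t
    by (rule integral_periodic_shift[OF contF]) (use per that in \<open>auto simp: torus_periodic_def\<close>)
  then have "(?I has_vector_derivative 0) (at 0 within {0..1})"
    by (subst has_vector_derivative_transform[where f = "\<lambda>_. integral (cbox 0 1) F"]) auto
  then have "integral (cbox 0 1) (\<lambda>\<theta>. partial_deriv j F (\<theta> + 0 *\<^sub>R axis j 1)) = 0"
    using d vector_derivative_unique_within[of 0 "{0..1::real}" ?I]
    by (metis (no_types, lifting) at_within_Icc_at_right trivial_limit_at_right_real zero_less_one)
  then show ?thesis by simp
qed

definition osc :: "real \<Rightarrow> real ^ 'n::finite \<Rightarrow> real ^ 'n \<Rightarrow> complex" where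
  "osc h d \<theta> = exp (2 * of_real pi * (\<i> / of_real h) * of_real (d \<bullet> \<theta>))"

text \<open>The Fourier coefficient of \<open>b\<close> at the frequency -d/h. The sign is that of
  the kernel: for \<open>b = \<sigma> k\<close> and \<open>d = k - l\<close> this is
  \<open>op_kernel h \<sigma> k l\<close>.\<close>

definition fcoef :: "real \<Rightarrow> (real ^ 'n::finite \<Rightarrow> complex) \<Rightarrow> real ^ 'n \<Rightarrow> complex" where
  "fcoef h b d = integral (cbox 0 1) (\<lambda>\<theta>. osc h d \<theta> * b \<theta>)"

lemma continuous_on_osc [continuous_intros]: "continuous_on S (osc h d)"
  unfolding osc_def by (intro continuous_intros)

lemma osc_add: "osc h (c + d) \<theta> = osc h c \<theta> * osc h d \<theta>"
  unfolding osc_def exp_add[symmetric] by (simp add: inner_add_left algebra_simps add_divide_distrib)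

lemma osc_zero [simp]: "osc h 0 \<theta> = 1"
  by (simp add: osc_def)

lemma cmod_osc [simp]: "cmod (osc h d \<theta>) = 1"
  unfolding osc_def norm_exp_eq_Re by (simp add: complex_eq_iff Re_divide)

lemma cnj_osc: "cnj (osc h d \<theta>) = osc h (-d) \<theta>"
  unfolding osc_def exp_cnj by simp

lemma op_kernel_eq_fcoef:
  assumes "continuous_on UNIV (\<sigma> k)"
  shows "op_kernel h \<sigma> k l = fcoef h (\<sigma> k) (k - l)"
  unfolding op_kernel_def fcoef_def osc_def
  by (rule set_lebesgue_integral_cbox_eq_integral)
     (intro continuous_intros continuous_on_subset[OF assms], auto)

lemma periodic_osc:
  assumes "d \<in> hlattice h" "h \<noteq> 0"
  shows "torus_periodic (osc h d)"
proof -
  from assms(1) obtain k where d: "d = h *\<^sub>R k" and k: "\<And>j. k $ j \<in> \<int>"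
    by (auto simp: hlattice_def)
  have "osc h d (\<theta> + axis j 1) = osc h d \<theta>" for j \<theta>
  proof -
    from k[of j] obtain z :: int where z: "k $ j = of_int z" by (auto elim: Ints_cases)
    have "osc h d (\<theta> + axis j 1) = exp (2 * of_real pi * (\<i> / of_real h) * of_real (d \<bullet> \<theta>)
        + 2 * of_int z * of_real pi * \<i>)"
      unfolding osc_def using assms(2)
      by (simp add: d z inner_add_right inner_axis algebra_simps add_divide_distrib)
    then show ?thesis
      unfolding osc_def using exp_integer_2pi[of "of_int z"] by (simp add: exp_add mult_ac)
  qed
  then show ?thesis by (simp add: torus_periodic_def)
qed

lemma osc_has_derivative:
  "(osc h d has_derivative (\<lambda>v. 2 * of_real pi * (\<i> / of_real h) * of_real (d \<bullet> v) * osc h d \<theta>)) (at \<theta>)"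
proof -
  have 1: "((\<lambda>\<theta>. of_real (d \<bullet> \<theta>) :: complex) has_derivative (\<lambda>v. of_real (d \<bullet> v))) (at \<theta>)"
    by (intro bounded_linear.has_derivative[OF bounded_linear_of_real] has_derivative_inner_right
        has_derivative_ident)
  show ?thesis
    unfolding osc_def
    by (rule has_derivative_eq_rhs[OF has_derivative_compose[OF
          has_derivative_mult_right[OF 1, of "2 * of_real pi * (\<i> / of_real h)"]
          DERIV_exp[unfolded has_field_derivative_def]]])
       (simp only: mult_ac)
qed

lemma partial_deriv_mult:
  assumes "f differentiable (at \<theta>)" "g differentiable (at \<theta>)"
  shows "partial_deriv j (\<lambda>\<theta>. f \<theta> * g \<theta>) \<theta> = f \<theta> * partial_deriv j g \<theta> + partial_deriv j f \<theta> * g \<theta>"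
proof -
  have "((\<lambda>t. f (\<theta> + t *\<^sub>R axis j 1) * g (\<theta> + t *\<^sub>R axis j 1)) has_vector_derivative
      f (\<theta> + 0 *\<^sub>R axis j 1) * partial_deriv j g (\<theta> + 0 *\<^sub>R axis j 1)
      + partial_deriv j f (\<theta> + 0 *\<^sub>R axis j 1) * g (\<theta> + 0 *\<^sub>R axis j 1)) (at 0)"
    by (intro has_vector_derivative_mult has_vector_derivative_partial_deriv) (simp_all add: assms)
  then show ?thesis
    unfolding partial_deriv_def[of j "\<lambda>\<theta>. f \<theta> * g \<theta>"] by (simp add: vector_derivative_at)
qed

lemma partial_deriv_osc:
  "partial_deriv j (osc h d) \<theta> = 2 * of_real pi * (\<i> / of_real h) * of_real (d $ j) * osc h d \<theta>"
  unfolding partial_deriv_def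
proof (rule vector_derivative_at)
  have "((\<lambda>t. osc h d (\<theta> + t *\<^sub>R axis j 1)) has_derivative
     (\<lambda>t. 2 * of_real pi * (\<i> / of_real h) * of_real (d \<bullet> (t *\<^sub>R axis j 1)) * osc h d (\<theta> + 0 *\<^sub>R axis j 1))) (at 0)"
    by (rule has_derivative_compose[OF _ osc_has_derivative]) (auto intro!: derivative_eq_intros)
  then show "((\<lambda>t. osc h d (\<theta> + t *\<^sub>R axis j 1)) has_vector_derivative
     2 * of_real pi * (\<i> / of_real h) * of_real (d $ j) * osc h d \<theta>) (at 0)"
    unfolding has_vector_derivative_def
    by (simp add: inner_axis scaleR_conv_of_real[where 'a = complex] mult_ac)
qed

lemma torus_periodic_mult:
  "torus_periodic f \<Longrightarrow> torus_periodic g \<Longrightarrow> torus_periodic (\<lambda>\<theta>. f \<theta> * g \<theta> :: complex)"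
  by (simp add: torus_periodic_def)

text \<open>Integration by parts without boundary terms: the derivative of the periodic product of
  \<open>osc h d\<close> and \<open>b\<close> has integral zero, and \<open>osc h d\<close> is an
  eigenfunction of every partial derivative.\<close>

lemma fcoef_partial_deriv:
  assumes per: "torus_periodic b" and diff: "\<And>\<theta>. b differentiable (at \<theta>)"
    and cont: "continuous_on UNIV (partial_deriv j b)"
    and d: "d \<in> hlattice h" and h: "h \<noteq> 0"
  shows "fcoef h (partial_deriv j b) d = - (2 * of_real pi * (\<i> / of_real h) * of_real (d $ j)) * fcoef h b d"
proof -
  let ?c = "2 * of_real pi * (\<i> / of_real h) * of_real (d $ j) :: complex"
  have contb: "continuous_on UNIV b"
    using diff by (simp add: continuous_at_imp_continuous_on differentiable_imp_continuous_within)
  have dosc: "osc h d differentiable (at \<theta>)" for \<theta>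
    using osc_has_derivative differentiable_def by blast
  have pd: "partial_deriv j (\<lambda>\<theta>. osc h d \<theta> * b \<theta>)
      = (\<lambda>\<theta>. osc h d \<theta> * partial_deriv j b \<theta> + ?c * (osc h d \<theta> * b \<theta>))"
    by (rule ext) (simp add: partial_deriv_mult[OF dosc diff] partial_deriv_osc)
  have "0 = integral (cbox 0 1) (partial_deriv j (\<lambda>\<theta>. osc h d \<theta> * b \<theta>))"
  proof (rule integral_partial_deriv_periodic[symmetric])
    show "torus_periodic (\<lambda>\<theta>. osc h d \<theta> * b \<theta>)"
      by (intro torus_periodic_mult periodic_osc d h per)
    show "(\<lambda>\<theta>. osc h d \<theta> * b \<theta>) differentiable (at \<theta>)" for \<theta>
      by (intro differentiable_mult dosc diff)
    show "continuous_on UNIV (partial_deriv j (\<lambda>\<theta>. osc h d \<theta> * b \<theta>))"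
      unfolding pd by (intro continuous_intros cont contb)
  qed
  also have "\<dots> = fcoef h (partial_deriv j b) d + ?c * fcoef h b d"
    unfolding pd fcoef_def
    by (subst integral_add; (intro integrable_continuous continuous_intros
          continuous_on_subset[OF cont] continuous_on_subset[OF contb] subset_UNIV)?) simp
  finally show ?thesis by (simp add: eq_neg_iff_add_eq_0)
qed

text \<open>Orthogonality of characters from integration by parts: the derivative of 1 vanishes, but
  its coefficient is that of 1 times a factor which is nonzero as soon as some component of
  \<open>d\<close> is.\<close>

lemma fcoef_const_1:
  fixes d :: "real ^ 'n::finite"
  assumes d: "d \<in> hlattice h" and h: "h \<noteq> 0"
  shows "fcoef h (\<lambda>_. 1) d = (if d = 0 then 1 else 0)"
proof (cases "d = 0")
  case True
  have "measure lborel (cbox (0::real^'n) 1) = 1"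
    by (subst content_cbox_cart) (auto simp: interval_ne_empty_cart)
  then show ?thesis
    by (simp add: True fcoef_def)
next
  case False
  then obtain j where j: "d $ j \<noteq> 0" by (auto simp: vec_eq_iff)
  have "partial_deriv j (\<lambda>_::real^'n. 1) = (\<lambda>_. 0)"
    by (rule ext) (simp add: partial_deriv_def vector_derivative_const_at)
  then have "0 = - (2 * of_real pi * (\<i> / of_real h) * of_real (d $ j)) * fcoef h (\<lambda>_. 1) d"
    using fcoef_partial_deriv[of "\<lambda>_. 1" j d h] d h by (simp only:) (simp add: torus_periodic_def fcoef_def)
  then show ?thesis using False j h by (auto simp: complex_eq_iff)
qed

subsection \<open>Forms with frozen symbols\<close>

definition sqsum :: "'a set \<Rightarrow> ('a \<Rightarrow> complex) \<Rightarrow> real" where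
  "sqsum A f = (\<Sum>k\<in>A. (cmod (f k))\<^sup>2)"

text \<open>Rows carry \<open>f\<close>, columns carry \<open>g\<close>. The symbol is an arbitrary
  family \<open>F\<close> because the same form is needed for \<open>\<sigma>\<close>, for its
  differences in k and for frozen families \<open>\<lambda>_. b\<close>.\<close>

definition sform :: "real \<Rightarrow> (real ^ 'n::finite \<Rightarrow> real ^ 'n \<Rightarrow> complex) \<Rightarrow> (real ^ 'n) set \<Rightarrow>
    (real ^ 'n) set \<Rightarrow> (real ^ 'n \<Rightarrow> complex) \<Rightarrow> (real ^ 'n \<Rightarrow> complex) \<Rightarrow> complex" where
  "sform h F A B f g = (\<Sum>k\<in>A. \<Sum>l\<in>B. fcoef h (F k) (k - l) * g l * cnj (f k))"

definition trigpoly :: "real \<Rightarrow> (real ^ 'n::finite) set \<Rightarrow> (real ^ 'n \<Rightarrow> complex) \<Rightarrow> real ^ 'n \<Rightarrow> complex" where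
  "trigpoly h B g \<theta> = (\<Sum>l\<in>B. g l * osc h (-l) \<theta>)"

lemma sqsum_nonneg: "0 \<le> sqsum A f"
  unfolding sqsum_def by (intro sum_nonneg) auto

lemma hlattice_diff: "k \<in> hlattice h \<Longrightarrow> l \<in> hlattice h \<Longrightarrow> k - l \<in> hlattice h"
  unfolding hlattice_def mem_Collect_eq
  by (metis Ints_diff scaleR_right_diff_distrib vector_minus_component)

lemma continuous_on_trigpoly [continuous_intros]: "continuous_on S (trigpoly h B g)"
  unfolding trigpoly_def by (intro continuous_intros)

text \<open>For a frozen symbol the kernel depends on \<open>k - l\<close> only, so the double sum
  factorises under the integral: the operator becomes multiplication by \<open>b\<close> between the
  transforms of \<open>g\<close> and \<open>f\<close>.\<close>

lemma sform_const_eq_integral: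
  assumes cont: "continuous_on UNIV b" and fin: "finite A" "finite B"
  shows "sform h (\<lambda>_. b) A B f g =
    integral (cbox 0 1) (\<lambda>\<theta>. b \<theta> * (trigpoly h B g \<theta> * cnj (trigpoly h A f \<theta>)))"
proof -
  note [continuous_intros] = continuous_on_subset[OF cont subset_UNIV]
  have eq: "b \<theta> * (trigpoly h B g \<theta> * cnj (trigpoly h A f \<theta>))
      = (\<Sum>k\<in>A. \<Sum>l\<in>B. osc h (k - l) \<theta> * b \<theta> * (g l * cnj (f k)))" for \<theta>
  proof -
    have "osc h (k - l) \<theta> = osc h (-l) \<theta> * osc h k \<theta>" for k l
      by (simp add: osc_add[symmetric])
    moreover have "trigpoly h B g \<theta> * cnj (trigpoly h A f \<theta>)
        = (\<Sum>k\<in>A. \<Sum>l\<in>B. (g l * osc h (-l) \<theta>) * (cnj (f k) * osc h k \<theta>))"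
      unfolding trigpoly_def by (subst sum.swap) (simp add: sum_product cnj_osc)
    ultimately show ?thesis
      by (simp only: sum_distrib_left) (simp only: mult_ac)
  qed
  have int: "(\<lambda>\<theta>. osc h (k - l) \<theta> * b \<theta> * (g l * cnj (f k))) integrable_on cbox 0 1" for k l
    by (intro integrable_continuous continuous_intros)
  have "integral (cbox 0 1) (\<lambda>\<theta>. b \<theta> * (trigpoly h B g \<theta> * cnj (trigpoly h A f \<theta>)))
     = (\<Sum>k\<in>A. \<Sum>l\<in>B. integral (cbox 0 1) (\<lambda>\<theta>. osc h (k - l) \<theta> * b \<theta> * (g l * cnj (f k))))"
    unfolding eq by (simp add: integral_sum fin int integrable_sum)
  then show ?thesis
    by (simp add: sform_def fcoef_def mult.assoc[symmetric])
qed

text \<open>Parseval, read off from the constant symbol 1, whose kernel is the identity by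
  orthogonality.\<close>

lemma integral_trigpoly:
  assumes A: "finite A" "A \<subseteq> hlattice h" and h: "h \<noteq> 0"
  shows "integral (cbox 0 1) (\<lambda>\<theta>. (cmod (trigpoly h A f \<theta>))\<^sup>2) = sqsum A f"
proof -
  have "complex_of_real (integral (cbox 0 1) (\<lambda>\<theta>. (cmod (trigpoly h A f \<theta>))\<^sup>2))
      = integral (cbox 0 1) (\<lambda>\<theta>. complex_of_real ((cmod (trigpoly h A f \<theta>))\<^sup>2))"
    by (rule integral_linear[OF _ bounded_linear_of_real, unfolded o_def, symmetric])
       (intro integrable_continuous continuous_intros)
  also have "\<dots> = sform h (\<lambda>_ _. 1) A A f f"
    by (subst sform_const_eq_integral) (auto simp: A complex_norm_square[symmetric])
  also have "\<dots> = (\<Sum>k\<in>A. \<Sum>l\<in>A. if k = l then f l * cnj (f k) else 0)"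
    unfolding sform_def
    using A h by (intro sum.cong refl) (auto simp: fcoef_const_1 hlattice_diff subset_eq)
  also have "\<dots> = complex_of_real (sqsum A f)"
    using A unfolding sqsum_def by (simp add: sum.delta complex_norm_square[symmetric])
  finally show ?thesis by (simp only: of_real_eq_iff)
qed

text \<open>The product of the two transforms is bounded by the sum of their squares instead of by
  Cauchy-Schwarz, since a bound additive in \<open>sqsum\<close> can be summed over cells
  directly.\<close>

lemma cmod_sform_const_le:
  assumes cont: "continuous_on UNIV b" and D: "\<And>\<theta>. cmod (b \<theta>) \<le> D"
    and A: "finite A" "A \<subseteq> hlattice h" and B: "finite B" "B \<subseteq> hlattice h" and h: "h \<noteq> 0"
  shows "cmod (sform h (\<lambda>_. b) A B f g) \<le> D * (sqsum B g + sqsum A f)"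
proof -
  note [continuous_intros] = continuous_on_subset[OF cont subset_UNIV]
  have D0: "0 \<le> D" using D norm_ge_zero order_trans by blast
  have "cmod (sform h (\<lambda>_. b) A B f g) \<le> integral (cbox 0 1) (\<lambda>\<theta>.
      D * ((cmod (trigpoly h B g \<theta>))\<^sup>2 + (cmod (trigpoly h A f \<theta>))\<^sup>2))"
    unfolding sform_const_eq_integral[OF cont A(1) B(1)]
  proof (rule integral_norm_bound_integral)
    fix \<theta> :: "real ^ 'a"
    let ?G = "cmod (trigpoly h B g \<theta>)" and ?H = "cmod (trigpoly h A f \<theta>)"
    have "?G * ?H \<le> ?G\<^sup>2 + ?H\<^sup>2"
      using sum_squares_bound[of ?G ?H] mult_nonneg_nonneg[of ?G ?H, OF norm_ge_zero norm_ge_zero]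
      by linarith
    then have "cmod (b \<theta>) * (?G * ?H) \<le> D * (?G\<^sup>2 + ?H\<^sup>2)"
      by (intro mult_mono D D0) auto
    then show "cmod (b \<theta> * (trigpoly h B g \<theta> * cnj (trigpoly h A f \<theta>))) \<le> D * (?G\<^sup>2 + ?H\<^sup>2)"
      by (simp add: norm_mult)
  qed (intro integrable_continuous continuous_intros)+
  also have "\<dots> = D * (sqsum B g + sqsum A f)"
    unfolding integral_trigpoly[OF A h, symmetric] integral_trigpoly[OF B h, symmetric]
    by (subst integral_mult_right, subst integral_add)
       (intro integrable_continuous continuous_intros refl)+
  finally show ?thesis .
qed

lemma Re_sform_const_ge:
  assumes cont: "continuous_on UNIV b" and c: "\<And>\<theta>. c \<le> Re (b \<theta>)"
    and A: "finite A" "A \<subseteq> hlattice h" and h: "h \<noteq> 0"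
  shows "Re (sform h (\<lambda>_. b) A A f f) \<ge> c * sqsum A f"
proof -
  note [continuous_intros] = continuous_on_subset[OF cont subset_UNIV]
  let ?H = "trigpoly h A f"
  have "c * sqsum A f = integral (cbox 0 1) (\<lambda>\<theta>. c * (cmod (?H \<theta>))\<^sup>2)"
    by (simp add: integral_trigpoly[OF A h])
  also have "\<dots> \<le> integral (cbox 0 1) (\<lambda>\<theta>. Re (b \<theta> * (?H \<theta> * cnj (?H \<theta>))))"
    by (intro integral_le integrable_continuous continuous_intros)
       (use c in \<open>auto simp: complex_norm_square[symmetric] intro!: mult_right_mono simp del: of_real_power\<close>)
  also have "\<dots> = Re (sform h (\<lambda>_. b) A A f f)"
    unfolding sform_const_eq_integral[OF cont A(1) A(1)]
    by (rule integral_linear[OF _ bounded_linear_Re, unfolded o_def])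
       (intro integrable_continuous continuous_intros)
  finally show ?thesis .
qed

section \<open>Toroidal derivatives and Fourier coefficients\<close>

lemma smooth_fun_differentiable: "smooth_fun f \<Longrightarrow> f differentiable (at \<theta>)"
  unfolding smooth_fun_def using C_k.simps(2) by blast

lemma smooth_fun_partial_deriv: "smooth_fun f \<Longrightarrow> smooth_fun (partial_deriv j f)"
  unfolding smooth_fun_def using C_k.simps(2) by blast

lemma smooth_fun_continuous: "smooth_fun f \<Longrightarrow> continuous_on S f"
  unfolding smooth_fun_def using C_k.simps(1) continuous_on_subset by blast

lemma partial_deriv_lincomb:
  assumes "f differentiable (at \<theta>)" "g differentiable (at \<theta>)"
  shows "partial_deriv j (\<lambda>\<theta>. c * f \<theta> + d * g \<theta>) \<theta> = c * partial_deriv j f \<theta> + d * partial_deriv j g \<theta>"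
proof -
  have "((\<lambda>t. c * f (\<theta> + t *\<^sub>R axis j 1) + d * g (\<theta> + t *\<^sub>R axis j 1)) has_vector_derivative
      c * partial_deriv j f (\<theta> + 0 *\<^sub>R axis j 1) + d * partial_deriv j g (\<theta> + 0 *\<^sub>R axis j 1)) (at 0)"
    by (intro has_vector_derivative_add has_vector_derivative_mult_right
        has_vector_derivative_partial_deriv) (simp_all add: assms)
  then show ?thesis
    unfolding partial_deriv_def[of j "\<lambda>\<theta>. c * f \<theta> + d * g \<theta>"] by (simp add: vector_derivative_at)
qed

lemma C_k_lincomb: "C_k N f \<Longrightarrow> C_k N g \<Longrightarrow> C_k N (\<lambda>\<theta>. c * f \<theta> + d * g \<theta>)"
proof (induction N arbitrary: f g)
  case 0
  then show ?case by (auto intro!: continuous_intros)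
next
  case (Suc N)
  have "partial_deriv j (\<lambda>\<theta>. c * f \<theta> + d * g \<theta>)
      = (\<lambda>\<theta>. c * partial_deriv j f \<theta> + d * partial_deriv j g \<theta>)" for j
    using Suc.prems by (intro ext partial_deriv_lincomb) auto
  then show ?case
    using Suc by (auto intro!: differentiable_add differentiable_mult)
qed

lemma smooth_fun_lincomb:
  "smooth_fun f \<Longrightarrow> smooth_fun g \<Longrightarrow> smooth_fun (\<lambda>\<theta>. c * f \<theta> + d * g \<theta>)"
  unfolding smooth_fun_def using C_k_lincomb by blast

lemma tor_op_Suc_eq:
  "tor_op h j (Suc l) f = (\<lambda>\<theta>. (of_real h / (2 * of_real pi * \<i>)) * partial_deriv j (tor_op h j l f) \<theta>
      + (- of_real h * of_nat l) * tor_op h j l f \<theta>)"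
  by (rule ext) (simp add: algebra_simps)

lemma smooth_fun_tor_op: "smooth_fun f \<Longrightarrow> smooth_fun (tor_op h j N f)"
proof (induction N)
  case (Suc N)
  then show ?case unfolding tor_op_Suc_eq
    by (intro smooth_fun_lincomb smooth_fun_partial_deriv)
qed simp

lemma torus_periodic_partial_deriv:
  assumes "torus_periodic f"
  shows "torus_periodic (partial_deriv j f)"
proof -
  have "f (\<theta> + axis i 1 + t *\<^sub>R axis j 1) = f (\<theta> + t *\<^sub>R axis j 1)" for \<theta> i t
    using assms[unfolded torus_periodic_def, rule_format, of "\<theta> + t *\<^sub>R axis j 1" i]
    by (simp add: algebra_simps)
  then show ?thesis by (simp add: torus_periodic_def partial_deriv_def)
qed

lemma torus_periodic_tor_op: "torus_periodic f \<Longrightarrow> torus_periodic (tor_op h j N f)"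
proof (induction N)
  case (Suc N)
  then show ?case
    using torus_periodic_partial_deriv[of "tor_op h j N f" j] by (simp add: torus_periodic_def)
qed simp

lemma fcoef_lincomb:
  assumes "continuous_on UNIV f" "continuous_on UNIV g"
  shows "fcoef h (\<lambda>\<theta>. a * f \<theta> + b * g \<theta>) d = a * fcoef h f d + b * fcoef h g d"
proof -
  note [continuous_intros] = assms[THEN continuous_on_subset, OF subset_UNIV]
  have int: "(\<lambda>\<theta>. c * (osc h d \<theta> * f \<theta>)) integrable_on cbox 0 1"
    "(\<lambda>\<theta>. c * (osc h d \<theta> * g \<theta>)) integrable_on cbox 0 1" for c
    by (intro integrable_continuous continuous_intros)+
  have "fcoef h (\<lambda>\<theta>. a * f \<theta> + b * g \<theta>) d
     = integral (cbox 0 1) (\<lambda>\<theta>. a * (osc h d \<theta> * f \<theta>) + b * (osc h d \<theta> * g \<theta>))"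
    unfolding fcoef_def by (simp add: algebra_simps)
  then show ?thesis
    using int by (simp add: integral_add fcoef_def)
qed

text \<open>The t-th toroidal factor multiplies the coefficient at \<open>d\<close> by -d_j - h t.
  The outcome is a shifted factorial and not a power of d_j; it has zeros at d_j = -h t, so it
  controls \<open>d\<close> only once |d_j| is large.\<close>

lemma fcoef_tor_op:
  assumes f: "smooth_fun f" "torus_periodic f" and d: "d \<in> hlattice h" and h: "h \<noteq> 0"
  shows "fcoef h (tor_op h j N f) d = (\<Prod>t<N. of_real (- (d $ j) - h * real t)) * fcoef h f d"
proof (induction N)
  case 0
  then show ?case by simp
next
  case (Suc N)
  let ?g = "tor_op h j N f"
  have sm: "smooth_fun ?g" and per: "torus_periodic ?g"
    using f by (auto intro: smooth_fun_tor_op torus_periodic_tor_op)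
  have "fcoef h (tor_op h j (Suc N) f) d
      = (of_real h / (2 * of_real pi * \<i>)) * fcoef h (partial_deriv j ?g) d
        + (- of_real h * of_nat N) * fcoef h ?g d"
    unfolding tor_op_Suc_eq
    by (intro fcoef_lincomb smooth_fun_continuous smooth_fun_partial_deriv sm)
  also have "fcoef h (partial_deriv j ?g) d
      = - (2 * of_real pi * (\<i> / of_real h) * of_real (d $ j)) * fcoef h ?g d"
    by (intro fcoef_partial_deriv per smooth_fun_differentiable sm smooth_fun_continuous
        smooth_fun_partial_deriv d h)
  also have "(of_real h / (2 * of_real pi * \<i>)) * (- (2 * of_real pi * (\<i> / of_real h) * of_real (d $ j)) * fcoef h ?g d)
      + (- of_real h * of_nat N) * fcoef h ?g d = of_real (- (d $ j) - h * real N) * fcoef h ?g d"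
    using h by (simp add: field_simps)
  finally show ?case by (simp add: Suc.IH)
qed

lemma cmod_fcoef_le:
  fixes b :: "real ^ 'n::finite \<Rightarrow> complex"
  assumes cont: "continuous_on UNIV b" and D: "\<And>\<theta>. cmod (b \<theta>) \<le> D"
  shows "cmod (fcoef h b d) \<le> D"
proof -
  note [continuous_intros] = continuous_on_subset[OF cont subset_UNIV]
  have "cmod (fcoef h b d) \<le> integral (cbox 0 (1::real^'n)) (\<lambda>_. D)"
    unfolding fcoef_def
    by (rule integral_norm_bound_integral)
       (auto simp: norm_mult D intro!: integrable_continuous continuous_intros)
  also have "measure lborel (cbox (0::real^'n) 1) = 1"
    by (subst content_cbox_cart) (auto simp: interval_ne_empty_cart)
  then have "integral (cbox 0 (1::real^'n)) (\<lambda>_. D) = D" by simp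
  finally show ?thesis .
qed

subsection \<open>Freezing the symbol in a box\<close>

lemma hlattice_iff: "h \<noteq> 0 \<Longrightarrow> k \<in> hlattice h \<longleftrightarrow> (\<forall>i. \<exists>z::int. k $ i = h * of_int z)"
proof
  assume h: "h \<noteq> 0" and *: "\<forall>i. \<exists>z::int. k $ i = h * of_int z"
  have "k = h *\<^sub>R ((1 / h) *\<^sub>R k)" using h by simp
  moreover have "((1 / h) *\<^sub>R k) $ i \<in> \<int>" for i
    using *[rule_format, of i] h by auto
  ultimately show "k \<in> hlattice h" unfolding hlattice_def by blast
next
  assume "k \<in> hlattice h"
  then obtain k' where k: "k = h *\<^sub>R k'" "\<And>j. k' $ j \<in> \<int>" by (auto simp: hlattice_def)
  show "\<forall>i. \<exists>z::int. k $ i = h * of_int z"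
  proof
    fix i
    from k(2)[of i] obtain z where "k' $ i = of_int z" by (rule Ints_cases)
    then show "\<exists>z::int. k $ i = h * of_int z" using k(1) by auto
  qed
qed

definition glue :: "'n list \<Rightarrow> real ^ 'n::finite \<Rightarrow> real ^ 'n \<Rightarrow> real ^ 'n" where
  "glue xs b k = (\<chi> i. if i \<in> set xs then k $ i else b $ i)"

lemma glue_Nil [simp]: "glue [] b k = b"
  by (simp add: glue_def)

lemma glue_mem_hlattice:
  "h \<noteq> 0 \<Longrightarrow> b \<in> hlattice h \<Longrightarrow> k \<in> hlattice h \<Longrightarrow> glue xs b k \<in> hlattice h"
  by (auto simp: hlattice_iff glue_def)

lemma axis_shift_mem_hlattice:
  "h \<noteq> 0 \<Longrightarrow> b \<in> hlattice h \<Longrightarrow> b + (h * real t) *\<^sub>R axis j 1 \<in> hlattice h"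
  unfolding hlattice_iff
proof
  fix i assume "\<forall>i. \<exists>z. b $ i = h * real_of_int z"
  then obtain z where "b $ i = h * real_of_int z" by blast
  then have "(b + (h * real t) *\<^sub>R axis j 1) $ i = h * real_of_int (z + (if i = j then int t else 0))"
    by (simp add: axis_def algebra_simps)
  then show "\<exists>z. (b + (h * real t) *\<^sub>R axis j 1) $ i = h * real_of_int z" by blast
qed

definition symbol_diff :: "real \<Rightarrow> 'n::finite \<Rightarrow> (real ^ 'n \<Rightarrow> real ^ 'n \<Rightarrow> complex) \<Rightarrow>
    real ^ 'n \<Rightarrow> real ^ 'n \<Rightarrow> complex" where
  "symbol_diff h j F k \<theta> = diff_op h j (\<lambda>k'. F k' \<theta>) k"

lemma continuous_on_symbol_diff:
  assumes "h \<noteq> 0" "\<And>k. k \<in> hlattice h \<Longrightarrow> continuous_on UNIV (F k)" "k \<in> hlattice h"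
  shows "continuous_on UNIV (symbol_diff h j F k)"
proof -
  have "k + h *\<^sub>R axis j 1 \<in> hlattice h"
    using axis_shift_mem_hlattice[OF assms(1,3), of 1 j] by simp
  then have [continuous_intros]: "continuous_on UNIV (F (k + h *\<^sub>R axis j 1))" "continuous_on UNIV (F k)"
    using assms by auto
  have "continuous_on UNIV (\<lambda>\<theta>. (F (k + h *\<^sub>R axis j 1) \<theta> - F k \<theta>) / of_real h)"
    by (intro continuous_intros) (use assms(1) in auto)
  then show ?thesis by (simp add: symbol_diff_def[abs_def] diff_op_def)
qed

lemma fcoef_sum:
  assumes "finite T" "continuous_on UNIV u" "\<And>t. t \<in> T \<Longrightarrow> continuous_on UNIV (v t)"
  shows "fcoef h (\<lambda>\<theta>. u \<theta> + (\<Sum>t\<in>T. c t * v t \<theta>)) d = fcoef h u d + (\<Sum>t\<in>T. c t * fcoef h (v t) d)"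
  using assms(1,3)
proof (induction T)
  case empty
  then show ?case by simp
next
  case (insert s T)
  have "fcoef h (\<lambda>\<theta>. 1 * (u \<theta> + (\<Sum>t\<in>T. c t * v t \<theta>)) + c s * v s \<theta>) d
      = 1 * fcoef h (\<lambda>\<theta>. u \<theta> + (\<Sum>t\<in>T. c t * v t \<theta>)) d + c s * fcoef h (v s) d"
    by (rule fcoef_lincomb) (use insert.prems in \<open>auto intro!: continuous_intros assms(2)\<close>)
  then show ?case
    using insert by (simp add: algebra_simps)
qed

text \<open>A fundamental theorem of calculus in the \<open>j\<close>-th coordinate: the characteristic function
  of \<open>{k. t < n k}\<close> that it produces is moved into the test function \<open>f\<close>.\<close>

lemma sform_glue_snoc:
  fixes F :: "real ^ 'n::finite \<Rightarrow> real ^ 'n \<Rightarrow> complex"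
  assumes h: "h \<noteq> 0" and F: "\<And>k. k \<in> hlattice h \<Longrightarrow> continuous_on UNIV (F k)"
    and j: "j \<notin> set xs" and b: "b \<in> hlattice h" and A: "A \<subseteq> hlattice h"
    and n: "\<And>k. k \<in> A \<Longrightarrow> k $ j = b $ j + h * real (n k)" "\<And>k. k \<in> A \<Longrightarrow> n k \<le> T"
  shows "sform h (\<lambda>k. F (glue (xs @ [j]) b k)) A B f g = sform h (\<lambda>k. F (glue xs b k)) A B f g
    + (\<Sum>t<T. of_real h * sform h (\<lambda>k. symbol_diff h j F (glue xs (b + (h * real t) *\<^sub>R axis j 1) k)) A B
        (\<lambda>k. if t < n k then f k else 0) g)"
proof -
  define bt where "bt t = b + (h * real t) *\<^sub>R axis j 1" for t
  have bt0: "bt 0 = b" by (simp add: bt_def)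
  have btj: "bt t $ i = b $ i + (if i = j then h * real t else 0)" for t i
    by (simp add: bt_def axis_def)
  \<comment> \<open>Coordinate j of the glued point comes from the corner, so a lattice step of the
    point is a lattice step of the corner.\<close>
  have step: "glue xs (bt t) k + h *\<^sub>R axis j 1 = glue xs (bt (Suc t)) k" for t k
    using j by (auto simp: vec_eq_iff glue_def btj axis_def algebra_simps)
  have top: "glue (xs @ [j]) b k = glue xs (bt (n k)) k" if "k \<in> A" for k
    using j n(1)[OF that] by (auto simp: vec_eq_iff glue_def btj)
  have L: "glue xs (bt t) k \<in> hlattice h" if "k \<in> A" for t k
    using that A unfolding bt_def by (intro glue_mem_hlattice axis_shift_mem_hlattice h b) auto
  have tele: "F (glue xs (bt N) k) = (\<lambda>\<theta>. F (glue xs b k) \<theta> + (\<Sum>t<N. of_real h *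
      symbol_diff h j F (glue xs (bt t) k) \<theta>))" for N k
  proof (induction N)
    case 0
    then show ?case by (simp add: bt0)
  next
    case (Suc N)
    have "F (glue xs (bt (Suc N)) k) \<theta> = F (glue xs (bt N) k) \<theta>
        + of_real h * symbol_diff h j F (glue xs (bt N) k) \<theta>" for \<theta>
      using h by (simp add: symbol_diff_def diff_op_def step)
    then show ?case by (simp add: fun_eq_iff Suc.IH)
  qed
  have coef: "fcoef h (F (glue (xs @ [j]) b k)) d = fcoef h (F (glue xs b k)) d
      + (\<Sum>t<T. if t < n k then of_real h * fcoef h (symbol_diff h j F (glue xs (bt t) k)) d else 0)"
    if k: "k \<in> A" for k d
  proof -
    have "fcoef h (F (glue (xs @ [j]) b k)) d = fcoef h (F (glue xs b k)) d
      + (\<Sum>t<n k. of_real h * fcoef h (symbol_diff h j F (glue xs (bt t) k)) d)"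
      unfolding top[OF k] tele
      by (rule fcoef_sum) (use L[OF k] L[OF k, of 0] in
          \<open>auto intro!: F continuous_on_symbol_diff h simp: bt0\<close>)
    \<comment> \<open>The number of steps depends on \<open>k\<close>; padding with zeros up to the
      common bound \<open>T\<close> allows the sum over \<open>t\<close> to leave the sum over
      \<open>k\<close>.\<close>
    also have "(\<Sum>t<n k. of_real h * fcoef h (symbol_diff h j F (glue xs (bt t) k)) d)
      = (\<Sum>t<T. if t < n k then of_real h * fcoef h (symbol_diff h j F (glue xs (bt t) k)) d else 0)"
      using n(2)[OF k] by (intro sum.mono_neutral_cong_left) auto
    finally show ?thesis .
  qed
  have "sform h (\<lambda>k. F (glue (xs @ [j]) b k)) A B f g
      = (\<Sum>k\<in>A. \<Sum>l\<in>B. fcoef h (F (glue xs b k)) (k - l) * g l * cnj (f k)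
        + (\<Sum>t<T. of_real h * (fcoef h (symbol_diff h j F (glue xs (bt t) k)) (k - l) * g l *
            cnj (if t < n k then f k else 0))))"
    unfolding sform_def
    by (intro sum.cong refl, simp only: coef distrib_right sum_distrib_right,
        rule arg_cong2[of _ _ _ _ plus, OF refl], rule sum.cong[OF refl]) simp
  also have "\<dots> = sform h (\<lambda>k. F (glue xs b k)) A B f g
      + (\<Sum>k\<in>A. \<Sum>l\<in>B. \<Sum>t<T. of_real h * (fcoef h (symbol_diff h j F (glue xs (bt t) k)) (k - l) * g l *
            cnj (if t < n k then f k else 0)))"
    by (simp add: sum.distrib sform_def)
  also have "(\<Sum>k\<in>A. \<Sum>l\<in>B. \<Sum>t<T. of_real h * (fcoef h (symbol_diff h j F (glue xs (bt t) k)) (k - l) * g l *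
            cnj (if t < n k then f k else 0)))
     = (\<Sum>t<T. of_real h * sform h (\<lambda>k. symbol_diff h j F (glue xs (bt t) k)) A B
        (\<lambda>k. if t < n k then f k else 0) g)"
    unfolding sform_def sum_distrib_left
    by (rule trans[OF sum.cong[OF refl sum.swap] sum.swap])
  finally show ?thesis unfolding bt_def .
qed

text \<open>Each difference gains a factor \<open>\<nu>\<close>, and order one per coordinate is
  enough since each coordinate is released once. A list of directions allows induction; for
  \<open>coords\<close> the composition is that of \<open>Diff_op\<close>.\<close>

definition mixed_diff_le :: "real \<Rightarrow> 'n::finite list \<Rightarrow> (real ^ 'n \<Rightarrow> real ^ 'n \<Rightarrow> complex) \<Rightarrow>
    (real ^ 'n) set \<Rightarrow> real \<Rightarrow> real \<Rightarrow> bool" where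
  "mixed_diff_le h xs F Q D \<nu> \<longleftrightarrow> (\<forall>\<alpha>. (\<forall>i. \<alpha> i \<le> 1) \<longrightarrow> (\<forall>q\<in>Q. \<forall>\<theta>.
     cmod (foldr (\<lambda>j. diff_op h j ^^ \<alpha> j) xs (\<lambda>k. F k \<theta>) q) \<le> D * \<nu> ^ (\<Sum>i\<in>set xs. \<alpha> i)))"

text \<open>\<open>foldr\<close> applies the operator of the last list element first, so the
  difference in direction \<open>j\<close>, with exponent 0 or 1, can be absorbed into the family
  \<open>F\<close>.\<close>

lemma mixed_diff_le_snoc:
  assumes m: "mixed_diff_le h (xs @ [j]) F Q D \<nu>" and j: "j \<notin> set xs"
  shows "mixed_diff_le h xs F Q D \<nu>" "mixed_diff_le h xs (symbol_diff h j F) Q (D * \<nu>) \<nu>"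
proof -
  have upd: "foldr (\<lambda>i. diff_op h i ^^ (\<alpha>(j := a)) i) (xs @ [j]) G
      = foldr (\<lambda>i. diff_op h i ^^ \<alpha> i) xs ((diff_op h j ^^ a) G)" for \<alpha> a G
    using j by (auto intro!: foldr_cong)
  have s: "(\<Sum>i\<in>set (xs @ [j]). (\<alpha>(j := a)) i) = a + (\<Sum>i\<in>set xs. \<alpha> i)" for \<alpha> :: "'a \<Rightarrow> nat" and a
  proof -
    have "(\<Sum>i\<in>set xs. (\<alpha>(j := a)) i) = (\<Sum>i\<in>set xs. \<alpha> i)"
      using j by (intro sum.cong) auto
    then show ?thesis using j by simp
  qed
  have *: "cmod (foldr (\<lambda>i. diff_op h i ^^ \<alpha> i) xs ((diff_op h j ^^ a) (\<lambda>k. F k \<theta>)) q)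
      \<le> D * \<nu> ^ (a + (\<Sum>i\<in>set xs. \<alpha> i))" if "\<forall>i. \<alpha> i \<le> 1" "q \<in> Q" "a \<le> 1" for \<alpha> q a \<theta>
    using m[unfolded mixed_diff_le_def, rule_format, of "\<alpha>(j := a)" q \<theta>] that unfolding upd s by simp
  show "mixed_diff_le h xs F Q D \<nu>"
    unfolding mixed_diff_le_def using *[where a = 0] by simp
  have "symbol_diff h j F = (\<lambda>k \<theta>. diff_op h j (\<lambda>k'. F k' \<theta>) k)"
    by (simp add: fun_eq_iff symbol_diff_def)
  then show "mixed_diff_le h xs (symbol_diff h j F) Q (D * \<nu>) \<nu>"
    unfolding mixed_diff_le_def using *[where a = 1] by (simp add: mult.assoc)
qed

definition hbox :: "real \<Rightarrow> real ^ 'n::finite \<Rightarrow> real \<Rightarrow> (real ^ 'n) set" where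
  "hbox h p R = {q \<in> hlattice h. \<forall>i. p $ i \<le> q $ i \<and> q $ i \<le> p $ i + R}"

lemma hbox_steps:
  assumes h: "0 < h" and p: "p \<in> hlattice h" and k: "k \<in> hbox h p R"
  obtains n :: nat where "k $ j = p $ j + h * real n" "h * real n \<le> R"
proof -
  have L: "k \<in> hlattice h" and le: "p $ j \<le> k $ j" "k $ j \<le> p $ j + R"
    using k by (auto simp: hbox_def)
  obtain y z :: int where yz: "p $ j = h * y" "k $ j = h * z"
    using hlattice_iff[of h p] hlattice_iff[of h k] p L h by blast
  have "y \<le> z" using le(1) h unfolding yz by simp
  then have "k $ j = p $ j + h * real (nat (z - y))"
    unfolding yz by (simp add: algebra_simps)
  with le(2) that[of "nat (z - y)"] show ?thesis by simp
qed

lemma sform_glue_bounds: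
  fixes F :: "real ^ 'n::finite \<Rightarrow> real ^ 'n \<Rightarrow> complex"
  assumes h: "0 < h" and F: "\<And>k. k \<in> hlattice h \<Longrightarrow> continuous_on UNIV (F k)"
    and m: "mixed_diff_le h xs F (hbox h p R) D \<nu>" and nu: "0 \<le> \<nu>" and R: "0 \<le> R"
    and dist: "distinct xs" and p: "p \<in> hlattice h"
    and b: "b \<in> hbox h p R" "\<And>i. i \<in> set xs \<Longrightarrow> b $ i = p $ i"
    and A: "finite A" "A \<subseteq> hbox h p R" and B: "finite B" "B \<subseteq> hlattice h"
  shows "cmod (sform h (\<lambda>k. F (glue xs b k)) A B f g)
      \<le> D * (1 + R * \<nu>) ^ length xs * (sqsum B g + sqsum A f)" (is "?bound xs F D b f")
    and "cmod (sform h (\<lambda>k. F (glue xs b k)) A B f g - sform h (\<lambda>_. F b) A B f g)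
      \<le> D * ((1 + R * \<nu>) ^ length xs - 1) * (sqsum B g + sqsum A f)" (is "?close xs F D b f")
proof -
  have h0: "h \<noteq> 0" and AL: "A \<subseteq> hlattice h" using h A by (auto simp: hbox_def)
  have "?bound xs F D b f \<and> ?close xs F D b f"
    using F m dist b
  proof (induction xs arbitrary: F D b f rule: rev_induct)
    case Nil
    have "cmod (F b \<theta>) \<le> D" for \<theta>
      using Nil.prems(2,4) by (auto simp: mixed_diff_le_def)
    then have "cmod (sform h (\<lambda>_. F b) A B f g) \<le> D * (sqsum B g + sqsum A f)"
      using Nil.prems(1,4) by (intro cmod_sform_const_le A B AL h0) (auto simp: hbox_def)
    then show ?case by simp
  next
    case (snoc j xs)
    have j: "j \<notin> set xs" and dxs: "distinct xs" using snoc.prems(3) by auto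
    have bL: "b \<in> hlattice h" using snoc.prems(4) by (simp add: hbox_def)
    have bj: "b $ j = p $ j" using snoc.prems(5) by simp
    note md = mixed_diff_le_snoc[OF snoc.prems(2) j]
    have D0: "0 \<le> D"
      using md(1)[unfolded mixed_diff_le_def, rule_format, of "\<lambda>_. 0" b] snoc.prems(4)
        norm_ge_zero[of "foldr (\<lambda>j. diff_op h j ^^ 0) xs (\<lambda>k. F k undefined) b"]
      by (simp del: norm_ge_zero) (meson order_trans norm_ge_zero)
    have "\<forall>k\<in>A. \<exists>n::nat. k $ j = b $ j + h * real n \<and> h * real n \<le> R"
      using hbox_steps[OF h p, of _ R j] A(2) bj by (metis subsetD)
    then obtain n :: "real ^ 'n \<Rightarrow> nat"
      where n: "\<And>k. k \<in> A \<Longrightarrow> k $ j = b $ j + h * real (n k)" "\<And>k. k \<in> A \<Longrightarrow> h * real (n k) \<le> R"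
      by metis
    \<comment> \<open>The largest number of lattice steps that fit into the side of the box.\<close>
    define T where "T = nat \<lfloor>R / h\<rfloor>"
    have TR: "h * real T \<le> R"
    proof -
      have "real T \<le> R / h" using R h by (simp add: T_def)
      then show ?thesis using h by (simp add: field_simps)
    qed
    have nT: "n k \<le> T" if "k \<in> A" for k
      using n(2)[OF that] h unfolding T_def by (simp add: le_nat_floor field_simps)
    define bt where "bt t = b + (h * real t) *\<^sub>R axis j 1" for t
    have bt: "bt t \<in> hbox h p R" if "t < T" for t
    proof -
      have tR: "h * real t \<le> R" using that h by (intro order_trans[OF _ TR]) simp
      moreover have "0 \<le> h * real t" using h by simp
      ultimately have "bt t $ i \<le> p $ i + R" "p $ i \<le> bt t $ i" for i
        using snoc.prems(4) bj unfolding bt_def axis_def hbox_def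
        by (simp_all del: zero_le_mult_iff)
      then show ?thesis
        unfolding hbox_def bt_def using axis_shift_mem_hlattice[OF h0 bL] by auto
    qed
    have btp: "bt t $ i = p $ i" if "i \<in> set xs" for t i
      using snoc.prems(5) that j by (auto simp: bt_def axis_def)
    let ?N = "sqsum B g + sqsum A f" and ?w = "1 + R * \<nu>"
    define S where "S = (\<Sum>t<T. of_real h * sform h (\<lambda>k. symbol_diff h j F (glue xs (bt t) k)) A B
        (\<lambda>k. if t < n k then f k else 0) g)"
    have eq: "sform h (\<lambda>k. F (glue (xs @ [j]) b k)) A B f g = sform h (\<lambda>k. F (glue xs b k)) A B f g + S"
      unfolding S_def bt_def by (rule sform_glue_snoc[OF h0 snoc.prems(1) j bL AL n(1) nT])
    have N0: "0 \<le> ?N" by (simp add: sqsum_nonneg)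
    have w1: "1 \<le> ?w" using R nu by simp
    have "cmod S \<le> (\<Sum>t<T. h * (D * \<nu> * ?w ^ length xs * ?N))"
      unfolding S_def
    proof (rule sum_norm_le)
      fix t assume "t \<in> {..<T}"
      then have t: "t < T" by simp
      let ?f = "\<lambda>k. if t < n k then f k else 0"
      have "cmod (sform h (\<lambda>k. symbol_diff h j F (glue xs (bt t) k)) A B ?f g)
          \<le> D * \<nu> * ?w ^ length xs * (sqsum B g + sqsum A ?f)"
        using snoc.IH[of "symbol_diff h j F" "D * \<nu>" "bt t" ?f,
            OF continuous_on_symbol_diff[OF h0 snoc.prems(1)] md(2) dxs bt[OF t] btp] by blast
      \<comment> \<open>The indicator of \<open>t < n k\<close> acts on the row function alone and
        cannot increase its norm.\<close>
      also have "\<dots> \<le> D * \<nu> * ?w ^ length xs * ?N"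
      proof (rule mult_left_mono)
        show "sqsum B g + sqsum A ?f \<le> ?N"
          unfolding sqsum_def by (auto intro!: sum_mono)
      qed (use D0 nu w1 in auto)
      finally show "cmod (of_real h * sform h (\<lambda>k. symbol_diff h j F (glue xs (bt t) k)) A B ?f g)
          \<le> h * (D * \<nu> * ?w ^ length xs * ?N)"
        using h by (simp add: norm_mult)
    qed
    also have "\<dots> = (h * real T) * (D * \<nu> * ?w ^ length xs * ?N)" by simp
    also have "\<dots> \<le> R * (D * \<nu> * ?w ^ length xs * ?N)"
      using TR D0 nu w1 N0 by (intro mult_right_mono) auto
    finally have S: "cmod S \<le> R * (D * \<nu> * ?w ^ length xs * ?N)" .
    have IH: "?bound xs F D b f" "?close xs F D b f"
      using snoc.IH[of F D b f, OF snoc.prems(1) md(1) dxs snoc.prems(4)] snoc.prems(5) by auto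
    have "?bound (xs @ [j]) F D b f"
      unfolding eq using norm_triangle_le[OF add_mono[OF IH(1) S]] by (simp add: algebra_simps)
    moreover have "?close (xs @ [j]) F D b f"
    proof -
      have "cmod ((sform h (\<lambda>k. F (glue xs b k)) A B f g - sform h (\<lambda>_. F b) A B f g) + S)
          \<le> D * (?w ^ length xs - 1) * ?N + R * (D * \<nu> * ?w ^ length xs * ?N)"
        by (rule norm_triangle_le[OF add_mono[OF IH(2) S]])
      then show ?thesis unfolding eq by (simp add: algebra_simps)
    qed
    ultimately show ?case ..
  qed
  then show "?bound xs F D b f" "?close xs F D b f" by blast+
qed

lemma sform_block_bounds:
  fixes F :: "real ^ 'n::finite \<Rightarrow> real ^ 'n \<Rightarrow> complex"
  assumes h: "0 < h" and F: "\<And>k. k \<in> hlattice h \<Longrightarrow> continuous_on UNIV (F k)"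
    and m: "mixed_diff_le h coords F (hbox h p R) D \<nu>" and nu: "0 \<le> \<nu>" and R: "0 \<le> R"
    and p: "p \<in> hlattice h"
    and A: "finite A" "A \<subseteq> hbox h p R" and B: "finite B" "B \<subseteq> hlattice h"
  shows "cmod (sform h F A B f g)
      \<le> D * (1 + R * \<nu>) ^ CARD('n) * (sqsum B g + sqsum A f)"
    and "cmod (sform h F A B f g - sform h (\<lambda>_. F p) A B f g)
      \<le> D * ((1 + R * \<nu>) ^ CARD('n) - 1) * (sqsum B g + sqsum A f)"
proof -
  have [simp]: "glue coords p k = k" for k :: "real ^ 'n"
    by (simp add: glue_def coords vec_eq_iff)
  have len: "length (coords :: 'n list) = CARD('n)"
    using coords distinct_card by metis
  have "p \<in> hbox h p R" using p R by (simp add: hbox_def)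
  from sform_glue_bounds[OF h F m nu R coords(1) p this _ A B, of f g]
  show "cmod (sform h F A B f g)
      \<le> D * (1 + R * \<nu>) ^ CARD('n) * (sqsum B g + sqsum A f)"
    and "cmod (sform h F A B f g - sform h (\<lambda>_. F p) A B f g)
      \<le> D * ((1 + R * \<nu>) ^ CARD('n) - 1) * (sqsum B g + sqsum A f)"
    by (simp_all add: len)
qed

subsection \<open>Cells of variable size\<close>

abbreviation jb :: "real ^ 'n::finite \<Rightarrow> real" where
  "jb k \<equiv> 1 + norm k"

lemma jb_pos [simp]: "0 < jb k"
  by (simp add: add_pos_nonneg)

lemma jb_powr_mult_minus: "jb k powr a * jb k powr (- a) = 1"
proof -
  have "jb k \<noteq> 0" using norm_ge_zero[of k] by linarith
  then show ?thesis by (subst powr_add[symmetric]) simp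
qed

text \<open>Mean value theorem; as \<open>a \<le> 1\<close>, the derivative of the power is largest
  in modulus at the smaller endpoint. It is applied with \<open>\<tau>\<close> and with
  \<open>- \<tau>\<close>.\<close>

lemma powr_diff_le:
  fixes x y a :: real
  assumes "0 < x" "x \<le> y" "a \<le> 1"
  shows "\<bar>y powr a - x powr a\<bar> \<le> \<bar>a\<bar> * x powr (a - 1) * (y - x)"
proof (cases "x = y")
  case False
  then have xy: "x < y" using assms by simp
  have "\<exists>z>x. z < y \<and> y powr a - x powr a = (y - x) * (a * z powr (a - 1))"
    by (rule MVT2[OF xy]) (use assms(1) in \<open>auto intro!: derivative_eq_intros\<close>)
  then obtain z where z: "x < z" "y powr a - x powr a = (y - x) * (a * z powr (a - 1))" by auto
  have "z powr (a - 1) \<le> x powr (a - 1)"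
    by (rule powr_mono2') (use assms z in auto)
  then have "\<bar>a\<bar> * z powr (a - 1) * (y - x) \<le> \<bar>a\<bar> * x powr (a - 1) * (y - x)"
    using xy by (intro mult_right_mono mult_left_mono) auto
  then show ?thesis using xy by (simp add: z(2) abs_mult mult_ac)
qed simp

text \<open>Both comparisons are assumed because the exponent may have either sign, as 2m - \<rho>
  |\<alpha>| does.\<close>

lemma powr_comparable:
  fixes x y K e :: real
  assumes "0 < x" "0 < y" "1 \<le> K" "y \<le> K * x" "x \<le> K * y"
  shows "y powr e \<le> K powr \<bar>e\<bar> * x powr e"
proof (cases "0 \<le> e")
  case True
  then have "y powr e \<le> (K * x) powr e"
    using assms by (intro powr_mono2) auto
  then show ?thesis using True assms by (simp add: powr_mult)
next
  case False
  then have "(K * y) powr e \<le> x powr e"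
    using assms by (intro powr_mono2') auto
  then have "K powr (- e) * (K powr e * y powr e) \<le> K powr (- e) * x powr e"
    using assms by (intro mult_left_mono) (auto simp: powr_mult)
  moreover have "K powr (- e) * (K powr e * y powr e) = y powr e"
    using assms by (simp add: mult.assoc[symmetric] powr_add[symmetric])
  ultimately show ?thesis using False by simp
qed

text \<open>For large x the perturbation is at most half of x and is absorbed; for bounded x the
  assumption \<open>1 \<le> y\<close> suffices.\<close>

lemma sublinear_perturbation:
  fixes c \<tau> :: real
  assumes "0 \<le> c" "\<tau> < 1"
  obtains \<kappa> where "0 < \<kappa>" "\<kappa> \<le> 1"
    "\<And>x y. 1 \<le> x \<Longrightarrow> 1 \<le> y \<Longrightarrow> x \<le> y + c * x powr \<tau> \<Longrightarrow> \<kappa> * x \<le> y"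
proof -
  \<comment> \<open>Solves T^(1 - \<tau>) = 2c + 1, so 2c x^\<tau> \<le> x from \<open>T\<close> on;
    the summand 1 ensures \<open>1 \<le> T\<close>.\<close>
  define T where "T = (2 * c + 1) powr (1 / (1 - \<tau>))"
  have T: "1 \<le> T" unfolding T_def using assms by (intro ge_one_powr_ge_zero) auto
  have "1 / (2 * T) * x \<le> y" if x: "1 \<le> x" and y: "1 \<le> y" and xy: "x \<le> y + c * x powr \<tau>" for x y
  proof (cases "T \<le> x")
    case True
    have "2 * c + 1 = T powr (1 - \<tau>)"
      unfolding T_def using assms by (simp add: powr_powr)
    also have "\<dots> \<le> x powr (1 - \<tau>)"
      using True T assms by (intro powr_mono2) auto
    finally have "2 * c * x powr \<tau> \<le> x powr (1 - \<tau>) * x powr \<tau>"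
      using x by (intro mult_right_mono) auto
    also have "\<dots> = x" using x by (simp add: powr_add[symmetric])
    finally have "x \<le> 2 * y" using xy by linarith
    also have "\<dots> \<le> (2 * T) * y" using T y by simp
    finally show ?thesis using T by (simp add: field_simps)
  next
    case False
    then have "x \<le> (2 * T) * 1" using T by simp
    also have "\<dots> \<le> (2 * T) * y" using T y by (intro mult_left_mono) auto
    finally show ?thesis using T by (simp add: field_simps)
  qed
  then show thesis
    using that[of "1 / (2 * T)"] T by (simp add: field_simps)
qed

definition Phi :: "real \<Rightarrow> real ^ 'n::finite \<Rightarrow> real ^ 'n" where
  "Phi \<tau> k = (jb k powr (- \<tau>)) *\<^sub>R k"

text \<open>The point is moved at fixed weight, then the weight is changed at the fixed point
  \<open>l\<close>. In the second part the mean value bound supplies a factor 1/(1 + |l|) that pays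
  for |l|; both parts contribute equally, hence the 2.\<close>

lemma norm_Phi_diff_le:
  assumes \<tau>: "0 < \<tau>" "\<tau> < 1" and le: "norm l \<le> norm k"
  shows "norm (Phi \<tau> k - Phi \<tau> l) \<le> 2 * norm (k - l) * jb l powr (- \<tau>)"
proof -
  have pos: "0 < jb l" "0 < jb k" by (auto intro: add_pos_nonneg)
  have tri: "norm k - norm l \<le> norm (k - l)" by (rule norm_triangle_ineq2)
  have eq: "Phi \<tau> k - Phi \<tau> l = (jb k powr (- \<tau>)) *\<^sub>R (k - l) + (jb k powr (- \<tau>) - jb l powr (- \<tau>)) *\<^sub>R l"
    by (simp add: Phi_def algebra_simps)
  have 1: "jb k powr (- \<tau>) * norm (k - l) \<le> jb l powr (- \<tau>) * norm (k - l)"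
    using pos le \<tau> by (intro mult_right_mono powr_mono2') auto
  have "\<bar>jb k powr (- \<tau>) - jb l powr (- \<tau>)\<bar> * norm l
      \<le> (\<bar>- \<tau>\<bar> * jb l powr (- \<tau> - 1) * (jb k - jb l)) * norm l"
    using powr_diff_le[of "jb l" "jb k" "- \<tau>"] pos le \<tau> by (intro mult_right_mono) auto
  also have "\<dots> \<le> (1 * jb l powr (- \<tau> - 1) * norm (k - l)) * jb l"
    using \<tau> tri le by (intro mult_mono) auto
  also have "\<dots> = norm (k - l) * (jb l powr (- \<tau> - 1) * jb l powr 1)"
    using pos by simp
  also have "\<dots> = norm (k - l) * jb l powr (- \<tau>)"
    by (subst powr_add[symmetric]) simp
  finally have 2: "\<bar>jb k powr (- \<tau>) - jb l powr (- \<tau>)\<bar> * norm l \<le> norm (k - l) * jb l powr (- \<tau>)" .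
  have "norm (Phi \<tau> k - Phi \<tau> l) \<le> jb k powr (- \<tau>) * norm (k - l)
      + \<bar>jb k powr (- \<tau>) - jb l powr (- \<tau>)\<bar> * norm l"
    unfolding eq by (rule order_trans[OF norm_triangle_ineq]) simp
  with 1 2 show ?thesis by (simp add: mult_ac)
qed

text \<open>The inverse estimate: \<open>k\<close> is (1 + |k|)^\<tau> times its image, and
  replacing the weight of \<open>l\<close> by that of \<open>k\<close> costs at most \<tau> |k - l|,
  which is absorbed on the left since \<open>\<tau> < 1\<close>.\<close>

lemma norm_diff_le_Phi:
  assumes \<tau>: "0 < \<tau>" "\<tau> < 1" and le: "norm l \<le> norm k"
  shows "(1 - \<tau>) * norm (k - l) \<le> jb k powr \<tau> * norm (Phi \<tau> k - Phi \<tau> l)"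
proof -
  have pos: "0 < jb l" "0 < jb k" by (auto intro: add_pos_nonneg)
  have tri: "norm k - norm l \<le> norm (k - l)" by (rule norm_triangle_ineq2)
  have "(jb k powr \<tau> - jb l powr \<tau>) *\<^sub>R Phi \<tau> l = (jb k powr \<tau>) *\<^sub>R Phi \<tau> l - l"
    by (simp add: Phi_def algebra_simps jb_powr_mult_minus)
  moreover have "(jb k powr \<tau>) *\<^sub>R Phi \<tau> k = k"
    by (simp add: Phi_def jb_powr_mult_minus)
  ultimately have eq: "k - l = (jb k powr \<tau>) *\<^sub>R (Phi \<tau> k - Phi \<tau> l) + (jb k powr \<tau> - jb l powr \<tau>) *\<^sub>R Phi \<tau> l"
    by (simp add: scaleR_diff_right)
  have nP: "norm (Phi \<tau> l) = jb l powr (- \<tau>) * norm l"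
    by (simp add: Phi_def)
  have "\<bar>jb k powr \<tau> - jb l powr \<tau>\<bar> * norm (Phi \<tau> l)
      \<le> (\<bar>\<tau>\<bar> * jb l powr (\<tau> - 1) * (jb k - jb l)) * (jb l powr (- \<tau>) * jb l)"
    unfolding nP using powr_diff_le[of "jb l" "jb k" \<tau>] pos le \<tau> by (intro mult_mono) auto
  also have "\<dots> = \<tau> * (jb k - jb l) * (jb l powr (\<tau> - 1) * jb l powr (- \<tau>) * jb l powr 1)"
    using \<tau> pos by simp
  also have "\<dots> = \<tau> * (norm k - norm l)"
    by (subst powr_add[symmetric])+ (use jb_pos[of l] in \<open>simp del: jb_pos\<close>)
  also have "\<dots> \<le> \<tau> * norm (k - l)" using tri \<tau> by simp
  finally have 2: "\<bar>jb k powr \<tau> - jb l powr \<tau>\<bar> * norm (Phi \<tau> l) \<le> \<tau> * norm (k - l)" .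
  have "norm (k - l) \<le> jb k powr \<tau> * norm (Phi \<tau> k - Phi \<tau> l)
      + \<bar>jb k powr \<tau> - jb l powr \<tau>\<bar> * norm (Phi \<tau> l)"
    by (subst eq, rule order_trans[OF norm_triangle_ineq]) simp
  with 2 show ?thesis by (simp add: algebra_simps)
qed

text \<open>The Lipschitz bound carries the weight of the point nearer to the origin. A displacement
  of at most (1 + |k|)/2 keeps that weight within a factor 2 of the one at \<open>k\<close>, whence
  4 = 2 * 2.\<close>

lemma norm_Phi_diff_near:
  assumes \<tau>: "0 < \<tau>" "\<tau> < 1" and \<eta>: "\<eta> \<le> 1 / 2" and near: "norm (k - l) \<le> \<eta> * jb k powr \<tau>"
  shows "norm (Phi \<tau> k - Phi \<tau> l) \<le> 4 * \<eta>"
proof -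
  have pos: "0 < jb l" "0 < jb k" "1 \<le> jb k" by (auto intro: add_pos_nonneg)
  note inv = jb_powr_mult_minus[of k \<tau>]
  have \<eta>0: "0 \<le> \<eta>"
    using order_trans[OF norm_ge_zero near] pos by (simp add: zero_le_mult_iff)
  show ?thesis
  proof (cases "norm l \<le> norm k")
    case True
    have "norm (k - l) \<le> 1 / 2 * jb k powr 1"
      by (rule order_trans[OF near]) (use \<eta> \<tau> pos in \<open>intro mult_mono powr_mono; auto\<close>)
    then have "jb k / 2 \<le> jb l"
      using norm_triangle_ineq2[of k l] pos by simp
    then have "jb l powr (- \<tau>) \<le> (jb k / 2) powr (- \<tau>)"
      using pos \<tau> by (intro powr_mono2') auto
    also have "\<dots> = 2 powr \<tau> * jb k powr (- \<tau>)"
      using pos by (simp add: powr_divide powr_minus_divide)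
    also have "\<dots> \<le> 2 * jb k powr (- \<tau>)"
      using powr_mono[of \<tau> 1 "2::real"] \<tau> by (intro mult_right_mono) auto
    finally have "2 * norm (k - l) * jb l powr (- \<tau>) \<le> 2 * (\<eta> * jb k powr \<tau>) * (2 * jb k powr (- \<tau>))"
      using near \<eta>0 by (intro mult_mono) auto
    also have "\<dots> = 4 * \<eta> * (jb k powr \<tau> * jb k powr (- \<tau>))" by (simp add: mult_ac)
    finally show ?thesis
      using norm_Phi_diff_le[OF \<tau> True] inv by simp
  next
    case False
    then have "norm (Phi \<tau> l - Phi \<tau> k) \<le> 2 * norm (l - k) * jb k powr (- \<tau>)"
      by (intro norm_Phi_diff_le \<tau>) auto
    also have "\<dots> \<le> 2 * (\<eta> * jb k powr \<tau>) * jb k powr (- \<tau>)"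
      using near by (intro mult_mono) (auto simp: norm_minus_commute \<eta>0)
    also have "\<dots> = 2 * \<eta> * (jb k powr \<tau> * jb k powr (- \<tau>))" by (simp add: mult_ac)
    finally show ?thesis using inv \<eta>0 by (simp add: norm_minus_commute)
  qed
qed

text \<open>If |l| \<le> |k|, the inverse estimate gives the claim. Otherwise it only gives a bound
  by (1 + |l|)^\<tau>, and \<open>sublinear_perturbation\<close> then shows that 1 + |l| is at most
  a multiple of 1 + |k|.\<close>

lemma Phi_close_comparable:
  assumes \<tau>: "0 < \<tau>" "\<tau> < 1" and r: "0 \<le> r"
  obtains K where "1 \<le> K"
    "\<And>k l :: real ^ 'n::finite. norm (Phi \<tau> k - Phi \<tau> l) \<le> r \<Longrightarrow>
       jb l \<le> K * jb k \<and> norm (k - l) \<le> K * jb k powr \<tau>"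
proof -
  define c where "c = r / (1 - \<tau>)"
  have c: "0 \<le> c" using \<tau> r by (simp add: c_def)
  obtain \<kappa> where \<kappa>: "0 < \<kappa>" "\<kappa> \<le> 1"
    "\<And>x y. 1 \<le> x \<Longrightarrow> 1 \<le> y \<Longrightarrow> x \<le> y + c * x powr \<tau> \<Longrightarrow> \<kappa> * x \<le> y"
    using sublinear_perturbation[OF c \<tau>(2)] by blast
  have main: "norm (k - l) \<le> c * jb k powr \<tau>"
    if "norm l \<le> norm k" "norm (Phi \<tau> k - Phi \<tau> l) \<le> r" for k l :: "real ^ 'n"
  proof -
    have "(1 - \<tau>) * norm (k - l) \<le> jb k powr \<tau> * r"
      by (rule order_trans[OF norm_diff_le_Phi[OF \<tau> that(1)]]) (use that(2) in \<open>simp add: mult_left_mono\<close>)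
    then show ?thesis using \<tau> by (simp add: c_def field_simps)
  qed
  have "jb l \<le> ((1 + c) / \<kappa>) * jb k \<and> norm (k - l) \<le> ((1 + c) / \<kappa>) * jb k powr \<tau>"
    if close: "norm (Phi \<tau> k - Phi \<tau> l) \<le> r" for k l :: "real ^ 'n"
  proof (cases "norm l \<le> norm k")
    case True
    have "1 \<le> (1 + c) / \<kappa>" "c \<le> (1 + c) / \<kappa>"
      using \<kappa> c mult_left_le_one_le[of c \<kappa>] by (auto simp: field_simps)
    moreover have "jb l \<le> 1 * jb k" using True by simp
    ultimately show ?thesis
      using main[OF True close] by (meson add_nonneg_nonneg mult_right_mono norm_ge_zero order_trans powr_ge_zero zero_le_one)
  next
    case False
    then have le: "norm k \<le> norm l" by simp
    have m: "norm (l - k) \<le> c * jb l powr \<tau>"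
      by (rule main[OF le]) (use close in \<open>simp add: norm_minus_commute\<close>)
    have "\<kappa> * jb l \<le> jb k"
      by (rule \<kappa>(3)) (use m norm_triangle_ineq2[of l k] in auto)
    then have l: "jb l \<le> jb k / \<kappa>" using \<kappa> by (simp add: field_simps)
    also have "\<dots> \<le> ((1 + c) / \<kappa>) * jb k"
      using \<kappa> c by (auto simp: field_simps)
    finally have 1: "jb l \<le> ((1 + c) / \<kappa>) * jb k" .
    have "jb l powr \<tau> \<le> (jb k / \<kappa>) powr \<tau>"
      using l \<tau> by (intro powr_mono2) (auto intro: add_nonneg_nonneg)
    also have "\<dots> = jb k powr \<tau> * (1 / \<kappa>) powr \<tau>"
      using \<kappa> by (simp add: powr_divide)
    also have "\<dots> \<le> jb k powr \<tau> * (1 / \<kappa>)"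
      using powr_mono[of \<tau> 1 "1 / \<kappa>"] \<tau> \<kappa> by (intro mult_left_mono) (auto simp: field_simps)
    finally have "c * jb l powr \<tau> \<le> c * (jb k powr \<tau> * (1 / \<kappa>))"
      using c by (intro mult_left_mono)
    also have "\<dots> \<le> ((1 + c) / \<kappa>) * jb k powr \<tau>"
      using \<kappa> c by (auto simp: field_simps)
    finally show ?thesis using 1 m by (simp add: norm_minus_commute)
  qed
  moreover have "1 \<le> (1 + c) / \<kappa>" using \<kappa> c by (auto simp: field_simps)
  ultimately show thesis using that by blast
qed

section \<open>Translates of the cell partition and their boundary zones\<close>

definition cell :: "real \<Rightarrow> real \<Rightarrow> real ^ 'n::finite \<Rightarrow> 'n \<Rightarrow> int" where
  "cell \<tau> s k i = \<lfloor>Phi \<tau> k $ i - s\<rfloor>"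

definition adjacent :: "('n \<Rightarrow> int) \<Rightarrow> ('n \<Rightarrow> int) \<Rightarrow> bool" where
  "adjacent c d \<longleftrightarrow> (\<forall>i. \<bar>c i - d i\<bar> \<le> 1)"

text \<open>The thickness \<open>\<omega>\<close> is measured after \<open>Phi\<close>, so in the
  lattice the boundary layer grows with the cells, like (1 + |k|)^\<tau>.\<close>

definition zone :: "real \<Rightarrow> real \<Rightarrow> real \<Rightarrow> (real ^ 'n::finite) set" where
  "zone \<tau> \<omega> s = {k. \<exists>i. \<exists>z::int. \<bar>Phi \<tau> k $ i - s - of_int z\<bar> \<le> \<omega>}"

lemma adjacent_cells_Phi:
  fixes k l :: "real ^ 'n::finite"
  assumes "adjacent (cell \<tau> s k) (cell \<tau> s l)"
  shows "norm (Phi \<tau> k - Phi \<tau> l) \<le> 2 * real CARD('n)"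
proof -
  have "\<bar>(Phi \<tau> k - Phi \<tau> l) $ i\<bar> \<le> 2" for i
    using assms[unfolded adjacent_def cell_def, rule_format, of i]
    by (simp add: vector_minus_component) linarith
  then have "(\<Sum>i\<in>UNIV. \<bar>(Phi \<tau> k - Phi \<tau> l) $ i\<bar>) \<le> real CARD('n) * 2"
    by (intro sum_bounded_above) auto
  then show ?thesis using norm_le_l1_cart[of "Phi \<tau> k - Phi \<tau> l"] by linarith
qed

lemma distinct_cells_near:
  fixes k l :: "real ^ 'n::finite"
  assumes ne: "cell \<tau> s k \<noteq> cell \<tau> s l" and near: "norm (Phi \<tau> k - Phi \<tau> l) \<le> \<omega>" and \<omega>: "\<omega> < 1"
  shows "k \<in> zone \<tau> \<omega> s" "l \<in> zone \<tau> \<omega> s" "adjacent (cell \<tau> s k) (cell \<tau> s l)"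
proof -
  have comp: "\<bar>Phi \<tau> k $ i - Phi \<tau> l $ i\<bar> \<le> \<omega>" for i
    using component_le_norm_cart[of "Phi \<tau> k - Phi \<tau> l" i] near by simp
  show "adjacent (cell \<tau> s k) (cell \<tau> s l)"
    unfolding adjacent_def cell_def
  proof
    fix i show "\<bar>\<lfloor>Phi \<tau> k $ i - s\<rfloor> - \<lfloor>Phi \<tau> l $ i - s\<rfloor>\<bar> \<le> 1"
      using comp[of i] \<omega> by linarith
  qed
  obtain i where i: "\<lfloor>Phi \<tau> k $ i - s\<rfloor> \<noteq> \<lfloor>Phi \<tau> l $ i - s\<rfloor>"
    using ne by (auto simp: cell_def fun_eq_iff)
  \<comment> \<open>Two numbers at distance below 1 with different floors are separated by the
    larger floor: this is the wall between the cells.\<close>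
  define z where "z = max \<lfloor>Phi \<tau> k $ i - s\<rfloor> \<lfloor>Phi \<tau> l $ i - s\<rfloor>"
  have "\<bar>Phi \<tau> k $ i - s - of_int z\<bar> \<le> \<omega> \<and> \<bar>Phi \<tau> l $ i - s - of_int z\<bar> \<le> \<omega>"
    using i comp[of i] unfolding z_def by linarith
  then show "k \<in> zone \<tau> \<omega> s" "l \<in> zone \<tau> \<omega> s" by (auto simp: zone_def)
qed

text \<open>In one coordinate the walls of the \<open>J\<close> shifts are 1/J apart modulo 1, which
  exceeds the width 2 \<omega> of a boundary layer; so each coordinate spoils at most one
  shift.\<close>

lemma card_zone_shifts_le:
  fixes k :: "real ^ 'n::finite"
  assumes J: "0 < J" and \<omega>: "2 * \<omega> * real J < 1"
  shows "card {t. t < J \<and> k \<in> zone \<tau> \<omega> (real t / real J)} \<le> CARD('n)"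
proof -
  define S where "S i = {t. t < J \<and> (\<exists>z::int. \<bar>Phi \<tau> k $ i - real t / real J - of_int z\<bar> \<le> \<omega>)}" for i
  have "t = t'" if "t \<in> S i" "t' \<in> S i" for t t' i
  proof -
    from that obtain z z' :: int where
      *: "\<bar>Phi \<tau> k $ i - real t / real J - of_int z\<bar> \<le> \<omega>"
         "\<bar>Phi \<tau> k $ i - real t' / real J - of_int z'\<bar> \<le> \<omega>"
      by (auto simp: S_def)
    then have "\<bar>real t / real J + of_int z - (real t' / real J + of_int z')\<bar> \<le> 2 * \<omega>" by linarith
    then have "\<bar>real t / real J + of_int z - (real t' / real J + of_int z')\<bar> * real J \<le> 2 * \<omega> * real J"
      by (intro mult_right_mono) auto
    also have "\<bar>real t / real J + of_int z - (real t' / real J + of_int z')\<bar> * real J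
        = \<bar>(real t / real J + of_int z - (real t' / real J + of_int z')) * real J\<bar>"
      by (simp add: abs_mult)
    also have "(real t / real J + of_int z - (real t' / real J + of_int z')) * real J
        = of_int (int t - int t' + int J * (z - z'))"
      using J by (simp add: field_simps)
    finally have "\<bar>int t - int t' + int J * (z - z')\<bar> < 1"
      using \<omega> by (simp only: of_int_abs[symmetric])
    then have eq: "int t - int t' = int J * (z' - z)" by (simp add: algebra_simps)
    have "\<bar>int t - int t'\<bar> < int J" using that by (auto simp: S_def)
    then have "z' - z = 0"
      unfolding eq abs_mult using J
      by (metis abs_of_nat int_one_le_iff_zero_less mult.right_neutral mult_less_cancel_left_pos
          not_less of_nat_0_less_iff zero_less_abs_iff)
    then show ?thesis using eq by simp
  qed
  note uniq = this
  have fin: "finite (S i)" for i by (simp add: S_def)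
  have "card (S i) \<le> 1" for i
    unfolding One_nat_def card_le_Suc0_iff_eq[OF fin] using uniq by blast
  then have "card (\<Union>i\<in>UNIV. S i) \<le> (\<Sum>i\<in>(UNIV::'n set). 1)"
    by (intro order_trans[OF card_UN_le sum_mono]) auto
  moreover have "{t. t < J \<and> k \<in> zone \<tau> \<omega> (real t / real J)} = (\<Union>i\<in>UNIV. S i)"
    by (auto simp: zone_def S_def)
  ultimately show ?thesis by simp
qed

section \<open>A Schur test on the lattice\<close>

definition lweight :: "real \<Rightarrow> real ^ 'n::finite \<Rightarrow> real" where
  "lweight h d = (\<Prod>i\<in>UNIV. 1 / (1 + (d $ i / h)\<^sup>2))"

lemma sum_inverse_square_Ints_le:
  assumes fin: "finite U" and U: "U \<subseteq> \<int>"
  shows "(\<Sum>x\<in>U. 1 / (1 + x\<^sup>2)) \<le> (6::real)"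
proof -
  let ?u = "\<lambda>x::real. 1 / (1 + x\<^sup>2)"
  \<comment> \<open>The term 1/(1 + (N+1)^2) is at most 2/((N+1)(N+2)), which telescopes. The two
    half-lines then give 3 + 3.\<close>
  have nat: "(\<Sum>k\<le>N. ?u (real k)) \<le> 3 - 2 / (real N + 1)" for N
  proof (induction N)
    case (Suc N)
    have "?u (real (Suc N)) \<le> 2 / (real N + 1) - 2 / (real N + 2)"
      by (simp add: divide_simps add_pos_nonneg) (simp add: algebra_simps power2_eq_square)
    then show ?case using Suc by (simp add: add.commute)
  qed simp
  have nat3: "(\<Sum>k\<le>N. ?u (real k)) \<le> 3" for N
    by (rule order_trans[OF nat]) simp
  obtain N :: nat where N: "\<And>x. x \<in> U \<Longrightarrow> \<bar>x\<bar> \<le> real N"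
  proof -
    obtain M where "\<And>x. x \<in> U \<Longrightarrow> \<bar>x\<bar> \<le> M"
      using finite_imp_bounded[OF fin] by (auto simp: bounded_iff)
    then show thesis using that real_arch_simple[of M] by (meson order_trans)
  qed
  have sub: "U \<subseteq> real ` {..N} \<union> (\<lambda>k. - real k) ` {..N}"
  proof
    fix x assume x: "x \<in> U"
    then obtain z where z: "x = of_int z" using U by (auto elim: Ints_cases)
    have "nat \<bar>z\<bar> \<le> N" using N[OF x] z by simp
    moreover have "x = real (nat \<bar>z\<bar>) \<or> x = - real (nat \<bar>z\<bar>)" using z by auto
    ultimately show "x \<in> real ` {..N} \<union> (\<lambda>k. - real k) ` {..N}" by blast
  qed
  have "(\<Sum>x\<in>U. ?u x) \<le> (\<Sum>x\<in>real ` {..N} \<union> (\<lambda>k. - real k) ` {..N}. ?u x)"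
    by (intro sum_mono2 sub) auto
  also have "\<dots> \<le> (\<Sum>x\<in>real ` {..N}. ?u x) + (\<Sum>x\<in>(\<lambda>k. - real k) ` {..N}. ?u x)"
    by (subst sum_Un) (auto intro!: sum_nonneg)
  also have "\<dots> = (\<Sum>k\<le>N. ?u (real k)) + (\<Sum>k\<le>N. ?u (real k))"
    by (subst sum.reindex, simp add: inj_on_def)+ (simp add: o_def)
  also have "\<dots> \<le> 6" using nat3[of N] by simp
  finally show ?thesis .
qed

text \<open>The weight is a product over coordinates, so its sum over a full grid is a product of
  one-dimensional sums. \<open>S\<close> is embedded in the grid over all rescaled coordinates that
  occur in it.\<close>

lemma sum_lweight_le:
  fixes S :: "(real ^ 'n::finite) set"
  assumes h: "h \<noteq> 0" and S: "finite S" "S \<subseteq> hlattice h"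
  shows "(\<Sum>d\<in>S. lweight h d) \<le> 6 ^ CARD('n)"
proof -
  let ?u = "\<lambda>x::real. 1 / (1 + x\<^sup>2)"
  define U where "U = (\<Union>d\<in>S. range (\<lambda>i. d $ i / h))"
  have fin: "finite U" unfolding U_def using S by auto
  have Z: "U \<subseteq> \<int>"
  proof
    fix x assume "x \<in> U"
    then obtain d i where "d \<in> S" and x: "x = d $ i / h" unfolding U_def by auto
    then have d: "d \<in> hlattice h" using S(2) by auto
    obtain z :: int where "d $ i = h * of_int z" using hlattice_iff[OF h, of d] d by blast
    then show "x \<in> \<int>" using x h by simp
  qed
  define e where "e d = (\<lambda>i. d $ i / h)" for d :: "real ^ 'n"
  have inj: "inj_on e S"
    unfolding inj_on_def e_def using h by (auto simp: fun_eq_iff vec_eq_iff)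
  have eS: "e ` S \<subseteq> PiE UNIV (\<lambda>_. U)" by (auto simp: e_def U_def PiE_def)
  have "(\<Sum>d\<in>S. lweight h d) = (\<Sum>d\<in>S. \<Prod>i\<in>UNIV. ?u (e d i))"
    by (simp add: lweight_def e_def)
  also have "\<dots> = (\<Sum>\<phi>\<in>e ` S. \<Prod>i\<in>UNIV. ?u (\<phi> i))"
    by (subst sum.reindex[OF inj]) simp
  also have "\<dots> \<le> (\<Sum>\<phi>\<in>PiE (UNIV::'n set) (\<lambda>_. U). \<Prod>i\<in>UNIV. ?u (\<phi> i))"
    by (rule sum_mono2[OF _ eS]) (auto intro!: finite_PiE fin prod_nonneg)
  also have "\<dots> = (\<Prod>i\<in>(UNIV::'n set). \<Sum>x\<in>U. ?u x)"
    by (rule prod_sum_PiE[symmetric]) (auto simp: fin)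
  also have "\<dots> \<le> (\<Prod>i\<in>(UNIV::'n set). 6)"
    by (intro prod_mono conjI sum_nonneg sum_inverse_square_Ints_le fin Z) auto
  finally show ?thesis by simp
qed

text \<open>The dominating kernel is a convolution kernel, so row and column sums obey the same
  bound. The product of \<open>f\<close> and \<open>g\<close> is again split into a sum of
  squares.\<close>

lemma schur_test:
  fixes f g :: "real ^ 'n::finite \<Rightarrow> complex"
  assumes h: "h \<noteq> 0" and A: "finite A" "A \<subseteq> hlattice h" and B: "finite B" "B \<subseteq> hlattice h"
    and M: "\<And>k l. k \<in> A \<Longrightarrow> l \<in> B \<Longrightarrow> cmod (a k l) \<le> C * lweight h (k - l)" and C: "0 \<le> C"
  shows "cmod (\<Sum>k\<in>A. \<Sum>l\<in>B. a k l * g l * cnj (f k)) \<le> C * 6 ^ CARD('n) * (sqsum B g + sqsum A f)"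
proof -
  let ?w = "lweight h"
  have w0: "0 \<le> ?w d" for d :: "real ^ 'n" unfolding lweight_def by (intro prod_nonneg) auto
  have row: "(\<Sum>l\<in>B. ?w (k - l)) \<le> 6 ^ CARD('n)" if "k \<in> A" for k
  proof -
    have "(\<Sum>l\<in>B. ?w (k - l)) = (\<Sum>d\<in>(\<lambda>l. k - l) ` B. ?w d)"
      by (subst sum.reindex) (auto simp: inj_on_def)
    also have "\<dots> \<le> 6 ^ CARD('n)"
      using that A B by (intro sum_lweight_le h) (auto intro!: hlattice_diff)
    finally show ?thesis .
  qed
  have col: "(\<Sum>k\<in>A. ?w (k - l)) \<le> 6 ^ CARD('n)" if "l \<in> B" for l
  proof -
    have "(\<Sum>k\<in>A. ?w (k - l)) = (\<Sum>d\<in>(\<lambda>k. k - l) ` A. ?w d)"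
      by (subst sum.reindex) (auto simp: inj_on_def)
    also have "\<dots> \<le> 6 ^ CARD('n)"
      using that A B by (intro sum_lweight_le h) (auto intro!: hlattice_diff)
    finally show ?thesis .
  qed
  have "cmod (\<Sum>k\<in>A. \<Sum>l\<in>B. a k l * g l * cnj (f k))
      \<le> (\<Sum>k\<in>A. \<Sum>l\<in>B. C * ?w (k - l) * ((cmod (g l))\<^sup>2 + (cmod (f k))\<^sup>2))"
  proof (intro sum_norm_le)
    fix k l assume kl: "k \<in> A" "l \<in> B"
    have "cmod (g l) * cmod (f k) \<le> (cmod (g l))\<^sup>2 + (cmod (f k))\<^sup>2"
      using sum_squares_bound[of "cmod (g l)" "cmod (f k)"]
        mult_nonneg_nonneg[OF norm_ge_zero[of "g l"] norm_ge_zero[of "f k"]] by linarith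
    then have "cmod (a k l) * (cmod (g l) * cmod (f k))
        \<le> C * ?w (k - l) * ((cmod (g l))\<^sup>2 + (cmod (f k))\<^sup>2)"
      by (intro mult_mono M kl mult_nonneg_nonneg C w0) auto
    then show "cmod (a k l * g l * cnj (f k)) \<le> C * ?w (k - l) * ((cmod (g l))\<^sup>2 + (cmod (f k))\<^sup>2)"
      by (simp add: norm_mult mult.assoc)
  qed
  also have "\<dots> = C * ((\<Sum>k\<in>A. \<Sum>l\<in>B. ?w (k - l) * (cmod (g l))\<^sup>2)
      + (\<Sum>k\<in>A. \<Sum>l\<in>B. ?w (k - l) * (cmod (f k))\<^sup>2))"
    by (simp add: sum_distrib_left sum.distrib algebra_simps)
  also have "\<dots> \<le> C * ((\<Sum>l\<in>B. 6 ^ CARD('n) * (cmod (g l))\<^sup>2) + (\<Sum>k\<in>A. 6 ^ CARD('n) * (cmod (f k))\<^sup>2))"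
  proof (intro mult_left_mono[OF _ C] add_mono)
    have "(\<Sum>k\<in>A. \<Sum>l\<in>B. ?w (k - l) * (cmod (g l))\<^sup>2)
        = (\<Sum>l\<in>B. (\<Sum>k\<in>A. ?w (k - l)) * (cmod (g l))\<^sup>2)"
      by (subst sum.swap) (simp add: sum_distrib_right)
    also have "\<dots> \<le> (\<Sum>l\<in>B. 6 ^ CARD('n) * (cmod (g l))\<^sup>2)"
      by (intro sum_mono mult_right_mono col) auto
    finally show "(\<Sum>k\<in>A. \<Sum>l\<in>B. ?w (k - l) * (cmod (g l))\<^sup>2)
        \<le> (\<Sum>l\<in>B. 6 ^ CARD('n) * (cmod (g l))\<^sup>2)" .
    have "(\<Sum>k\<in>A. \<Sum>l\<in>B. ?w (k - l) * (cmod (f k))\<^sup>2)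
        = (\<Sum>k\<in>A. (\<Sum>l\<in>B. ?w (k - l)) * (cmod (f k))\<^sup>2)"
      by (simp add: sum_distrib_right)
    also have "\<dots> \<le> (\<Sum>k\<in>A. 6 ^ CARD('n) * (cmod (f k))\<^sup>2)"
      by (intro sum_mono mult_right_mono row) auto
    finally show "(\<Sum>k\<in>A. \<Sum>l\<in>B. ?w (k - l) * (cmod (f k))\<^sup>2)
        \<le> (\<Sum>k\<in>A. 6 ^ CARD('n) * (cmod (f k))\<^sup>2)" .
  qed
  finally show ?thesis
    by (simp add: sqsum_def sum_distrib_left algebra_simps)
qed

subsection \<open>Estimates for a symbol class\<close>

lemma foldr_funpow_zero: "foldr (\<lambda>j. F j ^^ 0) xs g = g"
  by (induction xs) auto

lemma Diff_op_zero: "Diff_op h (\<lambda>_. 0) g = g"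
  unfolding Diff_op_def by (rule foldr_funpow_zero)

lemma foldr_tor_op_zero: "(\<And>i. i \<in> set xs \<Longrightarrow> \<beta> i = 0) \<Longrightarrow> foldr (\<lambda>i. tor_op h i (\<beta> i)) xs f = f"
  by (induction xs) auto

lemma Tor_op_zero: "Tor_op h (\<lambda>_. 0) f = f"
  unfolding Tor_op_def by (rule foldr_tor_op_zero) simp

lemma Tor_op_single: "Tor_op h (\<lambda>i. if i = j then N else 0) f = tor_op h j N f"
proof -
  have "j \<in> set (coords :: 'a list)" by (simp add: coords)
  then obtain xs ys where xy: "(coords :: 'a list) = xs @ j # ys" "j \<notin> set xs" "j \<notin> set ys"
    using coords(1) by (metis distinct.simps(2) distinct_append not_distinct_conv_prefix split_list_first)
  let ?\<beta> = "\<lambda>i. if i = j then N else 0"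
  have "foldr (\<lambda>i. tor_op h i (?\<beta> i)) ys f = f"
    "foldr (\<lambda>i. tor_op h i (?\<beta> i)) xs (tor_op h j N f) = tor_op h j N f"
    by (rule foldr_tor_op_zero; use xy in auto)+
  then show ?thesis unfolding Tor_op_def xy(1) by simp
qed

text \<open>Linear in \<open>x\<close>, with the remaining powers estimated at \<open>c\<close>:
  this turns the freezing error of a box into a multiple of R \<nu>.\<close>

lemma power_one_plus_minus_one_le:
  fixes x c :: real
  assumes "0 \<le> x" "x \<le> c"
  shows "(1 + x) ^ n - 1 \<le> real n * x * (1 + c) ^ n"
proof (induction n)
  case (Suc n)
  have "(1 + x) ^ Suc n - 1 = ((1 + x) ^ n - 1) + x * (1 + x) ^ n" by (simp add: algebra_simps)
  also have "\<dots> \<le> real n * x * (1 + c) ^ n + x * (1 + c) ^ n"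
    using assms by (intro add_mono Suc.IH mult_left_mono power_mono) auto
  also have "\<dots> = real (Suc n) * x * (1 + c) ^ n" by (simp add: algebra_simps)
  also have "\<dots> \<le> real (Suc n) * x * (1 + c) ^ Suc n"
    using assms by (intro mult_left_mono power_increasing) auto
  finally show ?case .
qed simp

locale semiclassical_symbol =
  fixes h m \<rho> \<delta> \<tau> :: real and \<sigma> :: "real ^ 'n::finite \<Rightarrow> real ^ 'n \<Rightarrow> complex"
  assumes h: "0 < h" and m: "0 < m" and \<delta>: "0 \<le> \<delta>" "\<delta> < \<tau>" and \<rho>: "\<tau> < \<rho>" "\<rho> \<le> 1"
    and \<sigma>: "\<sigma> \<in> symbol_class h (2 * m) \<rho> \<delta>"
begin

abbreviation "L \<equiv> (hlattice h :: (real ^ 'n) set)"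
abbreviation "form \<equiv> sform h \<sigma>"

lemma h0: "h \<noteq> 0" using h by simp

lemma \<tau>: "0 < \<tau>" "\<tau> < 1" using \<delta> \<rho> by auto

lemma smooth: "k \<in> L \<Longrightarrow> smooth_fun (\<sigma> k)"
  and periodic: "k \<in> L \<Longrightarrow> torus_periodic (\<sigma> k)"
  using \<sigma> unfolding symbol_class_def by auto

lemma cont: "k \<in> L \<Longrightarrow> continuous_on S (\<sigma> k)"
  using smooth smooth_fun_continuous by blast

lemma symbol_bound:
  "\<exists>C. \<forall>k\<in>L. \<forall>\<theta>. cmod (Tor_op h \<beta> (\<lambda>\<theta>'. Diff_op h \<alpha> (\<lambda>k'. \<sigma> k' \<theta>') k) \<theta>)
          \<le> C * (1 + norm k) powr (2 * m - \<rho> * real (mi_size \<alpha>) + \<delta> * real (mi_size \<beta>))"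
  using \<sigma> unfolding symbol_class_def by blast

text \<open>One constant for the finitely many multi-indices with entries 0 and 1, the only ones
  that \<open>mixed_diff_le\<close> asks for.\<close>

lemma Diff_op_bound:
  obtains C where "0 \<le> C" "\<And>\<alpha> k \<theta>. \<forall>i. \<alpha> i \<le> 1 \<Longrightarrow> k \<in> L \<Longrightarrow>
    cmod (Diff_op h \<alpha> (\<lambda>k'. \<sigma> k' \<theta>) k) \<le> C * jb k powr (2 * m - \<rho> * real (mi_size \<alpha>))"
proof -
  have "\<forall>\<alpha>. \<exists>C. \<forall>k\<in>L. \<forall>\<theta>. cmod (Diff_op h \<alpha> (\<lambda>k'. \<sigma> k' \<theta>) k)
      \<le> C * jb k powr (2 * m - \<rho> * real (mi_size \<alpha>))"
    using symbol_bound[of "\<lambda>_. 0"] by (simp add: Tor_op_zero mi_size_def)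
  then obtain c where c: "\<And>\<alpha> k \<theta>. k \<in> L \<Longrightarrow> cmod (Diff_op h \<alpha> (\<lambda>k'. \<sigma> k' \<theta>) k)
      \<le> c \<alpha> * jb k powr (2 * m - \<rho> * real (mi_size \<alpha>))"
    by metis
  define F where "F = {\<alpha> :: 'n \<Rightarrow> nat. \<forall>i. \<alpha> i \<le> 1}"
  have "F = PiE UNIV (\<lambda>_. {..1})" by (auto simp: F_def PiE_def Pi_def)
  then have fin: "finite F" by (simp add: finite_PiE)
  define C where "C = (\<Sum>\<alpha>\<in>F. \<bar>c \<alpha>\<bar>)"
  show thesis
  proof (rule that[of C])
    show "0 \<le> C" unfolding C_def by (intro sum_nonneg) auto
    fix \<alpha> :: "'n \<Rightarrow> nat" and k \<theta> assume \<alpha>: "\<forall>i. \<alpha> i \<le> 1" and k: "k \<in> L"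
    have "\<bar>c \<alpha>\<bar> \<le> C" unfolding C_def using \<alpha> fin by (intro member_le_sum) (auto simp: F_def)
    then have "c \<alpha> \<le> C" by simp
    then show "cmod (Diff_op h \<alpha> (\<lambda>k'. \<sigma> k' \<theta>) k) \<le> C * jb k powr (2 * m - \<rho> * real (mi_size \<alpha>))"
      by (intro order_trans[OF c[OF k]] mult_right_mono) auto
  qed
qed

text \<open>Covers a single cell as well as a cell with its neighbours. As the diameter is taken
  after \<open>Phi\<close>, one \<open>r\<close> serves at all scales.\<close>

definition cluster :: "real \<Rightarrow> (real ^ 'n) set \<Rightarrow> bool" where
  "cluster r A \<longleftrightarrow> finite A \<and> A \<subseteq> L \<and> (\<forall>k\<in>A. \<forall>l\<in>A. norm (Phi \<tau> k - Phi \<tau> l) \<le> r)"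

text \<open>Only the rows must be clustered, since the symbol depends on the row index. The freezing
  point is the lower corner of the bounding box of \<open>A\<close> and need not lie in
  \<open>A\<close>; its size is compared with that of \<open>k0\<close> so that ellipticity at
  \<open>p\<close> can give growth at \<open>k0\<close>.\<close>

lemma block_bounds:
  assumes r: "0 \<le> r"
  obtains D where "1 \<le> D"
    "\<And>A B f g k0. cluster r A \<Longrightarrow> k0 \<in> A \<Longrightarrow> finite B \<Longrightarrow> B \<subseteq> L \<Longrightarrow>
      cmod (form A B f g) \<le> D * jb k0 powr (2 * m) * (sqsum B g + sqsum A f)"
    "\<And>A B k0. cluster r A \<Longrightarrow> k0 \<in> A \<Longrightarrow> finite B \<Longrightarrow> B \<subseteq> L \<Longrightarrow>
      \<exists>p\<in>L. jb k0 \<le> D * jb p \<and> (\<forall>f g. cmod (form A B f g - sform h (\<lambda>_. \<sigma> p) A B f g)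
        \<le> D * jb k0 powr (2 * m - (\<rho> - \<tau>)) * (sqsum B g + sqsum A f))"
proof -
  obtain K where K: "1 \<le> K" "\<And>k l :: real ^ 'n. norm (Phi \<tau> k - Phi \<tau> l) \<le> r \<Longrightarrow>
       jb l \<le> K * jb k \<and> norm (k - l) \<le> K * jb k powr \<tau>"
    using Phi_close_comparable[OF \<tau> r] by blast
  \<comment> \<open>In units of (1 + |k0|)^\<tau> and per coordinate: K from \<open>k0\<close> to
    the corner plus 2K along the side of the box; the norm is at most the sum over the
    coordinates.\<close>
  define c where "c = 3 * K * real CARD('n)"
  have c0: "0 \<le> c" using K by (simp add: c_def)
  obtain \<kappa> where \<kappa>: "0 < \<kappa>" "\<kappa> \<le> 1"
    "\<And>x y. 1 \<le> x \<Longrightarrow> 1 \<le> y \<Longrightarrow> x \<le> y + c * x powr \<tau> \<Longrightarrow> \<kappa> * x \<le> y"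
    using sublinear_perturbation[OF c0 \<tau>(2)] by blast
  define K' where "K' = max (1 + c) (1 / \<kappa>)"
  have K': "1 \<le> K'" "1 + c \<le> K'" "1 / \<kappa> \<le> K'" using c0 by (auto simp: K'_def)
  obtain C where C: "0 \<le> C" "\<And>\<alpha> k \<theta>. \<forall>i. \<alpha> i \<le> 1 \<Longrightarrow> k \<in> L \<Longrightarrow>
    cmod (Diff_op h \<alpha> (\<lambda>k'. \<sigma> k' \<theta>) k) \<le> C * jb k powr (2 * m - \<rho> * real (mi_size \<alpha>))"
    using Diff_op_bound by blast
  \<comment> \<open>The exponent bounds the modulus of every 2m - \<rho> |\<alpha>| with |\<alpha>|
    at most the dimension, so \<open>D0\<close> moves the symbol bounds from any point of the box to
    \<open>k0\<close>.\<close>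
  define D0 where "D0 = C * K' powr (2 * m + real CARD('n))"
  have D0: "0 \<le> D0" using C by (simp add: D0_def)
  define E where "E = (1 + 2 * K) ^ CARD('n)"
  have E: "1 \<le> E" unfolding E_def using K by (intro one_le_power) auto
  define D where "D = D0 * E + D0 * (real CARD('n) * (2 * K) * E) + K'"
  have D: "1 \<le> D" "D0 * E \<le> D" "D0 * (real CARD('n) * (2 * K) * E) \<le> D" "K' \<le> D"
  proof -
    have "0 \<le> D0 * E" "0 \<le> D0 * (real CARD('n) * (2 * K) * E)"
      using D0 E K by (auto intro!: mult_nonneg_nonneg)
    then show "1 \<le> D" "D0 * E \<le> D" "D0 * (real CARD('n) * (2 * K) * E) \<le> D" "K' \<le> D"
      using K' unfolding D_def by linarith+
  qed
  have main: "\<exists>p\<in>L. jb k0 \<le> K' * jb p \<and> (\<forall>f g.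
      cmod (form A B f g) \<le> D0 * E * jb k0 powr (2 * m) * (sqsum B g + sqsum A f) \<and>
      cmod (form A B f g - sform h (\<lambda>_. \<sigma> p) A B f g)
        \<le> D0 * (real CARD('n) * (2 * K) * E) * jb k0 powr (2 * m - (\<rho> - \<tau>)) * (sqsum B g + sqsum A f))"
    if A: "cluster r A" and k0: "k0 \<in> A" and B: "finite B" "B \<subseteq> L" for A B k0
  proof -
    have fin: "finite A" and AL: "A \<subseteq> L"
      and close: "\<And>k. k \<in> A \<Longrightarrow> norm (Phi \<tau> k0 - Phi \<tau> k) \<le> r"
      using A k0 by (auto simp: cluster_def)
    define X where "X = jb k0"
    have X: "1 \<le> X" by (simp add: X_def)
    have comp: "\<bar>k0 $ i - k $ i\<bar> \<le> K * X powr \<tau>" if "k \<in> A" for k i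
      using K(2)[OF close[OF that]] component_le_norm_cart[of "k0 - k" i] by (simp add: X_def)
    define p where "p = (\<chi> i. Min ((\<lambda>k. k $ i) ` A))"
    define R where "R = 2 * K * X powr \<tau>"
    have R: "0 \<le> R" using K by (simp add: R_def)
    have p_le: "p $ i \<le> k $ i" if "k \<in> A" for k i
      using that fin by (simp add: p_def)
    have p_eq: "\<exists>k\<in>A. p $ i = k $ i" for i
    proof -
      have "p $ i \<in> (\<lambda>k. k $ i) ` A"
        unfolding p_def vec_lambda_beta using fin k0 by (intro Min_in) auto
      then show ?thesis by auto
    qed
    have pL: "p \<in> L"
      unfolding hlattice_iff[OF h0]
    proof
      fix i
      from p_eq[of i] obtain k where k: "k \<in> A" "p $ i = k $ i" by blast
      then have "k \<in> L" using AL by auto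
      then show "\<exists>z::int. p $ i = h * of_int z" using k(2) hlattice_iff[OF h0, of k] by auto
    qed
    have p_close: "\<bar>k0 $ i - p $ i\<bar> \<le> K * X powr \<tau>" for i
      using p_eq[of i] comp by auto
    have Abox: "A \<subseteq> hbox h p R"
    proof
      fix k assume k: "k \<in> A"
      have "k $ i \<le> p $ i + R" for i
        using comp[OF k, of i] p_close[of i] unfolding R_def by linarith
      then show "k \<in> hbox h p R" using k AL p_le by (auto simp: hbox_def)
    qed
    have near: "norm (q - k0) \<le> c * X powr \<tau>" if q: "q \<in> hbox h p R" for q
    proof -
      have "\<bar>(q - k0) $ i\<bar> \<le> 3 * K * X powr \<tau>" for i
      proof -
        have "p $ i \<le> q $ i" "q $ i \<le> p $ i + R" using q by (auto simp: hbox_def)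
        then show ?thesis using p_close[of i] by (simp add: R_def)
      qed
      then have "(\<Sum>i\<in>UNIV. \<bar>(q - k0) $ i\<bar>) \<le> real CARD('n) * (3 * K * X powr \<tau>)"
        by (intro sum_bounded_above) auto
      then show ?thesis using norm_le_l1_cart[of "q - k0"] by (simp add: c_def mult_ac)
    qed
    have Xtau: "X powr \<tau> \<le> X" using powr_mono[of \<tau> 1 X] X \<tau> by simp
    have cmp: "jb q \<le> K' * X \<and> X \<le> K' * jb q" if q: "q \<in> hbox h p R" for q
    proof -
      have "jb q \<le> X + c * X powr \<tau>"
        using near[OF q] norm_triangle_ineq2[of q k0] by (simp add: X_def)
      also have "\<dots> \<le> (1 + c) * X" using mult_left_mono[OF Xtau c0] by (simp add: algebra_simps)
      also have "\<dots> \<le> K' * X" using K' X by (intro mult_right_mono) auto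
      finally have 1: "jb q \<le> K' * X" .
      have "X \<le> jb q + c * X powr \<tau>"
        using near[OF q] norm_triangle_ineq3[of q k0] by (simp add: X_def)
      then have "\<kappa> * X \<le> jb q" using X by (intro \<kappa>(3)) auto
      then have "X \<le> 1 / \<kappa> * jb q" using \<kappa> by (simp add: field_simps)
      also have "\<dots> \<le> K' * jb q" using K' by (intro mult_right_mono) auto
      finally show ?thesis using 1 by simp
    qed
    define \<nu> where "\<nu> = X powr (- \<rho>)"
    have \<nu>: "0 \<le> \<nu>" by (simp add: \<nu>_def)
    have mix: "mixed_diff_le h coords \<sigma> (hbox h p R) (D0 * X powr (2 * m)) \<nu>"
      unfolding mixed_diff_le_def
    proof (intro allI impI ballI)
      fix \<alpha> :: "'n \<Rightarrow> nat" and q \<theta> assume \<alpha>: "\<forall>i. \<alpha> i \<le> 1" and q: "q \<in> hbox h p R"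
      let ?e = "2 * m - \<rho> * real (mi_size \<alpha>)"
      have "mi_size \<alpha> \<le> (\<Sum>i\<in>(UNIV::'n set). 1)" unfolding mi_size_def using \<alpha> by (intro sum_mono) auto
      then have "real (mi_size \<alpha>) \<le> real CARD('n)" by simp
      then have "\<rho> * real (mi_size \<alpha>) \<le> 1 * real CARD('n)" using \<rho> \<tau> by (intro mult_mono) auto
      moreover have "0 \<le> \<rho> * real (mi_size \<alpha>)" using \<rho> \<tau> by (intro mult_nonneg_nonneg) auto
      ultimately have e: "\<bar>?e\<bar> \<le> 2 * m + real CARD('n)" using m by linarith
      have "jb q powr ?e \<le> K' powr \<bar>?e\<bar> * X powr ?e"
        using cmp[OF q] K' X by (intro powr_comparable) auto
      also have "\<dots> \<le> K' powr (2 * m + real CARD('n)) * X powr ?e"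
        using e K' by (intro mult_right_mono powr_mono) auto
      also have "X powr ?e = X powr (2 * m) * \<nu> ^ mi_size \<alpha>"
        using X by (simp add: \<nu>_def powr_realpow[symmetric] powr_powr powr_add[symmetric])
      finally have e1: "jb q powr ?e \<le> K' powr (2 * m + real CARD('n)) * (X powr (2 * m) * \<nu> ^ mi_size \<alpha>)" .
      have "q \<in> L" using q by (simp add: hbox_def)
      then have "cmod (Diff_op h \<alpha> (\<lambda>k'. \<sigma> k' \<theta>) q) \<le> C * jb q powr ?e" by (rule C(2)[OF \<alpha>])
      also have "\<dots> \<le> C * (K' powr (2 * m + real CARD('n)) * (X powr (2 * m) * \<nu> ^ mi_size \<alpha>))"
        by (rule mult_left_mono[OF e1 C(1)])
      also have "\<dots> = D0 * X powr (2 * m) * \<nu> ^ mi_size \<alpha>" by (simp add: D0_def mult_ac)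
      finally show "cmod (foldr (\<lambda>j. diff_op h j ^^ \<alpha> j) coords (\<lambda>k. \<sigma> k \<theta>) q)
          \<le> D0 * X powr (2 * m) * \<nu> ^ (\<Sum>i\<in>set coords. \<alpha> i)"
        by (simp add: Diff_op_def mi_size_def coords)
    qed
    \<comment> \<open>Side length times gain per difference: the relative freezing error, a negative
      power of \<open>X\<close> because \<open>\<tau> < \<rho>\<close>.\<close>
    have Rnu: "R * \<nu> = 2 * K * X powr (\<tau> - \<rho>)"
      by (simp add: R_def \<nu>_def powr_diff powr_minus_divide)
    have "X powr (\<tau> - \<rho>) \<le> X powr 0" using X \<rho> by (intro powr_mono) auto
    then have Rnu_le: "R * \<nu> \<le> 2 * K" unfolding Rnu using K X by simp
    have Rnu0: "0 \<le> R * \<nu>" using R \<nu> by simp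
    have E_le: "(1 + R * \<nu>) ^ CARD('n) \<le> E"
      unfolding E_def using Rnu_le Rnu0 by (intro power_mono) auto
    have E_le': "(1 + R * \<nu>) ^ CARD('n) - 1 \<le> real CARD('n) * (2 * K) * E * X powr (\<tau> - \<rho>)"
      using power_one_plus_minus_one_le[OF Rnu0 Rnu_le, of "CARD('n)"] by (simp add: E_def Rnu mult_ac)
    show ?thesis
    proof (intro bexI[of _ p] conjI allI pL)
      have "p \<in> hbox h p R" using pL R by (simp add: hbox_def)
      then show "jb k0 \<le> K' * jb p" using cmp by (simp add: X_def)
      fix f g :: "real ^ 'n \<Rightarrow> complex"
      have N0: "0 \<le> sqsum B g + sqsum A f" by (simp add: sqsum_nonneg)
      note bb = sform_block_bounds[OF h cont mix \<nu> R pL fin Abox B, of f g]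
      show "cmod (form A B f g) \<le> D0 * E * jb k0 powr (2 * m) * (sqsum B g + sqsum A f)"
      proof (rule order_trans[OF bb(1)])
        have "D0 * X powr (2 * m) * (1 + R * \<nu>) ^ CARD('n) \<le> D0 * X powr (2 * m) * E"
          using E_le D0 by (intro mult_left_mono) auto
        then show "D0 * X powr (2 * m) * (1 + R * \<nu>) ^ CARD('n) * (sqsum B g + sqsum A f)
            \<le> D0 * E * jb k0 powr (2 * m) * (sqsum B g + sqsum A f)"
          by (intro mult_right_mono N0) (simp add: X_def mult_ac)
      qed
      show "cmod (form A B f g - sform h (\<lambda>_. \<sigma> p) A B f g)
        \<le> D0 * (real CARD('n) * (2 * K) * E) * jb k0 powr (2 * m - (\<rho> - \<tau>)) * (sqsum B g + sqsum A f)"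
      proof (rule order_trans[OF bb(2)])
        have "D0 * X powr (2 * m) * ((1 + R * \<nu>) ^ CARD('n) - 1)
            \<le> D0 * X powr (2 * m) * (real CARD('n) * (2 * K) * E * X powr (\<tau> - \<rho>))"
          using E_le' D0 by (intro mult_left_mono) auto
        also have "\<dots> = D0 * (real CARD('n) * (2 * K) * E) * (X powr (2 * m) * X powr (\<tau> - \<rho>))"
          by (simp add: mult_ac)
        also have "X powr (2 * m) * X powr (\<tau> - \<rho>) = jb k0 powr (2 * m - (\<rho> - \<tau>))"
          by (simp add: X_def powr_add[symmetric] algebra_simps)
        finally show "D0 * X powr (2 * m) * ((1 + R * \<nu>) ^ CARD('n) - 1) * (sqsum B g + sqsum A f)
            \<le> D0 * (real CARD('n) * (2 * K) * E) * jb k0 powr (2 * m - (\<rho> - \<tau>)) * (sqsum B g + sqsum A f)"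
          by (intro mult_right_mono N0)
      qed
    qed
  qed
  have up: "a * y * z \<le> D * y * z" if "a \<le> D" "0 \<le> y" "0 \<le> z" for a y z
    using that by (intro mult_right_mono)
  show thesis
  proof (rule that[OF D(1)])
    fix A B f g k0 assume *: "cluster r A" "k0 \<in> A" "finite B" "B \<subseteq> L"
    show "cmod (form A B f g) \<le> D * jb k0 powr (2 * m) * (sqsum B g + sqsum A f)"
      using main[OF *] by (meson D(2) up order_trans powr_ge_zero add_nonneg_nonneg sqsum_nonneg)
  next
    fix A B k0 assume *: "cluster r A" "k0 \<in> A" "finite B" "B \<subseteq> L"
    obtain p where p: "p \<in> L" "jb k0 \<le> K' * jb p" "\<And>f g. cmod (form A B f g - sform h (\<lambda>_. \<sigma> p) A B f g)
        \<le> D0 * (real CARD('n) * (2 * K) * E) * jb k0 powr (2 * m - (\<rho> - \<tau>)) * (sqsum B g + sqsum A f)"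
      using main[OF *] by blast
    have "K' * jb p \<le> D * jb p" using D(4) by (intro mult_right_mono) auto
    then show "\<exists>p\<in>L. jb k0 \<le> D * jb p \<and> (\<forall>f g. cmod (form A B f g - sform h (\<lambda>_. \<sigma> p) A B f g)
        \<le> D * jb k0 powr (2 * m - (\<rho> - \<tau>)) * (sqsum B g + sqsum A f))"
      using p up[OF D(3)] by (meson order_trans powr_ge_zero add_nonneg_nonneg sqsum_nonneg)
  qed
qed

text \<open>All N toroidal derivatives are taken in the direction of a dominant component of
  \<open>d\<close>. Once |d_j| \<ge> 2 N h, each factor of the shifted factorial is at least
  |d_j|/2; below this threshold |d| is bounded and the estimate without derivatives
  suffices.\<close>

lemma fcoef_decay:
  obtains C where "0 \<le> C" "\<And>k d. k \<in> L \<Longrightarrow> d \<in> L \<Longrightarrow>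
    cmod (fcoef h (\<sigma> k) d) * norm d ^ N \<le> C * jb k powr (2 * m + \<delta> * real N)"
proof -
  have "\<exists>C. \<forall>k\<in>L. \<forall>\<theta>. cmod (tor_op h j M (\<sigma> k) \<theta>) \<le> C * jb k powr (2 * m + \<delta> * real M)" for j M
    using symbol_bound[of "\<lambda>i. if i = j then M else 0" "\<lambda>_. 0"]
    by (simp add: Diff_op_zero Tor_op_single mi_size_def)
  then obtain c where c: "\<And>j M k \<theta>. k \<in> L \<Longrightarrow>
      cmod (tor_op h j M (\<sigma> k) \<theta>) \<le> c j M * jb k powr (2 * m + \<delta> * real M)"
    by metis
  have fc: "cmod (fcoef h (\<sigma> k) d) * (\<Prod>t<M. \<bar>- (d $ j) - h * real t\<bar>) \<le> c j M * jb k powr (2 * m + \<delta> * real M)"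
    if k: "k \<in> L" and d: "d \<in> L" for k d j M
  proof -
    have "cmod (fcoef h (tor_op h j M (\<sigma> k)) d) \<le> c j M * jb k powr (2 * m + \<delta> * real M)"
      by (rule cmod_fcoef_le[OF smooth_fun_continuous[OF smooth_fun_tor_op[OF smooth[OF k]]] c[OF k]])
    moreover have "cmod (of_real (\<Prod>t<M. (- (d $ j) - h * real t))) = (\<Prod>t<M. \<bar>- (d $ j) - h * real t\<bar>)"
      by (simp only: norm_of_real abs_prod)
    ultimately show ?thesis
      unfolding fcoef_tor_op[OF smooth[OF k] periodic[OF k] d h0] of_real_prod[symmetric] norm_mult
      by (simp add: mult.commute)
  qed
  define c1 where "c1 = (\<Sum>j\<in>UNIV. \<bar>c j N\<bar> + \<bar>c j 0\<bar>)"
  have c1: "c j N \<le> c1" "c j 0 \<le> c1" "0 \<le> c1" for j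
  proof -
    have "\<bar>c j N\<bar> + \<bar>c j 0\<bar> \<le> c1" unfolding c1_def by (intro member_le_sum) auto
    then show "c j N \<le> c1" "c j 0 \<le> c1" "0 \<le> c1" by linarith+
  qed
  \<comment> \<open>One summand for each case: large and bounded \<open>d\<close>.\<close>
  let ?G = "(2 * real CARD('n)) ^ N + (2 * real CARD('n) * real N * h) ^ N"
  show thesis
  proof (rule that[of "c1 * ?G"])
    show "0 \<le> c1 * ?G" using c1 h by simp
    fix k d assume k: "k \<in> L" and d: "d \<in> L"
    let ?f = "cmod (fcoef h (\<sigma> k) d)" and ?X = "jb k powr (2 * m + \<delta> * real N)"
    have "\<exists>j. norm d \<le> real CARD('n) * \<bar>d $ j\<bar>"
    proof (rule ccontr)
      assume "\<not> ?thesis"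
      then have "(\<Sum>j\<in>(UNIV::'n set). real CARD('n) * \<bar>d $ j\<bar>) < (\<Sum>j\<in>(UNIV::'n set). norm d)"
        by (intro sum_strict_mono) (auto simp: not_le)
      then have "real CARD('n) * (\<Sum>j\<in>UNIV. \<bar>d $ j\<bar>) < real CARD('n) * norm d"
        by (simp add: sum_distrib_left)
      then show False using norm_le_l1_cart[of d] by simp
    qed
    then obtain j where j: "norm d \<le> real CARD('n) * \<bar>d $ j\<bar>" by blast
    show "?f * norm d ^ N \<le> c1 * ?G * ?X"
    proof (cases "2 * real N * h \<le> \<bar>d $ j\<bar>")
      case True
      have "(\<bar>d $ j\<bar> / 2) ^ N \<le> (\<Prod>t<N. \<bar>- (d $ j) - h * real t\<bar>)"
      proof -
        have "\<bar>d $ j\<bar> / 2 \<le> \<bar>- (d $ j) - h * real t\<bar>" if "t < N" for t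
        proof -
          have "h * real t \<le> h * real N" "0 \<le> h * real t" using that h by auto
          moreover have "2 * (h * real N) \<le> \<bar>d $ j\<bar>" using True by (simp add: mult_ac)
          ultimately show ?thesis by linarith
        qed
        then have "(\<Prod>t<N. \<bar>d $ j\<bar> / 2) \<le> (\<Prod>t<N. \<bar>- (d $ j) - h * real t\<bar>)"
          by (intro prod_mono) auto
        then show ?thesis by simp
      qed
      then have "?f * (\<bar>d $ j\<bar> / 2) ^ N \<le> ?f * (\<Prod>t<N. \<bar>- (d $ j) - h * real t\<bar>)"
        by (intro mult_left_mono) auto
      also have "\<dots> \<le> c j N * ?X" by (rule fc[OF k d])
      also have "\<dots> \<le> c1 * ?X" using c1 by (intro mult_right_mono) auto
      finally have *: "?f * (\<bar>d $ j\<bar> / 2) ^ N \<le> c1 * ?X" .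
      have "norm d ^ N \<le> ((2 * real CARD('n)) * (\<bar>d $ j\<bar> / 2)) ^ N"
        using j by (intro power_mono) auto
      then have "norm d ^ N \<le> (2 * real CARD('n)) ^ N * (\<bar>d $ j\<bar> / 2) ^ N"
        by (simp only: power_mult_distrib)
      then have "?f * norm d ^ N \<le> ?f * ((2 * real CARD('n)) ^ N * (\<bar>d $ j\<bar> / 2) ^ N)"
        by (rule mult_left_mono) simp
      also have "\<dots> = (2 * real CARD('n)) ^ N * (?f * (\<bar>d $ j\<bar> / 2) ^ N)"
        by (simp only: mult_ac)
      also have "\<dots> \<le> ?G * (c1 * ?X)"
        by (intro mult_mono *) (use h in auto)
      finally show ?thesis by (simp only: mult_ac)
    next
      case False
      have "?f \<le> c j 0 * jb k powr (2 * m)" using fc[OF k d, where M = 0 and j = j] by simp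
      also have "\<dots> \<le> c1 * ?X"
        using c1 \<delta> by (intro mult_mono powr_mono) auto
      finally have f: "?f \<le> c1 * ?X" .
      have "norm d \<le> real CARD('n) * (2 * real N * h)"
        using False by (intro order_trans[OF j] mult_left_mono) auto
      then have "norm d ^ N \<le> (2 * real CARD('n) * real N * h) ^ N"
        by (intro power_mono) (auto simp: mult_ac)
      also have "\<dots> \<le> ?G" by simp
      finally have "?f * norm d ^ N \<le> (c1 * ?X) * ?G"
        using f c1 by (intro mult_mono) auto
      then show ?thesis by (simp only: mult_ac)
    qed
  qed
qed

text \<open>With r = |k - l|, distance from the diagonal means 1 + |k| \<le> (r/\<eta>)^(1/\<tau>).
  Thus N derivatives give r to the power (2m + \<delta> N)/\<tau> - N, which is as negative as
  desired because \<open>\<delta> < \<tau>\<close>; it must also beat the power r^(2n) that is lost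
  to \<open>lweight\<close>, n being the dimension.\<close>

lemma far_kernel_bound:
  assumes \<eta>: "0 < \<eta>"
  obtains C where "0 \<le> C" "\<And>k l. k \<in> L \<Longrightarrow> l \<in> L \<Longrightarrow> \<eta> * jb k powr \<tau> \<le> norm (k - l) \<Longrightarrow>
    cmod (fcoef h (\<sigma> k) (k - l)) \<le> C * lweight h (k - l)"
proof -
  \<comment> \<open>Net gain in the exponent of r per derivative: it yields 1 and costs
    \<delta>/\<tau>.\<close>
  define b where "b = 1 - \<delta> / \<tau>"
  have b: "0 < b" using \<delta> \<tau> by (simp add: b_def)
  obtain N :: nat where N: "(2 * m / \<tau> + 2 * real CARD('n)) / b \<le> real N"
    using real_arch_simple by blast
  define e where "e = (2 * m + \<delta> * real N) / \<tau> - real N + 2 * real CARD('n)"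
  have e: "e \<le> 0"
  proof -
    have "2 * m / \<tau> + 2 * real CARD('n) \<le> real N * b"
      using N b by (simp add: pos_divide_le_eq)
    moreover have "e = 2 * m / \<tau> + 2 * real CARD('n) - real N * b"
      by (simp add: e_def b_def add_divide_distrib algebra_simps)
    ultimately show ?thesis by simp
  qed
  obtain C where C: "0 \<le> C" "\<And>k d. k \<in> L \<Longrightarrow> d \<in> L \<Longrightarrow>
    cmod (fcoef h (\<sigma> k) d) * norm d ^ N \<le> C * jb k powr (2 * m + \<delta> * real N)"
    using fcoef_decay by blast
  \<comment> \<open>Gives 1 + (d_i/h)^2 \<le> G r^2, where the summand 1 is paid for by r \<ge>
    \<eta>.\<close>
  define G where "G = 1 / \<eta>\<^sup>2 + 1 / h\<^sup>2"
  have G: "0 \<le> G" by (simp add: G_def)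
  define s where "s = (2 * m + \<delta> * real N) / \<tau>"
  have s0: "0 \<le> s" using m \<delta> \<tau> by (simp add: s_def)
  let ?C = "C * (1 / \<eta>) powr s * \<eta> powr e * G ^ CARD('n)"
  show thesis
  proof (rule that[of ?C])
    show "0 \<le> ?C" using C G by simp
    fix k l assume k: "k \<in> L" and l: "l \<in> L" and far: "\<eta> * jb k powr \<tau> \<le> norm (k - l)"
    let ?d = "k - l" and ?f = "cmod (fcoef h (\<sigma> k) (k - l))"
    define r where "r = norm ?d"
    have "\<eta> * 1 \<le> \<eta> * jb k powr \<tau>"
      using \<eta> \<tau> by (intro mult_left_mono ge_one_powr_ge_zero) auto
    then have r1: "\<eta> \<le> r" unfolding r_def using far by linarith
    then have r: "\<eta> \<le> r" "0 < r" using \<eta> by auto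
    have lw: "1 \<le> lweight h ?d * (G ^ CARD('n) * r powr (2 * real CARD('n)))"
    proof -
      have "1 + (?d $ i / h)\<^sup>2 \<le> G * r\<^sup>2" for i
      proof -
        have "(?d $ i)\<^sup>2 \<le> r\<^sup>2"
          using component_le_norm_cart[of ?d i] by (simp add: r_def abs_le_square_iff[symmetric] del: vector_minus_component)
        moreover have "1 \<le> r\<^sup>2 / \<eta>\<^sup>2" using r \<eta> by (simp add: power_mono)
        ultimately show ?thesis
          using h by (simp add: G_def power_divide distrib_right divide_right_mono add_mono del: vector_minus_component)
      qed
      then have "(\<Prod>i\<in>(UNIV::'n set). 1 + (?d $ i / h)\<^sup>2) \<le> (\<Prod>i\<in>(UNIV::'n set). G * r\<^sup>2)"
        by (intro prod_mono) auto
      also have "\<dots> = G ^ CARD('n) * r powr (2 * real CARD('n))"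
        using r powr_realpow[of r "2 * CARD('n)"] by (simp add: power_mult_distrib power_mult)
      finally have *: "(\<Prod>i\<in>(UNIV::'n set). 1 + (?d $ i / h)\<^sup>2) \<le> G ^ CARD('n) * r powr (2 * real CARD('n))" .
      have "lweight h ?d * (\<Prod>i\<in>(UNIV::'n set). 1 + (?d $ i / h)\<^sup>2) = 1"
        unfolding lweight_def prod.distrib[symmetric]
        by (rule prod.neutral) (auto simp: add_pos_nonneg add_nonneg_eq_0_iff simp del: vector_minus_component)
      moreover have "0 \<le> lweight h ?d" unfolding lweight_def by (intro prod_nonneg) auto
      ultimately show ?thesis using mult_left_mono[OF *, of "lweight h ?d"] by simp
    qed
    have "jb k powr \<tau> \<le> r / \<eta>" using far \<eta> by (simp add: r_def field_simps)
    then have "(jb k powr \<tau>) powr s \<le> (r / \<eta>) powr s"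
      using s0 by (intro powr_mono2) auto
    then have X: "jb k powr (2 * m + \<delta> * real N) \<le> r powr s * (1 / \<eta>) powr s"
      using \<tau> \<eta> r by (simp add: powr_powr s_def powr_divide)
    have "?f * r ^ N \<le> C * jb k powr (2 * m + \<delta> * real N)"
      unfolding r_def by (rule C(2)[OF k hlattice_diff[OF k l]])
    also have "\<dots> \<le> C * (r powr s * (1 / \<eta>) powr s)"
      using X C by (intro mult_left_mono)
    finally have "?f * r ^ N * r powr (- real N) \<le> C * (r powr s * (1 / \<eta>) powr s) * r powr (- real N)"
      by (intro mult_right_mono) auto
    moreover have "r ^ N * r powr (- real N) = 1"
      using r by (simp add: powr_realpow[symmetric] powr_add[symmetric])
    then have "?f * r ^ N * r powr (- real N) = ?f" by (simp only: mult.assoc mult_1_right)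
    ultimately have f: "?f \<le> C * (1 / \<eta>) powr s * (r powr s * r powr (- real N))"
      by (simp only: mult_ac)
    have "?f * 1 \<le> ?f * (lweight h ?d * (G ^ CARD('n) * r powr (2 * real CARD('n))))"
      using lw by (intro mult_left_mono) auto
    also have "\<dots> = ?f * (r powr (2 * real CARD('n)) * (G ^ CARD('n) * lweight h ?d))" by (simp add: mult_ac)
    also have "\<dots> \<le> (C * (1 / \<eta>) powr s * (r powr s * r powr (- real N))) * (r powr (2 * real CARD('n)) * (G ^ CARD('n) * lweight h ?d))"
      using G by (intro mult_right_mono f mult_nonneg_nonneg) (auto simp: lweight_def intro!: prod_nonneg)
    also have "\<dots> = C * (1 / \<eta>) powr s * (r powr s * r powr (- real N) * r powr (2 * real CARD('n))) * (G ^ CARD('n) * lweight h ?d)"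
      by (simp add: mult_ac)
    also have "r powr s * r powr (- real N) * r powr (2 * real CARD('n)) = r powr e"
      by (simp add: powr_add[symmetric] e_def s_def)
    also have "C * (1 / \<eta>) powr s * r powr e * (G ^ CARD('n) * lweight h ?d)
        \<le> C * (1 / \<eta>) powr s * \<eta> powr e * (G ^ CARD('n) * lweight h ?d)"
      using r e \<eta> G C
      by (intro mult_right_mono mult_left_mono powr_mono2') (auto simp: lweight_def intro!: prod_nonneg mult_nonneg_nonneg)
    finally show "?f \<le> ?C * lweight h ?d" by (simp add: mult_ac)
  qed
qed

subsection \<open>The lower bound for finitely supported sequences\<close>

definition wsum :: "(real ^ 'n) set \<Rightarrow> (real ^ 'n \<Rightarrow> complex) \<Rightarrow> real" where
  "wsum A f = (\<Sum>k\<in>A. jb k powr (2 * m) * (cmod (f k))\<^sup>2)"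

definition pform :: "(real ^ 'n \<Rightarrow> real ^ 'n \<Rightarrow> bool) \<Rightarrow> (real ^ 'n) set \<Rightarrow> (real ^ 'n) set \<Rightarrow>
    (real ^ 'n \<Rightarrow> complex) \<Rightarrow> (real ^ 'n \<Rightarrow> complex) \<Rightarrow> complex" where
  "pform P A B f g = (\<Sum>k\<in>A. \<Sum>l\<in>B. (if P k l then fcoef h (\<sigma> k) (k - l) else 0) * g l * cnj (f k))"

lemma wsum_nonneg: "0 \<le> wsum A f"
  unfolding wsum_def by (intro sum_nonneg) auto

lemma wsum_mono: "A \<subseteq> B \<Longrightarrow> finite B \<Longrightarrow> wsum A f \<le> wsum B f"
  unfolding wsum_def by (intro sum_mono2) auto

lemma sqsum_le_wsum: "sqsum A f \<le> wsum A f"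
  unfolding sqsum_def wsum_def
proof (rule sum_mono)
  fix k :: "real ^ 'n"
  have "1 \<le> jb k powr (2 * m)" using m by (intro ge_one_powr_ge_zero) auto
  from mult_right_mono[OF this, of "(cmod (f k))\<^sup>2"]
  show "(cmod (f k))\<^sup>2 \<le> jb k powr (2 * m) * (cmod (f k))\<^sup>2" by simp
qed

text \<open>The weight varies by a bounded factor within a cluster, so it may be evaluated at any of
  its points. This converts unweighted bounds on a cell into weighted ones.\<close>

lemma cluster_weight:
  assumes r: "0 \<le> r"
  obtains K where "1 \<le> K"
    "\<And>A B k0 f. cluster r A \<Longrightarrow> k0 \<in> A \<Longrightarrow> B \<subseteq> A \<Longrightarrow> jb k0 powr (2 * m) * sqsum B f \<le> K * wsum B f"
    "\<And>A B k0 f. cluster r A \<Longrightarrow> k0 \<in> A \<Longrightarrow> B \<subseteq> A \<Longrightarrow> wsum B f \<le> K * (jb k0 powr (2 * m) * sqsum B f)"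
proof -
  obtain K where K: "1 \<le> K" "\<And>k l :: real ^ 'n. norm (Phi \<tau> k - Phi \<tau> l) \<le> r \<Longrightarrow>
       jb l \<le> K * jb k \<and> norm (k - l) \<le> K * jb k powr \<tau>"
    using Phi_close_comparable[OF \<tau> r] by blast
  have cmp: "jb k powr (2 * m) \<le> K powr (2 * m) * jb l powr (2 * m)"
    if "cluster r A" "k \<in> A" "l \<in> A" for A k l
  proof -
    have "jb k \<le> K * jb l" using that K(2)[of l k] by (auto simp: cluster_def)
    moreover have "jb l \<le> K * jb k" using that K(2)[of k l] by (auto simp: cluster_def)
    ultimately have "jb k powr (2 * m) \<le> K powr \<bar>2 * m\<bar> * jb l powr (2 * m)"
      using K(1) by (intro powr_comparable) auto
    then show ?thesis using m by simp
  qed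
  show thesis
  proof (rule that[of "K powr (2 * m)"])
    show "1 \<le> K powr (2 * m)" using K m by (intro ge_one_powr_ge_zero) auto
    fix A B k0 f assume A: "cluster r A" "k0 \<in> A" and B: "B \<subseteq> A"
    show "jb k0 powr (2 * m) * sqsum B f \<le> K powr (2 * m) * wsum B f"
      unfolding sqsum_def wsum_def sum_distrib_left mult.assoc[symmetric]
      using A B by (intro sum_mono mult_right_mono cmp[of A]) auto
    show "wsum B f \<le> K powr (2 * m) * (jb k0 powr (2 * m) * sqsum B f)"
      unfolding sqsum_def wsum_def sum_distrib_left mult.assoc[symmetric]
      using A B by (intro sum_mono mult_right_mono cmp[of A]) auto
  qed
qed

text \<open>Here the columns must belong to the cluster too, since the weight at a row has to be
  carried over to them.\<close>

lemma cluster_form_bound: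
  assumes r: "0 \<le> r"
  obtains D where "0 \<le> D"
    "\<And>A B f g. cluster r (A \<union> B) \<Longrightarrow> cmod (form A B f g) \<le> D * (wsum B g + wsum A f)"
proof -
  obtain D where D: "1 \<le> D"
    "\<And>A B f g k0. cluster r A \<Longrightarrow> k0 \<in> A \<Longrightarrow> finite B \<Longrightarrow> B \<subseteq> L \<Longrightarrow>
      cmod (form A B f g) \<le> D * jb k0 powr (2 * m) * (sqsum B g + sqsum A f)"
    using block_bounds[OF r] by metis
  obtain K where K: "1 \<le> K"
    "\<And>A B k0 f. cluster r A \<Longrightarrow> k0 \<in> A \<Longrightarrow> B \<subseteq> A \<Longrightarrow> jb k0 powr (2 * m) * sqsum B f \<le> K * wsum B f"
    using cluster_weight[OF r] by metis
  have DK: "0 \<le> D * K" using D K by simp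
  have "cmod (form A B f g) \<le> D * K * (wsum B g + wsum A f)" if AB: "cluster r (A \<union> B)" for A B f g
  proof (cases "A = {}")
    case True
    then show ?thesis using DK by (simp add: sform_def wsum_nonneg)
  next
    case False
    then obtain k0 where k0: "k0 \<in> A" by blast
    have "cluster r A" "finite B" "B \<subseteq> L" using AB by (auto simp: cluster_def)
    then have "cmod (form A B f g) \<le> D * jb k0 powr (2 * m) * (sqsum B g + sqsum A f)"
      by (intro D(2) k0)
    also have "\<dots> = D * (jb k0 powr (2 * m) * sqsum B g + jb k0 powr (2 * m) * sqsum A f)"
      by (simp add: algebra_simps)
    also have "\<dots> \<le> D * (K * wsum B g + K * wsum A f)"
      using K(2)[OF AB] k0 D(1) by (intro mult_left_mono add_mono) auto
    finally show ?thesis by (simp add: algebra_simps)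
  qed
  with DK show thesis using that by blast
qed

lemma cluster_form_lower:
  assumes r: "0 \<le> r" and ell: "elliptic_symbol h (2 * m) \<sigma>"
    and pos: "finite {k \<in> L. \<not> (\<forall>\<theta>. \<sigma> k \<theta> \<in> \<real>\<^sub>\<ge>\<^sub>0)}"
  obtains c C where "0 < c" "0 \<le> C"
    "\<And>A f. cluster r A \<Longrightarrow> Re (form A A f f) \<ge> c * wsum A f - C * sqsum A f"
proof -
  obtain C0 M where C0: "0 < C0" "0 < M"
    "\<And>k \<theta>. k \<in> L \<Longrightarrow> M \<le> norm k \<Longrightarrow> cmod (\<sigma> k \<theta>) \<ge> C0 * jb k powr (2 * m)"
    using ell unfolding elliptic_symbol_def by blast
  obtain M1 where M1: "\<And>k. k \<in> L \<Longrightarrow> \<not> (\<forall>\<theta>. \<sigma> k \<theta> \<in> \<real>\<^sub>\<ge>\<^sub>0) \<Longrightarrow> norm k \<le> M1"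
    using finite_imp_bounded[OF pos] unfolding bounded_iff by blast
  define M2 where "M2 = max M (\<bar>M1\<bar> + 1)"
  have M2: "0 < M2" using C0 by (simp add: M2_def)
  \<comment> \<open>A nonnegative real value equals its modulus, so the two-sided notion of
    ellipticity becomes a lower bound beyond the finitely many exceptional points.\<close>
  have good: "C0 * jb k powr (2 * m) \<le> Re (\<sigma> k \<theta>)" if k: "k \<in> L" "M2 \<le> norm k" for k \<theta>
  proof -
    have "\<sigma> k \<theta> \<in> \<real>\<^sub>\<ge>\<^sub>0" using M1[OF k(1)] k(2) by (force simp: M2_def)
    then have "cmod (\<sigma> k \<theta>) = Re (\<sigma> k \<theta>)"
      by (auto simp: complex_nonneg_Reals_iff cmod_eq_Re)
    then show ?thesis using C0(3)[OF k(1), of \<theta>] k(2) by (simp add: M2_def)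
  qed
  obtain D where D: "1 \<le> D"
    "\<And>A B f g k0. cluster r A \<Longrightarrow> k0 \<in> A \<Longrightarrow> finite B \<Longrightarrow> B \<subseteq> L \<Longrightarrow>
      cmod (form A B f g) \<le> D * jb k0 powr (2 * m) * (sqsum B g + sqsum A f)"
    "\<And>A B k0. cluster r A \<Longrightarrow> k0 \<in> A \<Longrightarrow> finite B \<Longrightarrow> B \<subseteq> L \<Longrightarrow>
      \<exists>p\<in>L. jb k0 \<le> D * jb p \<and> (\<forall>f g. cmod (form A B f g - sform h (\<lambda>_. \<sigma> p) A B f g)
        \<le> D * jb k0 powr (2 * m - (\<rho> - \<tau>)) * (sqsum B g + sqsum A f))"
    using block_bounds[OF r] by metis
  obtain K where K: "1 \<le> K"
    "\<And>A B k0 f. cluster r A \<Longrightarrow> k0 \<in> A \<Longrightarrow> B \<subseteq> A \<Longrightarrow> wsum B f \<le> K * (jb k0 powr (2 * m) * sqsum B f)"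
    using cluster_weight[OF r] by metis
  define c1 where "c1 = C0 / D powr (2 * m)"
  have c1: "0 < c1" using C0 D by (simp add: c1_def)
  define \<epsilon> where "\<epsilon> = \<rho> - \<tau>"
  have \<epsilon>: "0 < \<epsilon>" using \<rho> by (simp add: \<epsilon>_def)
  \<comment> \<open>Beyond the first entry the freezing point satisfies |p| \<ge> \<open>M2\<close>;
    beyond the second the freezing error is at most half of the main term.\<close>
  define T where "T = max (D * (1 + M2)) ((4 * D / c1) powr (1 / \<epsilon>))"
  \<comment> \<open>For weights up to that at \<open>T\<close>: pays for the desired c1/2 and for
    the crude bound 2 D of the form.\<close>
  define C where "C = (c1 / 2 + 2 * D) * T powr (2 * m)"
  have C: "0 \<le> C" using c1 D by (simp add: C_def)
  have main: "Re (form A A f f) \<ge> (c1 / 2 * jb k0 powr (2 * m) - C) * sqsum A f"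
    if A: "cluster r A" and k0: "k0 \<in> A" for A f k0
  proof -
    define X where "X = jb k0"
    have X: "1 \<le> X" "0 < X" by (auto simp: X_def)
    have fin: "finite A" "A \<subseteq> L" using A by (auto simp: cluster_def)
    have S: "0 \<le> sqsum A f" by (rule sqsum_nonneg)
    show ?thesis
    proof (cases "X \<le> T")
      case True
      have "X powr (2 * m) \<le> T powr (2 * m)" using True X m by (intro powr_mono2) auto
      then have "(c1 / 2 + 2 * D) * X powr (2 * m) \<le> C"
        unfolding C_def using c1 D by (intro mult_left_mono) auto
      then have "(c1 / 2 * X powr (2 * m) - C) * sqsum A f \<le> (- (2 * D * X powr (2 * m))) * sqsum A f"
        by (intro mult_right_mono S) (simp add: algebra_simps)
      also have "\<dots> = - (D * X powr (2 * m) * (sqsum A f + sqsum A f))" by simp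
      also have "\<dots> \<le> - cmod (form A A f f)"
        using D(2)[OF A k0 fin, of f f] by (simp add: X_def)
      also have "\<dots> \<le> Re (form A A f f)"
        using abs_Re_le_cmod[of "form A A f f"] by linarith
      finally show ?thesis by (simp add: X_def)
    next
      case False
      obtain p where p: "p \<in> L" "X \<le> D * jb p" "cmod (form A A f f - sform h (\<lambda>_. \<sigma> p) A A f f)
        \<le> D * X powr (2 * m - \<epsilon>) * (sqsum A f + sqsum A f)"
        using D(3)[OF A k0 fin] unfolding X_def \<epsilon>_def by blast
      have "D * (1 + M2) \<le> D * jb p" using False p(2) by (simp add: T_def)
      then have pM: "M2 \<le> norm p" using D(1) by simp
      have "(X / D) powr (2 * m) \<le> jb p powr (2 * m)"
        using p(2) D(1) X m by (intro powr_mono2) (auto simp: field_simps)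
      then have "C0 * (X / D) powr (2 * m) \<le> C0 * jb p powr (2 * m)"
        using C0 by (intro mult_left_mono) auto
      moreover have "C0 * (X / D) powr (2 * m) = c1 * X powr (2 * m)"
        using X D by (simp add: c1_def powr_divide)
      ultimately have low: "c1 * X powr (2 * m) \<le> Re (\<sigma> p \<theta>)" for \<theta>
        using good[OF p(1) pM, of \<theta>] by linarith
      have frozen: "c1 * X powr (2 * m) * sqsum A f \<le> Re (sform h (\<lambda>_. \<sigma> p) A A f f)"
        by (rule Re_sform_const_ge[OF cont[OF p(1)] low fin h0])
      have "4 * D / c1 = ((4 * D / c1) powr (1 / \<epsilon>)) powr \<epsilon>"
        using \<epsilon> c1 D by (simp add: powr_powr)
      also have "\<dots> \<le> X powr \<epsilon>"
        using False \<epsilon> by (intro powr_mono2) (auto simp: T_def)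
      finally have "4 * D \<le> c1 * X powr \<epsilon>" using c1 by (simp add: field_simps)
      then have "4 * D * X powr (2 * m - \<epsilon>) \<le> c1 * X powr \<epsilon> * X powr (2 * m - \<epsilon>)"
        by (intro mult_right_mono) auto
      also have "\<dots> = c1 * X powr (2 * m)" by (simp add: mult.assoc powr_add[symmetric])
      finally have "2 * D * X powr (2 * m - \<epsilon>) * sqsum A f \<le> c1 / 2 * X powr (2 * m) * sqsum A f"
        by (intro mult_right_mono S) simp
      moreover have "Re (sform h (\<lambda>_. \<sigma> p) A A f f) - Re (form A A f f)
          \<le> D * X powr (2 * m - \<epsilon>) * (sqsum A f + sqsum A f)"
        using p(3) abs_Re_le_cmod[of "form A A f f - sform h (\<lambda>_. \<sigma> p) A A f f"] by simp
      moreover have "0 \<le> C * sqsum A f" using C S by simp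
      ultimately have "(c1 / 2 * X powr (2 * m) - C) * sqsum A f \<le> Re (form A A f f)"
        using frozen by (simp add: algebra_simps)
      then show ?thesis by (simp add: X_def)
    qed
  qed
  have "Re (form A A f f) \<ge> c1 / (2 * K) * wsum A f - C * sqsum A f" if A: "cluster r A" for A f
  proof (cases "A = {}")
    case True
    then show ?thesis by (simp add: sform_def wsum_def sqsum_def)
  next
    case False
    then obtain k0 where k0: "k0 \<in> A" by blast
    have "c1 / (2 * K) * wsum A f \<le> c1 / (2 * K) * (K * (jb k0 powr (2 * m) * sqsum A f))"
      using c1 K(1) by (intro mult_left_mono K(2)[OF A k0]) auto
    also have "\<dots> = c1 / 2 * jb k0 powr (2 * m) * sqsum A f" using K(1) by simp
    finally show ?thesis using main[OF A k0, of f] by (simp add: algebra_simps)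
  qed
  moreover have "0 < c1 / (2 * K)" using c1 K by simp
  ultimately show thesis using that C by blast
qed

section \<open>Near-diagonal and far parts of the form\<close>

lemma card_adjacent_le: "card {c\<in>C. adjacent c (d :: 'n \<Rightarrow> int)} \<le> 3 ^ CARD('n)"
proof -
  let ?P = "PiE UNIV (\<lambda>i. {d i - 1..d i + 1})"
  have "card {c\<in>C. adjacent c d} \<le> card ?P"
  proof (rule card_mono)
    show "finite ?P" by (intro finite_PiE) auto
    show "{c\<in>C. adjacent c d} \<subseteq> ?P"
    proof
      fix c assume "c \<in> {c\<in>C. adjacent c d}"
      then have *: "\<bar>c i - d i\<bar> \<le> 1" for i by (auto simp: adjacent_def)
      have "d i - 1 \<le> c i \<and> c i \<le> d i + 1" for i using *[of i] by linarith
      then show "c \<in> ?P" by auto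
    qed
  qed
  also have "card ?P = 3 ^ CARD('n)" by (simp add: card_PiE)
  finally show ?thesis .
qed

lemma sum_cells:
  fixes F :: "real ^ 'n \<Rightarrow> 'c::comm_monoid_add"
  assumes "finite A"
  shows "(\<Sum>k\<in>A. F k) = (\<Sum>c\<in>cell \<tau> s ` A. \<Sum>k\<in>{k\<in>A. cell \<tau> s k = c}. F k)"
  by (rule sum.image_gen[OF assms])

text \<open>Rows are grouped by cells. The columns coupled to a cell lie in it or its neighbours, so
  the cluster bound applies once per row cell, and each column is counted at most 3^n times in
  dimension n. \<open>R\<close> sees only the cells, hence merely drops whole blocks. The constant
  is uniform in the shift \<open>s\<close>.\<close>

lemma adjacent_pform_bound:
  obtains D where "0 \<le> D" "\<And>s R A B f g. finite A \<Longrightarrow> A \<subseteq> L \<Longrightarrow> finite B \<Longrightarrow> B \<subseteq> L \<Longrightarrow>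
     cmod (pform (\<lambda>k l. adjacent (cell \<tau> s k) (cell \<tau> s l) \<and> R (cell \<tau> s k) (cell \<tau> s l)) A B f g)
       \<le> D * (wsum B g + wsum A f)"
proof -
  \<comment> \<open>After \<open>Phi\<close>, a cell and its neighbours lie within twice the
    dimension of any one point of the cell; the diameter is at most twice that.\<close>
  have "0 \<le> 4 * real CARD('n)" by simp
  then obtain D where D: "0 \<le> D" "\<And>A B f g. cluster (4 * real CARD('n)) (A \<union> B) \<Longrightarrow>
      cmod (form A B f g) \<le> D * (wsum B g + wsum A f)"
    using cluster_form_bound by blast
  have "cmod (pform (\<lambda>k l. adjacent (cell \<tau> s k) (cell \<tau> s l) \<and> R (cell \<tau> s k) (cell \<tau> s l)) A B f g)
       \<le> D * 3 ^ CARD('n) * (wsum B g + wsum A f)"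
    if A: "finite A" "A \<subseteq> L" and B: "finite B" "B \<subseteq> L" for s R A B f g
  proof -
    define cl where "cl = (cell \<tau> s :: real ^ 'n \<Rightarrow> _)"
    define Ac where "Ac c = {k\<in>A. cl k = c}" for c
    define Bc where "Bc c = {l\<in>B. adjacent c (cl l) \<and> R c (cl l)}" for c
    have "pform (\<lambda>k l. adjacent (cl k) (cl l) \<and> R (cl k) (cl l)) A B f g
       = (\<Sum>c\<in>cl ` A. \<Sum>k\<in>Ac c. \<Sum>l\<in>B. (if adjacent (cl k) (cl l) \<and> R (cl k) (cl l)
            then fcoef h (\<sigma> k) (k - l) else 0) * g l * cnj (f k))"
      unfolding pform_def Ac_def cl_def by (rule sum_cells[OF A(1)])
    also have "\<dots> = (\<Sum>c\<in>cl ` A. form (Ac c) (Bc c) f g)"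
    proof (intro sum.cong refl)
      fix c
      have "(\<Sum>l\<in>B. (if adjacent (cl k) (cl l) \<and> R (cl k) (cl l)
            then fcoef h (\<sigma> k) (k - l) else 0) * g l * cnj (f k))
          = (\<Sum>l\<in>Bc c. fcoef h (\<sigma> k) (k - l) * g l * cnj (f k))" if "k \<in> Ac c" for k
        using that B(1) unfolding Bc_def Ac_def by (intro sum.mono_neutral_cong_right) auto
      then show "(\<Sum>k\<in>Ac c. \<Sum>l\<in>B. (if adjacent (cl k) (cl l) \<and> R (cl k) (cl l)
            then fcoef h (\<sigma> k) (k - l) else 0) * g l * cnj (f k)) = form (Ac c) (Bc c) f g"
        unfolding sform_def by (rule sum.cong[OF refl])
    qed
    finally have eq: "pform (\<lambda>k l. adjacent (cl k) (cl l) \<and> R (cl k) (cl l)) A B f g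
        = (\<Sum>c\<in>cl ` A. form (Ac c) (Bc c) f g)" .
    have clus: "cluster (4 * real CARD('n)) (Ac c \<union> Bc c)" if c: "c \<in> cl ` A" for c
    proof -
      obtain k0 where k0: "k0 \<in> A" "c = cl k0" using c by blast
      have near: "norm (Phi \<tau> k0 - Phi \<tau> k) \<le> 2 * real CARD('n)" if "k \<in> Ac c \<union> Bc c" for k
      proof (rule adjacent_cells_Phi)
        show "adjacent (cell \<tau> s k0) (cell \<tau> s k)"
          using that k0(2) by (auto simp: Ac_def Bc_def cl_def adjacent_def)
      qed
      have "norm (Phi \<tau> k - Phi \<tau> l) \<le> 4 * real CARD('n)"
        if "k \<in> Ac c \<union> Bc c" "l \<in> Ac c \<union> Bc c" for k l
      proof -
        have "norm ((Phi \<tau> k0 - Phi \<tau> l) - (Phi \<tau> k0 - Phi \<tau> k))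
            \<le> 2 * real CARD('n) + 2 * real CARD('n)"
          by (rule norm_triangle_le_diff[OF add_mono[OF near[OF that(2)] near[OF that(1)]]])
        then show ?thesis by simp
      qed
      then show ?thesis
        unfolding cluster_def using A B by (auto simp: Ac_def Bc_def)
    qed
    have "cmod (\<Sum>c\<in>cl ` A. form (Ac c) (Bc c) f g) \<le> (\<Sum>c\<in>cl ` A. D * (wsum (Bc c) g + wsum (Ac c) f))"
      by (intro sum_norm_le D(2) clus)
    also have "\<dots> = D * ((\<Sum>c\<in>cl ` A. wsum (Bc c) g) + (\<Sum>c\<in>cl ` A. wsum (Ac c) f))"
      by (simp only: sum_distrib_left sum.distrib distrib_left)
    also have "(\<Sum>c\<in>cl ` A. wsum (Ac c) f) = wsum A f"
      unfolding wsum_def Ac_def cl_def by (rule sum_cells[OF A(1), symmetric])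
    also have "D * ((\<Sum>c\<in>cl ` A. wsum (Bc c) g) + wsum A f)
        \<le> D * (3 ^ CARD('n) * wsum B g + 3 ^ CARD('n) * wsum A f)"
    proof (intro mult_left_mono[OF _ D(1)] add_mono)
      let ?w = "\<lambda>l. jb l powr (2 * m) * (cmod (g l))\<^sup>2"
      have "(\<Sum>c\<in>cl ` A. wsum (Bc c) g) \<le> (\<Sum>c\<in>cl ` A. \<Sum>l\<in>B. if adjacent c (cl l) then ?w l else 0)"
      proof (rule sum_mono)
        fix c
        have "wsum (Bc c) g \<le> wsum {l\<in>B. adjacent c (cl l)} g"
          by (rule wsum_mono) (use B in \<open>auto simp: Bc_def\<close>)
        also have "\<dots> = (\<Sum>l\<in>B. if adjacent c (cl l) then ?w l else 0)"
          unfolding wsum_def using B(1) by (rule sum.inter_filter)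
        finally show "wsum (Bc c) g \<le> (\<Sum>l\<in>B. if adjacent c (cl l) then ?w l else 0)" .
      qed
      \<comment> \<open>Counted by columns: \<open>l\<close> occurs at most once for each row cell
        adjacent to its own.\<close>
      also have "\<dots> = (\<Sum>l\<in>B. real (card {c\<in>cl ` A. adjacent c (cl l)}) * ?w l)"
        using A(1) by (subst sum.swap) (simp add: sum.inter_filter[symmetric])
      also have "\<dots> \<le> (\<Sum>l\<in>B. 3 ^ CARD('n) * ?w l)"
      proof (intro sum_mono mult_right_mono)
        fix l
        have "card {c\<in>cl ` A. adjacent c (cl l)} \<le> 3 ^ CARD('n)"
          by (rule card_adjacent_le)
        then show "real (card {c\<in>cl ` A. adjacent c (cl l)}) \<le> 3 ^ CARD('n)"
          by (metis of_nat_le_iff of_nat_numeral of_nat_power)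
      qed auto
      also have "\<dots> = 3 ^ CARD('n) * wsum B g" by (simp add: wsum_def sum_distrib_left)
      finally show "(\<Sum>c\<in>cl ` A. wsum (Bc c) g) \<le> 3 ^ CARD('n) * wsum B g" .
      have "1 * wsum A f \<le> 3 ^ CARD('n) * wsum A f" by (intro mult_right_mono wsum_nonneg) simp
      then show "wsum A f \<le> 3 ^ CARD('n) * wsum A f" by simp
    qed
    finally show ?thesis unfolding eq[unfolded cl_def] cl_def by (simp add: algebra_simps)
  qed
  then show thesis using that[of "D * 3 ^ CARD('n)"] D(1) by simp
qed

text \<open>The bound is in the unweighted norm, so the far part only enlarges the constant of the
  subtracted term; that constant depends on \<open>\<eta>\<close>.\<close>

lemma far_pform_bound:
  assumes \<eta>: "0 < \<eta>"
  obtains C where "0 \<le> C" "\<And>P A B f g. finite A \<Longrightarrow> A \<subseteq> L \<Longrightarrow> finite B \<Longrightarrow> B \<subseteq> L \<Longrightarrow>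
     (\<And>k l. P k l \<Longrightarrow> \<eta> * jb k powr \<tau> \<le> norm (k - l)) \<Longrightarrow>
     cmod (pform P A B f g) \<le> C * (sqsum B g + sqsum A f)"
proof -
  obtain C where C: "0 \<le> C" "\<And>k l. k \<in> L \<Longrightarrow> l \<in> L \<Longrightarrow> \<eta> * jb k powr \<tau> \<le> norm (k - l) \<Longrightarrow>
    cmod (fcoef h (\<sigma> k) (k - l)) \<le> C * lweight h (k - l)"
    using far_kernel_bound[OF \<eta>] by blast
  have "cmod (pform P A B f g) \<le> C * 6 ^ CARD('n) * (sqsum B g + sqsum A f)"
    if A: "finite A" "A \<subseteq> L" and B: "finite B" "B \<subseteq> L"
      and P: "\<And>k l. P k l \<Longrightarrow> \<eta> * jb k powr \<tau> \<le> norm (k - l)" for P A B f g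
    unfolding pform_def
  proof (rule schur_test[OF h0 A B _ C(1)])
    fix k l assume "k \<in> A" "l \<in> B"
    moreover have "0 \<le> C * lweight h (k - l)"
      using C(1) by (auto simp: lweight_def intro!: mult_nonneg_nonneg prod_nonneg)
    ultimately show "cmod (if P k l then fcoef h (\<sigma> k) (k - l) else 0) \<le> C * lweight h (k - l)"
      using C(2)[of k l] P[of k l] A B by auto
  qed
  then show thesis using that[of "C * 6 ^ CARD('n)"] C(1) by simp
qed

lemma form_split: "form A B f g = pform P A B f g + pform (\<lambda>k l. \<not> P k l) A B f g"
  unfolding pform_def sform_def sum.distrib[symmetric] by (intro sum.cong refl) simp

lemma pform_split:
  "pform P A B f g = pform (\<lambda>k l. P k l \<and> Q k l) A B f g + pform (\<lambda>k l. P k l \<and> \<not> Q k l) A B f g"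
  unfolding pform_def sum.distrib[symmetric] by (intro sum.cong refl) simp

text \<open>Boundedness from weight m to weight -m, for finite sums. With 1/8,
  \<open>norm_Phi_diff_near\<close> gives a distance of at most 1/2 < 1 after \<open>Phi\<close>, so
  points of non-adjacent cells are far from each other.\<close>

lemma form_bound:
  obtains D where "0 \<le> D" "\<And>A B f g. finite A \<Longrightarrow> A \<subseteq> L \<Longrightarrow> finite B \<Longrightarrow> B \<subseteq> L \<Longrightarrow>
     cmod (form A B f g) \<le> D * (wsum B g + wsum A f)"
proof -
  obtain D where D: "0 \<le> D" "\<And>s R A B f g. finite A \<Longrightarrow> A \<subseteq> L \<Longrightarrow> finite B \<Longrightarrow> B \<subseteq> L \<Longrightarrow>
     cmod (pform (\<lambda>k l. adjacent (cell \<tau> s k) (cell \<tau> s l) \<and> R (cell \<tau> s k) (cell \<tau> s l)) A B f g)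
       \<le> D * (wsum B g + wsum A f)"
    using adjacent_pform_bound by blast
  have "0 < (1 / 8 :: real)" by simp
  then obtain C where C: "0 \<le> C" "\<And>P A B f g. finite A \<Longrightarrow> A \<subseteq> L \<Longrightarrow> finite B \<Longrightarrow> B \<subseteq> L \<Longrightarrow>
     (\<And>k l. P k l \<Longrightarrow> 1 / 8 * jb k powr \<tau> \<le> norm (k - l)) \<Longrightarrow>
     cmod (pform P A B f g) \<le> C * (sqsum B g + sqsum A f)"
    using far_pform_bound by blast
  have "cmod (form A B f g) \<le> (D + C) * (wsum B g + wsum A f)"
    if AB: "finite A" "A \<subseteq> L" "finite B" "B \<subseteq> L" for A B f g
  proof -
    let ?P = "\<lambda>k l :: real ^ 'n. adjacent (cell \<tau> 0 k) (cell \<tau> 0 l)"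
    have far: "1 / 8 * jb k powr \<tau> \<le> norm (k - l)" if "\<not> ?P k l" for k l
    proof (rule ccontr)
      assume "\<not> ?thesis"
      then have "norm (Phi \<tau> k - Phi \<tau> l) \<le> 1 / 2"
        using norm_Phi_diff_near[OF \<tau>, of "1 / 8" k l] by simp
      moreover have "cell \<tau> 0 k \<noteq> cell \<tau> 0 l" using that by (auto simp: adjacent_def)
      ultimately show False using distinct_cells_near(3)[of \<tau> 0 k l "1 / 2"] that by simp
    qed
    have 1: "cmod (pform ?P A B f g) \<le> D * (wsum B g + wsum A f)"
      using D(2)[OF AB, of 0 "\<lambda>_ _. True"] by simp
    have "cmod (pform (\<lambda>k l. \<not> ?P k l) A B f g) \<le> C * (sqsum B g + sqsum A f)"
      by (rule C(2)[OF AB far])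
    also have "\<dots> \<le> C * (wsum B g + wsum A f)"
      using C(1) by (intro mult_left_mono add_mono sqsum_le_wsum)
    finally have 2: "cmod (pform (\<lambda>k l. \<not> ?P k l) A B f g) \<le> C * (wsum B g + wsum A f)" .
    show ?thesis
      unfolding form_split[of A B f g ?P] distrib_right by (rule norm_triangle_le[OF add_mono[OF 1 2]])
  qed
  then show thesis using that[of "D + C"] D C by simp
qed

text \<open>Pigeonhole over \<open>J\<close> shifts of the cell partition: for one of them, which depends on \<open>f\<close>,
  only a small part of the mass of \<open>f\<close> lies near the cell boundaries.\<close>

lemma exists_good_shift:
  assumes A: "finite A" and J: "0 < J" and \<omega>: "2 * \<omega> * real J < 1"
  obtains t where "t < J"
    "real J * wsum (A \<inter> zone \<tau> \<omega> (real t / real J)) f \<le> real CARD('n) * wsum A f"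
proof -
  define Z where "Z t = (zone \<tau> \<omega> (real t / real J) :: (real ^ 'n) set)" for t :: nat
  let ?w = "\<lambda>k. jb k powr (2 * m) * (cmod (f k))\<^sup>2"
  have "(\<Sum>t<J. wsum (A \<inter> Z t) f) = (\<Sum>t<J. \<Sum>k\<in>A. if k \<in> Z t then ?w k else 0)"
    unfolding wsum_def by (intro sum.cong refl sum.inter_restrict A)
  also have "\<dots> = (\<Sum>k\<in>A. real (card {t. t < J \<and> k \<in> Z t}) * ?w k)"
    by (subst sum.swap) (simp add: sum.inter_filter[symmetric])
  also have "\<dots> \<le> (\<Sum>k\<in>A. real CARD('n) * ?w k)"
    using card_zone_shifts_le[OF J \<omega>] unfolding Z_def by (intro sum_mono mult_right_mono) auto
  also have "\<dots> = real CARD('n) * wsum A f" by (simp add: wsum_def sum_distrib_left)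
  finally have le: "(\<Sum>t<J. wsum (A \<inter> Z t) f) \<le> real CARD('n) * wsum A f" .
  have "\<exists>t<J. real J * wsum (A \<inter> Z t) f \<le> real CARD('n) * wsum A f"
  proof (rule ccontr)
    assume "\<not> ?thesis"
    then have "(\<Sum>t<J. real CARD('n) * wsum A f) < (\<Sum>t<J. real J * wsum (A \<inter> Z t) f)"
      using J by (intro sum_strict_mono) (auto simp: not_le lessThan_empty_iff)
    then have "real J * (real CARD('n) * wsum A f) < real J * (\<Sum>t<J. wsum (A \<inter> Z t) f)"
      by (simp add: sum_distrib_left)
    then show False using le J by simp
  qed
  then show thesis using that unfolding Z_def by blast
qed

text \<open>Pairs are of three kinds: same cell, both near walls of adjacent cells, and far. The
  order of choices matters: \<open>c\<close> and \<open>D\<close> depend neither on the shift nor on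
  the wall thickness, so \<open>J\<close> comes from them, \<open>\<eta>\<close> from
  \<open>J\<close> and \<open>C2\<close> from \<open>\<eta>\<close>; only the shift depends on
  \<open>f\<close>.\<close>

lemma garding_finite:
  assumes ell: "elliptic_symbol h (2 * m) \<sigma>"
    and pos: "finite {k \<in> L. \<not> (\<forall>\<theta>. \<sigma> k \<theta> \<in> \<real>\<^sub>\<ge>\<^sub>0)}"
  obtains c C where "0 < c" "0 \<le> C"
    "\<And>A f. finite A \<Longrightarrow> A \<subseteq> L \<Longrightarrow> Re (form A A f f) \<ge> c * wsum A f - C * sqsum A f"
proof -
  have "0 \<le> 2 * real CARD('n)" by simp
  then obtain c C1 where c: "0 < c" "0 \<le> C1"
    "\<And>A f. cluster (2 * real CARD('n)) A \<Longrightarrow> Re (form A A f f) \<ge> c * wsum A f - C1 * sqsum A f"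
    using cluster_form_lower[OF _ ell pos] by blast
  obtain D where D: "0 \<le> D" "\<And>s R A B f g. finite A \<Longrightarrow> A \<subseteq> L \<Longrightarrow> finite B \<Longrightarrow> B \<subseteq> L \<Longrightarrow>
     cmod (pform (\<lambda>k l. adjacent (cell \<tau> s k) (cell \<tau> s l) \<and> R (cell \<tau> s k) (cell \<tau> s l)) A B f g)
       \<le> D * (wsum B g + wsum A f)"
    using adjacent_pform_bound by blast
  \<comment> \<open>The wall part costs 2 D times the boundary mass, and a good shift leaves at most
    the fraction n/J of the total, n being the dimension; with 4 D n \<le> c J this takes at most
    half of \<open>c\<close>.\<close>
  obtain J' :: nat where J': "4 * D * real CARD('n) / c \<le> real J'"
    using real_arch_simple by blast
  define J where "J = Suc J'"
  have J: "0 < J" "4 * D * real CARD('n) \<le> c * real J"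
    using J' c(1) by (auto simp: J_def field_simps)
  \<comment> \<open>Then 2 \<omega> J = 1/2 < 1, as the pigeonhole argument needs; the 4 in
    \<open>\<omega>\<close> is the one of \<open>norm_Phi_diff_near\<close>.\<close>
  define \<eta> where "\<eta> = 1 / (16 * real J)"
  define \<omega> where "\<omega> = 4 * \<eta>"
  have \<eta>: "0 < \<eta>" "\<eta> \<le> 1 / 2" using J by (auto simp: \<eta>_def field_simps)
  have \<omega>: "\<omega> < 1" "2 * \<omega> * real J < 1" using J by (auto simp: \<omega>_def \<eta>_def field_simps)
  obtain C2 where C2: "0 \<le> C2" "\<And>P A B f g. finite A \<Longrightarrow> A \<subseteq> L \<Longrightarrow> finite B \<Longrightarrow> B \<subseteq> L \<Longrightarrow>
     (\<And>k l. P k l \<Longrightarrow> \<eta> * jb k powr \<tau> \<le> norm (k - l)) \<Longrightarrow>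
     cmod (pform P A B f g) \<le> C2 * (sqsum B g + sqsum A f)"
    using far_pform_bound[OF \<eta>(1)] by blast
  have "Re (form A A f f) \<ge> c / 2 * wsum A f - (C1 + 2 * C2) * sqsum A f"
    if A: "finite A" "A \<subseteq> L" for A f
  proof -
    obtain t where t: "real J * wsum (A \<inter> zone \<tau> \<omega> (real t / real J)) f \<le> real CARD('n) * wsum A f"
      using exists_good_shift[OF A(1) J(1) \<omega>(2)] by blast
    define s where "s = real t / real J"
    define Z where "Z = A \<inter> zone \<tau> \<omega> s"
    define cl where "cl = (cell \<tau> s :: real ^ 'n \<Rightarrow> _)"
    let ?S = "\<lambda>k l. cl k = cl l"
    let ?N = "\<lambda>k l. adjacent (cl k) (cl l) \<and> k \<in> zone \<tau> \<omega> s \<and> l \<in> zone \<tau> \<omega> s"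
    have eq: "form A A f f = pform ?S A A f f + pform (\<lambda>k l. \<not> ?S k l \<and> ?N k l) A A f f
        + pform (\<lambda>k l. \<not> ?S k l \<and> \<not> ?N k l) A A f f"
      using form_split[of A A f f ?S] pform_split[of "\<lambda>k l. \<not> ?S k l" A A f f ?N] by simp
    define Ac where "Ac c = {k\<in>A. cl k = c}" for c
    have diag: "pform ?S A A f f = (\<Sum>c\<in>cl ` A. form (Ac c) (Ac c) f f)"
    proof -
      have "pform ?S A A f f = (\<Sum>c\<in>cl ` A. \<Sum>k\<in>Ac c. \<Sum>l\<in>A.
          (if cl k = cl l then fcoef h (\<sigma> k) (k - l) else 0) * f l * cnj (f k))"
        unfolding pform_def Ac_def cl_def by (rule sum_cells[OF A(1)])
      also have "\<dots> = (\<Sum>c\<in>cl ` A. form (Ac c) (Ac c) f f)"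
        unfolding sform_def
      proof (rule sum.cong[OF refl], rule sum.cong[OF refl])
        fix c k assume "k \<in> Ac c"
        then show "(\<Sum>l\<in>A. (if cl k = cl l then fcoef h (\<sigma> k) (k - l) else 0) * f l * cnj (f k))
           = (\<Sum>l\<in>Ac c. fcoef h (\<sigma> k) (k - l) * f l * cnj (f k))"
          using A(1) unfolding Ac_def by (intro sum.mono_neutral_cong_right) auto
      qed
      finally show ?thesis .
    qed
    have clus: "cluster (2 * real CARD('n)) (Ac c)" for c
      unfolding cluster_def
    proof (intro conjI ballI)
      fix k l assume "k \<in> Ac c" "l \<in> Ac c"
      then show "norm (Phi \<tau> k - Phi \<tau> l) \<le> 2 * real CARD('n)"
        by (intro adjacent_cells_Phi[where s = s]) (auto simp: adjacent_def Ac_def cl_def)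
    qed (use A in \<open>auto simp: Ac_def\<close>)
    have "c * wsum A f - C1 * sqsum A f = (\<Sum>d\<in>cl ` A. c * wsum (Ac d) f - C1 * sqsum (Ac d) f)"
    proof -
      have "wsum A f = (\<Sum>d\<in>cl ` A. wsum (Ac d) f)" "sqsum A f = (\<Sum>d\<in>cl ` A. sqsum (Ac d) f)"
        unfolding wsum_def sqsum_def Ac_def cl_def by (rule sum_cells[OF A(1)])+
      then show ?thesis by (simp add: sum_distrib_left sum_subtractf)
    qed
    also have "\<dots> \<le> (\<Sum>d\<in>cl ` A. Re (form (Ac d) (Ac d) f f))"
      by (intro sum_mono c(3) clus)
    finally have 1: "c * wsum A f - C1 * sqsum A f \<le> Re (pform ?S A A f f)"
      by (simp add: diag)
    \<comment> \<open>Both points of such a pair lie in the zone, so both sums may be restricted to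
      \<open>Z\<close> and the bound involves only the boundary mass.\<close>
    have "pform (\<lambda>k l. \<not> ?S k l \<and> ?N k l) A A f f
       = pform (\<lambda>k l. adjacent (cell \<tau> s k) (cell \<tau> s l) \<and> cell \<tau> s k \<noteq> cell \<tau> s l) Z Z f f"
    proof -
      have "pform (\<lambda>k l. \<not> ?S k l \<and> ?N k l) A A f f = (\<Sum>k\<in>Z. \<Sum>l\<in>A.
          (if \<not> ?S k l \<and> ?N k l then fcoef h (\<sigma> k) (k - l) else 0) * f l * cnj (f k))"
        unfolding pform_def Z_def using A(1) by (intro sum.mono_neutral_right) auto
      also have "\<dots> = (\<Sum>k\<in>Z. \<Sum>l\<in>Z. (if adjacent (cell \<tau> s k) (cell \<tau> s l) \<and> cell \<tau> s k \<noteq> cell \<tau> s l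
          then fcoef h (\<sigma> k) (k - l) else 0) * f l * cnj (f k))"
        unfolding Z_def cl_def using A(1)
        by (intro sum.cong refl sum.mono_neutral_cong_right) auto
      finally show ?thesis unfolding pform_def .
    qed
    then have "cmod (pform (\<lambda>k l. \<not> ?S k l \<and> ?N k l) A A f f) \<le> D * (wsum Z f + wsum Z f)"
      using D(2)[of Z Z s "(\<noteq>)" f f] A by (simp add: Z_def le_infI1)
    also have "\<dots> = 2 * D * wsum Z f" by simp
    also have "\<dots> \<le> c / 2 * wsum A f"
    proof -
      have "real J * (2 * D * wsum Z f) = 2 * D * (real J * wsum Z f)" by simp
      also have "\<dots> \<le> 2 * D * (real CARD('n) * wsum A f)"
        using t D(1) unfolding Z_def s_def by (intro mult_left_mono) auto
      also have "\<dots> = (4 * D * real CARD('n)) / 2 * wsum A f" by simp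
      also have "\<dots> \<le> (c * real J) / 2 * wsum A f"
        using J(2) by (intro mult_right_mono wsum_nonneg) simp
      also have "\<dots> = real J * (c / 2 * wsum A f)" by simp
      finally show ?thesis using J(1) by simp
    qed
    finally have 2: "cmod (pform (\<lambda>k l. \<not> ?S k l \<and> ?N k l) A A f f) \<le> c / 2 * wsum A f" .
    \<comment> \<open>Different cells at a distance below the threshold would be adjacent, with both
      points in the zone.\<close>
    have far: "\<eta> * jb k powr \<tau> \<le> norm (k - l)" if "\<not> ?S k l \<and> \<not> ?N k l" for k l
    proof (rule ccontr)
      assume "\<not> ?thesis"
      then have "norm (Phi \<tau> k - Phi \<tau> l) \<le> \<omega>"
        unfolding \<omega>_def by (intro norm_Phi_diff_near \<tau> \<eta>(2)) simp
      then show False using distinct_cells_near[of \<tau> s k l \<omega>] that \<omega>(1) by (auto simp: cl_def)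
    qed
    have 3: "cmod (pform (\<lambda>k l. \<not> ?S k l \<and> \<not> ?N k l) A A f f) \<le> C2 * (sqsum A f + sqsum A f)"
      by (rule C2(2)[OF A A far])
    have "Re (form A A f f) \<ge> Re (pform ?S A A f f) - cmod (pform (\<lambda>k l. \<not> ?S k l \<and> ?N k l) A A f f)
        - cmod (pform (\<lambda>k l. \<not> ?S k l \<and> \<not> ?N k l) A A f f)"
      unfolding eq plus_complex.sel
      using abs_Re_le_cmod[of "pform (\<lambda>k l. \<not> ?S k l \<and> ?N k l) A A f f"]
        abs_Re_le_cmod[of "pform (\<lambda>k l. \<not> ?S k l \<and> \<not> ?N k l) A A f f"] by linarith
    then show ?thesis using 1 2 3 by (simp add: algebra_simps)
  qed
  moreover have "0 < c / 2" "0 \<le> C1 + 2 * C2" using c C2 by auto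
  ultimately show thesis using that by blast
qed

subsection \<open>Passage to the limit\<close>

lemma form_scale: "form A B f (\<lambda>l. c * g l) = c * form A B f g"
  by (simp add: sform_def sum_distrib_left mult_ac)

lemma wsum_scale: "wsum B (\<lambda>l. of_real c * g l) = c\<^sup>2 * wsum B g"
  by (simp add: wsum_def sum_distrib_left norm_mult power_mult_distrib mult_ac)

text \<open>Scaling \<open>g\<close> against \<open>f\<close> puts free weights on the two terms of
  the additive bound, which replaces Cauchy-Schwarz.\<close>

lemma form_bound_scaled:
  assumes D: "0 \<le> D" "\<And>A B f g. finite A \<Longrightarrow> A \<subseteq> L \<Longrightarrow> finite B \<Longrightarrow> B \<subseteq> L \<Longrightarrow>
     cmod (form A B f g) \<le> D * (wsum B g + wsum A f)"
    and AB: "finite A" "A \<subseteq> L" "finite B" "B \<subseteq> L" and c: "0 < c"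
  shows "cmod (form A B f g) \<le> D * (c * wsum B g + wsum A f / c)"
proof -
  have "c * cmod (form A B f g) = cmod (form A B f (\<lambda>l. of_real c * g l))"
    using c by (simp add: form_scale norm_mult)
  also have "\<dots> \<le> D * (c\<^sup>2 * wsum B g + wsum A f)"
    using D(2)[OF AB, of f "\<lambda>l. of_real c * g l"] by (simp add: wsum_scale)
  also have "\<dots> = c * (D * (c * wsum B g + wsum A f / c))"
    using c by (simp add: field_simps power2_eq_square)
  finally show ?thesis using c by simp
qed

text \<open>Phase rotation: moving such a factor into a test function turns bounds on sums into
  bounds on sums of absolute values.\<close>

lemma cnj_sgn_mult: "cnj (sgn z) * z = of_real (cmod z)"
proof (cases "z = 0")
  case False
  then show ?thesis
    using complex_norm_square[of z]
    by (simp add: sgn_div_norm scaleR_conv_of_real divide_simps power2_eq_square mult_ac)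
qed simp

lemma Op_eq: "k \<in> L \<Longrightarrow> Op h \<sigma> g k = (\<Sum>\<^sub>\<infinity>l\<in>L. fcoef h (\<sigma> k) (k - l) * g l)"
  unfolding Op_def by (intro infsum_cong) (simp add: op_kernel_eq_fcoef cont)

context
  fixes g :: "real ^ 'n \<Rightarrow> complex"
  assumes g: "g \<in> l2s h m"
begin

definition "W = (\<Sum>\<^sub>\<infinity>k\<in>L. jb k powr (2 * m) * (cmod (g k))\<^sup>2)"

definition "S = (\<Sum>\<^sub>\<infinity>k\<in>L. (cmod (g k))\<^sup>2)"

lemma summable_W: "(\<lambda>k. jb k powr (2 * m) * (cmod (g k))\<^sup>2) summable_on L"
  using g by (simp add: l2s_def)

lemma wsum_tendsto: "((\<lambda>A. wsum A g) \<longlongrightarrow> W) (finite_subsets_at_top L)"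
  unfolding W_def wsum_def by (rule infsum_tendsto[OF summable_W])

lemma wsum_le_W: "finite A \<Longrightarrow> A \<subseteq> L \<Longrightarrow> wsum A g \<le> W"
  unfolding W_def wsum_def by (rule finite_sum_le_infsum[OF summable_W]) auto

lemma summable_S: "(\<lambda>k. (cmod (g k))\<^sup>2) summable_on L"
proof (rule nonneg_bdd_above_summable_on)
  show "bdd_above (sum (\<lambda>k. (cmod (g k))\<^sup>2) ` {F. F \<subseteq> L \<and> finite F})"
    unfolding bdd_above_def
    using order_trans[OF sqsum_le_wsum wsum_le_W] by (auto simp: sqsum_def)
qed auto

lemma sqsum_tendsto: "((\<lambda>A. sqsum A g) \<longlongrightarrow> S) (finite_subsets_at_top L)"
  unfolding S_def sqsum_def by (rule infsum_tendsto[OF summable_S])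

lemma W_eq: "W = (l2s_norm h m g)\<^sup>2"
  unfolding W_def l2s_norm_def by (simp add: infsum_nonneg)

lemma S_eq: "S = (l2s_norm h 0 g)\<^sup>2"
proof -
  have "jb k powr (2 * 0) = 1" for k :: "real ^ 'n"
    using jb_pos[of k] by (simp del: jb_pos)
  then show ?thesis
    unfolding S_def l2s_norm_def by (simp only: mult_1_left) (simp add: infsum_nonneg)
qed

text \<open>\<open>form_bound\<close> is tested on the single row \<open>k\<close>, with the phases
  of the summands moved into \<open>g\<close>; this does not increase \<open>wsum\<close>.\<close>

lemma row_summable:
  assumes k: "k \<in> L"
  shows "(\<lambda>l. fcoef h (\<sigma> k) (k - l) * g l) summable_on L"
proof (rule abs_summable_summable, rule nonneg_bdd_above_summable_on)
  obtain D where D: "0 \<le> D" "\<And>A B f g. finite A \<Longrightarrow> A \<subseteq> L \<Longrightarrow> finite B \<Longrightarrow> B \<subseteq> L \<Longrightarrow>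
     cmod (form A B f g) \<le> D * (wsum B g + wsum A f)"
    using form_bound by blast
  let ?z = "\<lambda>l. fcoef h (\<sigma> k) (k - l) * g l"
  have "(\<Sum>l\<in>B. cmod (?z l)) \<le> D * (W + jb k powr (2 * m))" if B: "finite B" "B \<subseteq> L" for B
  proof -
    let ?g = "\<lambda>l. cnj (sgn (?z l)) * g l"
    have "form {k} B (\<lambda>_. 1) ?g = (\<Sum>l\<in>B. of_real (cmod (?z l)))"
    proof -
      have "a * (u * b) * cnj 1 = u * (a * b)" for a u b :: complex by simp
      then show ?thesis by (simp only: sform_def cnj_sgn_mult[symmetric]) simp
    qed
    then have "cmod (form {k} B (\<lambda>_. 1) ?g) = (\<Sum>l\<in>B. cmod (?z l))"
      by (simp add: of_real_sum[symmetric] sum_nonneg del: of_real_sum)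
    moreover have "cmod (form {k} B (\<lambda>_. 1) ?g) \<le> D * (wsum B ?g + wsum {k} (\<lambda>_. 1))"
      using k B by (intro D(2)) auto
    moreover have "wsum B ?g \<le> wsum B g"
      unfolding wsum_def by (intro sum_mono mult_left_mono power_mono) (auto simp: norm_mult norm_sgn)
    then have "D * (wsum B ?g + wsum {k} (\<lambda>_. 1)) \<le> D * (W + jb k powr (2 * m))"
      using wsum_le_W[OF B] D(1) by (intro mult_left_mono) (auto simp: wsum_def)
    ultimately show ?thesis by linarith
  qed
  then show "bdd_above (sum (\<lambda>l. cmod (?z l)) ` {F. F \<subseteq> L \<and> finite F})"
    unfolding bdd_above_def by auto
qed auto

lemma form_tendsto:
  assumes A: "finite A" "A \<subseteq> L"
  shows "((\<lambda>B. form A B f g) \<longlongrightarrow> (\<Sum>k\<in>A. Op h \<sigma> g k * cnj (f k))) (finite_subsets_at_top L)"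
  unfolding sform_def
proof (rule tendsto_sum)
  fix k assume "k \<in> A"
  then have k: "k \<in> L" using A by auto
  have "((\<lambda>B. (\<Sum>l\<in>B. fcoef h (\<sigma> k) (k - l) * g l) * cnj (f k)) \<longlongrightarrow> Op h \<sigma> g k * cnj (f k))
      (finite_subsets_at_top L)"
    unfolding Op_eq[OF k] by (intro tendsto_mult infsum_tendsto[OF row_summable[OF k]] tendsto_const)
  then show "((\<lambda>B. \<Sum>l\<in>B. fcoef h (\<sigma> k) (k - l) * g l * cnj (f k)) \<longlongrightarrow> Op h \<sigma> g k * cnj (f k))
      (finite_subsets_at_top L)"
    by (simp add: sum_distrib_right)
qed

text \<open>Now the phases go into the row function; the bound for finite sections survives the
  limit in the columns.\<close>

lemma pairing_summable: "(\<lambda>k. Op h \<sigma> g k * cnj (g k)) summable_on L"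
proof (rule abs_summable_summable, rule nonneg_bdd_above_summable_on)
  obtain D where D: "0 \<le> D" "\<And>A B f g. finite A \<Longrightarrow> A \<subseteq> L \<Longrightarrow> finite B \<Longrightarrow> B \<subseteq> L \<Longrightarrow>
     cmod (form A B f g) \<le> D * (wsum B g + wsum A f)"
    using form_bound by blast
  let ?z = "\<lambda>k. Op h \<sigma> g k * cnj (g k)"
  have "(\<Sum>k\<in>A. cmod (?z k)) \<le> D * (W + W)" if A: "finite A" "A \<subseteq> L" for A
  proof -
    let ?f = "\<lambda>k. sgn (?z k) * g k"
    have "wsum A ?f \<le> wsum A g"
      unfolding wsum_def by (intro sum_mono mult_left_mono power_mono) (auto simp: norm_mult norm_sgn)
    then have f: "wsum A ?f \<le> W" using wsum_le_W[OF A] by simp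
    have "cmod (\<Sum>k\<in>A. Op h \<sigma> g k * cnj (?f k)) \<le> D * (W + W)"
    proof (rule Lim_norm_ubound[OF _ form_tendsto[OF A]])
      show "\<forall>\<^sub>F B in finite_subsets_at_top L. norm (form A B ?f g) \<le> D * (W + W)"
      proof (rule eventually_finite_subsets_at_top_weakI)
        fix B assume B: "finite B" "B \<subseteq> L"
        have "D * (wsum B g + wsum A ?f) \<le> D * (W + W)"
          using f wsum_le_W[OF B] by (intro mult_left_mono add_mono D(1))
        then show "norm (form A B ?f g) \<le> D * (W + W)"
          using D(2)[OF A B, of ?f g] by linarith
      qed
    qed simp
    also have "(\<Sum>k\<in>A. Op h \<sigma> g k * cnj (?f k)) = of_real (\<Sum>k\<in>A. cmod (?z k))"
    proof -
      have "a * cnj (u * b) = cnj u * (a * cnj b)" for a u b :: complex by simp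
      then show ?thesis by (simp only: of_real_sum cnj_sgn_mult[symmetric])
    qed
    finally show ?thesis by (simp add: sum_nonneg del: of_real_sum)
  qed
  then show "bdd_above (sum (\<lambda>k. cmod (?z k)) ` {F. F \<subseteq> L \<and> finite F})"
    unfolding bdd_above_def by auto
qed auto

text \<open>The pairing sums over all columns first, so finite squares A \<times> A are not its
  partial sums. Completing them to A \<times> B adds columns in the tail, bounded with weight
  \<open>t\<close> on the tail mass, which vanishes as A grows, and 1/t on the mass of A. The loss
  D/t remains.\<close>

lemma pairing_ge:
  assumes D: "0 \<le> D" "\<And>A B f g. finite A \<Longrightarrow> A \<subseteq> L \<Longrightarrow> finite B \<Longrightarrow> B \<subseteq> L \<Longrightarrow>
     cmod (form A B f g) \<le> D * (wsum B g + wsum A f)"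
    and c: "\<And>A f. finite A \<Longrightarrow> A \<subseteq> L \<Longrightarrow> Re (form A A f f) \<ge> c * wsum A f - C * sqsum A f"
    and t: "0 < t"
  shows "Re (l2_pairing h (Op h \<sigma> g) g) \<ge> (c - D / t) * W - C * S"
proof -
  let ?F = "finite_subsets_at_top L"
  have fin: "Re (\<Sum>k\<in>A. Op h \<sigma> g k * cnj (g k))
      \<ge> c * wsum A g - C * sqsum A g - D * (t * (W - wsum A g) + wsum A g / t)"
    if A: "finite A" "A \<subseteq> L" for A
  proof (rule tendsto_lowerbound[OF tendsto_Re[OF form_tendsto[OF A]]])
    show "\<forall>\<^sub>F B in ?F. c * wsum A g - C * sqsum A g - D * (t * (W - wsum A g) + wsum A g / t)
        \<le> Re (form A B g g)"
      unfolding eventually_finite_subsets_at_top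
    proof (intro exI[of _ A] conjI allI impI A)
      fix B assume "finite B \<and> A \<subseteq> B \<and> B \<subseteq> L"
      then have B: "finite B" "A \<subseteq> B" "B \<subseteq> L" by auto
      have split: "form A B g g = form A A g g + form A (B - A) g g"
        unfolding sform_def sum.distrib[symmetric]
        by (intro sum.cong refl) (simp add: sum.subset_diff[OF B(2,1)])
      have "wsum B g = wsum (B - A) g + wsum A g"
        unfolding wsum_def by (rule sum.subset_diff[OF B(2,1)])
      then have tail: "wsum (B - A) g \<le> W - wsum A g" using wsum_le_W[OF B(1,3)] by simp
      have "cmod (form A (B - A) g g) \<le> D * (t * wsum (B - A) g + wsum A g / t)"
        using B A by (intro form_bound_scaled D t) auto
      also have "\<dots> \<le> D * (t * (W - wsum A g) + wsum A g / t)"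
        using D(1) t tail by (intro mult_left_mono add_right_mono) auto
      finally show "c * wsum A g - C * sqsum A g - D * (t * (W - wsum A g) + wsum A g / t)
        \<le> Re (form A B g g)"
        using c[OF A, of g] abs_Re_le_cmod[of "form A (B - A) g g"] unfolding split plus_complex.sel
        by linarith
    qed
  qed simp
  have "c * W - C * S - D * (t * (W - W) + W / t) \<le> Re (l2_pairing h (Op h \<sigma> g) g)"
  proof (rule tendsto_le[OF finite_subsets_at_top_neq_bot])
    show "((\<lambda>A. Re (\<Sum>k\<in>A. Op h \<sigma> g k * cnj (g k))) \<longlongrightarrow> Re (l2_pairing h (Op h \<sigma> g) g)) ?F"
      unfolding l2_pairing_def by (intro tendsto_Re infsum_tendsto pairing_summable)
    show "((\<lambda>A. c * wsum A g - C * sqsum A g - D * (t * (W - wsum A g) + wsum A g / t))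
        \<longlongrightarrow> c * W - C * S - D * (t * (W - W) + W / t)) ?F"
      by (intro tendsto_intros wsum_tendsto sqsum_tendsto) (use t in auto)
    show "\<forall>\<^sub>F A in ?F. c * wsum A g - C * sqsum A g - D * (t * (W - wsum A g) + wsum A g / t)
        \<le> Re (\<Sum>k\<in>A. Op h \<sigma> g k * cnj (g k))"
      by (rule eventually_finite_subsets_at_top_weakI) (rule fin)
  qed
  then show ?thesis by (simp add: algebra_simps)
qed

end

lemma garding:
  assumes ell: "elliptic_symbol h (2 * m) \<sigma>"
    and pos: "finite {k \<in> L. \<not> (\<forall>\<theta>. \<sigma> k \<theta> \<in> \<real>\<^sub>\<ge>\<^sub>0)}"
  shows "\<exists>C\<^sub>0>0. \<exists>C\<^sub>1>0. \<forall>g \<in> l2s h m.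
    Re (l2_pairing h (Op h \<sigma> g) g) \<ge> C\<^sub>0 * (l2s_norm h m g)\<^sup>2 - C\<^sub>1 * (l2s_norm h 0 g)\<^sup>2"
proof -
  obtain c C where c: "0 < c" "0 \<le> C"
    "\<And>A f. finite A \<Longrightarrow> A \<subseteq> L \<Longrightarrow> Re (form A A f f) \<ge> c * wsum A f - C * sqsum A f"
    using garding_finite[OF ell pos] by blast
  obtain D where D: "0 \<le> D" "\<And>A B f g. finite A \<Longrightarrow> A \<subseteq> L \<Longrightarrow> finite B \<Longrightarrow> B \<subseteq> L \<Longrightarrow>
     cmod (form A B f g) \<le> D * (wsum B g + wsum A f)"
    using form_bound by blast
  \<comment> \<open>Large enough for D/t \<le> c/2; the summand 1 keeps \<open>t\<close> positive
    when \<open>D\<close> is 0.\<close>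
  define t where "t = 2 * (D + 1) / c"
  have t: "0 < t" using c D by (simp add: t_def)
  have "D / t \<le> c / 2" using c D by (simp add: t_def field_simps)
  have "Re (l2_pairing h (Op h \<sigma> g) g) \<ge> c / 2 * (l2s_norm h m g)\<^sup>2 - (C + 1) * (l2s_norm h 0 g)\<^sup>2"
    if g: "g \<in> l2s h m" for g
  proof -
    have "(c - D / t) * (l2s_norm h m g)\<^sup>2 - C * (l2s_norm h 0 g)\<^sup>2 \<le> Re (l2_pairing h (Op h \<sigma> g) g)"
      using pairing_ge[OF g D c(3) t] by (simp only: W_eq[OF g] S_eq[OF g])
    moreover have "c / 2 * (l2s_norm h m g)\<^sup>2 \<le> (c - D / t) * (l2s_norm h m g)\<^sup>2"
      using \<open>D / t \<le> c / 2\<close> by (intro mult_right_mono) auto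
    moreover have "C * (l2s_norm h 0 g)\<^sup>2 \<le> (C + 1) * (l2s_norm h 0 g)\<^sup>2"
      by (intro mult_right_mono) auto
    ultimately show ?thesis by linarith
  qed
  moreover have "0 < c / 2" "0 < C + 1" using c by auto
  ultimately show ?thesis by blast
qed

end

theorem theorem6p11:
  fixes h \<rho> \<delta> m :: real
    and \<sigma> :: "real ^ 'n::finite \<Rightarrow> real ^ 'n \<Rightarrow> complex"
    and P :: "(real ^ 'n \<Rightarrow> complex) \<Rightarrow> real ^ 'n \<Rightarrow> complex"
  assumes "0 < h" "h \<le> 1"
    and "0 \<le> \<delta>" "\<delta> < \<rho>" "\<rho> \<le> 1"
    and "0 < m"
    and "\<sigma> \<in> symbol_class h (2 * m) \<rho> \<delta>"
    and "P = Op h \<sigma>"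
    and "elliptic_symbol h (2 * m) \<sigma>"
    and "finite {k \<in> hlattice h. \<not> (\<forall>\<theta>. \<sigma> k \<theta> \<in> \<real>\<^sub>\<ge>\<^sub>0)}"
  shows "\<exists>C\<^sub>0>0. \<exists>C\<^sub>1>0. \<forall>g \<in> l2s h m.
    Re (l2_pairing h (P g) g) \<ge> C\<^sub>0 * (l2s_norm h m g)\<^sup>2 - C\<^sub>1 * (l2s_norm h 0 g)\<^sup>2"
proof -
  \<comment> \<open>The midpoint lies strictly between \<open>\<delta>\<close> and
    \<open>\<rho>\<close>, as the scale exponent of the cells must.\<close>
  interpret semiclassical_symbol h m \<rho> \<delta> "(\<delta> + \<rho>) / 2" \<sigma>
    by unfold_locales (use assms in auto)
  show ?thesis
    unfolding \<open>P = Op h \<sigma>\<close> by (rule garding) (use assms in auto)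
qed

end
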